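(* Let $A\in\mathbb{R}^{n\times n}$, $B\in\mathbb{R}^{n\times m}$, $H\in\mathbb{R}^{n\times q}$, $C\in\mathbb{R}^{p\times n}$, $D_y\in\mathbb{R}^{p\times m}$, $G_y\in\mathbb{R}^{p\times q}$, $E\in\mathbb{R}^{r\times n}$, $D_z\in\mathbb{R}^{r\times m}$, $G_z\in\mathbb{R}^{r\times q}$, and assume that the pair $(A,B)$ is (asymptotically) stabilizable and the pair $(C,A)$ is (asymptotically) detectable with respect to $\mathbb{C}_g$. Let $\mathcal{V}_m$ and $\mathcal{S}_M$ be the subspaces defined in the context. Then the disturbance decoupling problem by dynamic output feedback with stability (Problem 2 in the context) is solvable if and only if there exists a matrix $K\in\mathbb{R}^{m\times p}$ such that all of the following hold: (A) $\operatorname{im}\begin{bmatrix} H \\ G_z \end{bmatrix}\subseteq(\mathcal{V}^\star_{(A,B,E,D_z)}\oplus 0_{\mathcal{Z}})+\operatorname{im}\begin{bmatrix} B \\ D_z \end{bmatrix}$; (B) $\ker[\,E\ \ G_z\,]\supseteq(\mathcal{S}^\star_{(A,H,C,G_y)}\oplus\mathcal{W})\cap\ker[\,C\ \ G_y\,]$; (C) $\mathcal{S}^\star_{(A,H,C,G_y)}\subseteq\mathcal{V}^\star_{(A,B,E,D_z)}$; (D) $\mathcal{V}_m+\mathcal{S}_M$ is an internally stabilizable $(A,B,E,D_z)$-output nulling subspace; (E) $\mathcal{S}_M$ is an externally detectable $(A,H,C,G_y)$-input containing subspace; (F) $I+KD_y$ is non-singular, and $K$ satisfies $$\begin{bmatrix}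 A+BKC & H+BKG_y \\ E+D_zKC & G_z+D_zKG_y \end{bmatrix}(\mathcal{S}^\star_{(A,H,C,G_y)}\oplus\mathcal{W})\subseteq \mathcal{V}^\star_{(A,B,E,D_z)}\oplus 0_{\mathcal{Z}}.$$
   Context: Notation: $\mathcal{X}=\mathbb{R}^n$, $\mathcal{U}=\mathbb{R}^m$, $\mathcal{W}=\mathbb{R}^q$, $\mathcal{Y}=\mathbb{R}^p$, $\mathcal{Z}=\mathbb{R}^r$; $0_{\mathcal{Z}}$ is the zero subspace of $\mathcal{Z}$; $\mathcal{S}\oplus\mathcal{W}$ is the external direct sum (product) $\{\begin{bmatrix} s \\ w \end{bmatrix}: s\in\mathcal{S}, w\in\mathcal{W}\}$. $\mathbb{C}_g$ is the open left half complex plane (continuous time) or the open unit disc (discrete time); the result holds in either case. $(A,B)$ is stabilizable if $\sigma(A+BF)\subset\mathbb{C}_g$ for some real $F$; $(C,A)$ is detectable if $\sigma(A+GC)\subset\mathbb{C}_g$ for some real $G$. For a map $M$ and $M$-invariant $\mathcal{J}$, $\sigma(M|\mathcal{J})$ and $\sigma(M|\mathcal{X}/\mathcal{J})$ are the spectra of the restriction and of the map induced on the quotient. For a generic real quadruple $(\mathbf A,\mathbf B,\mathbf C,\mathbf D)$ with state space $\mathcal{X}$, input space $\mathbf U$, output space $\mathbf Y$: - $\mathcal{V}\subseteq\mathcal{X}$ is output nulling if $\begin{bmatrix}\mathbf A \\ \mathbf C\end{bmatrix}\mathcal{V}\subseteq(\mathcal{V}\oplus 0_{\mathbf Y})+\operatorname{im}\begin{bmatrix}\mathbf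 B \\ \mathbf D\end{bmatrix}$; equivalently there is a matrix $F$ (an output nulling friend of $\mathcal{V}$) with $\begin{bmatrix}\mathbf A+\mathbf BF \\ \mathbf C+\mathbf DF\end{bmatrix}\mathcal{V}\subseteq\mathcal{V}\oplus 0_{\mathbf Y}$. It is internally stabilizable if some output nulling friend $F$ satisfies $\sigma(\mathbf A+\mathbf BF|\mathcal{V})\subset\mathbb{C}_g$. - $\mathcal{S}\subseteq\mathcal{X}$ is input containing if $[\,\mathbf A\ \ \mathbf B\,]\big((\mathcal{S}\oplus\mathbf U)\cap\ker[\,\mathbf C\ \ \mathbf D\,]\big)\subseteq\mathcal{S}$; equivalently there is a matrix $G$ (an input containing friend of $\mathcal{S}$) with $[\,\mathbf A+G\mathbf C\ \ \mathbf B+G\mathbf D\,](\mathcal{S}\oplus\mathbf U)\subseteq\mathcal{S}$. It is externally detectable if some input containing friend $G$ satisfies $\sigma(\mathbf A+G\mathbf C|\mathcal{X}/\mathcal{S})\subset\mathbb{C}_g$. - $\mathcal{V}^\star_{(\mathbf A,\mathbf B,\mathbf C,\mathbf D)}$ is the largest output nulling subspace and $\mathcal{S}^\star_{(\mathbf A,\mathbf B,\mathbf C,\mathbf D)}$ the smallest input containing subspace. Define $\mathcal{V}_m=\mathcal{V}^\star_{(A,[B\ H],E,[D_z\ G_z])}\cap\mathcal{S}^\star_{(A,[B\ H],E,[D_z\ G_z])}$ and $\mathcal{S}_M=\mathcal{V}^\star_{(A,H,\left[\begin{smallmatrix} C \\ E \end{smallmatrix}\right],\left[\begin{smallmatrix}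 G_y \\ G_z \end{smallmatrix}\right])}+\mathcal{S}^\star_{(A,H,\left[\begin{smallmatrix} C \\ E \end{smallmatrix}\right],\left[\begin{smallmatrix} G_y \\ G_z \end{smallmatrix}\right])}$. Problem 2 (disturbance decoupling by dynamic output feedback with stability) is solvable if there exist $s\in\mathbb{N}$ and matrices $A_c\in\mathbb{R}^{s\times s}$, $B_c\in\mathbb{R}^{s\times p}$, $C_c\in\mathbb{R}^{m\times s}$, $D_c\in\mathbb{R}^{m\times p}$ such that $I-D_yD_c$ is non-singular (well-posedness) and, with $W=(I-D_yD_c)^{-1}$, $\widehat A=\begin{bmatrix}A+BD_cWC & BC_c+BD_cWD_yC_c \\ B_cWC & A_c+B_cWD_yC_c\end{bmatrix}$, $\widehat H=\begin{bmatrix}H+BD_cWG_y \\ B_cWG_y\end{bmatrix}$, $\widehat C=[\,E+D_zD_cWC\ \ \ D_zC_c+D_zD_cWD_yC_c\,]$, $\widehat G=G_z+D_zD_cWG_y$, the closed-loop transfer function $G_{z,w}(\lambda)=\widehat C(\lambda I-\widehat A)^{-1}\widehat H+\widehat G$ is identically zero and $\sigma(\widehat A)\subset\mathbb{C}_g$. *)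

theory Defs
  imports
    "Jordan_Normal_Form.Matrix_Kernel"
    "Jordan_Normal_Form.Spectral_Radius"
    "HOL-Library.Set_Algebras"
begin

abbreviation cmat :: "real mat \<Rightarrow> complex mat" where
  "cmat \<equiv> map_mat complex_of_real"

definition append_cols :: "'a :: zero mat \<Rightarrow> 'a mat \<Rightarrow> 'a mat" (infixr "@\<^sub>c" 65) where
  "A @\<^sub>c B = four_block_mat A B (0\<^sub>m 0 (dim_col A)) (0\<^sub>m 0 (dim_col B))"

abbreviation mat_image :: "'a :: semiring_0 mat \<Rightarrow> 'a vec set \<Rightarrow> 'a vec set" where
  "mat_image M X \<equiv> (\<lambda>x. M *\<^sub>v x) ` X"

abbreviation mat_range :: "'a :: semiring_0 mat \<Rightarrow> 'a vec set" where
  "mat_range M \<equiv> mat_image M (carrier_vec (dim_col M))"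

definition ext_sum :: "'a vec set \<Rightarrow> 'a vec set \<Rightarrow> 'a vec set" (infixr "\<oplus>\<^sub>v" 66) where
  "S \<oplus>\<^sub>v W = {s @\<^sub>v w | s w. s \<in> S \<and> w \<in> W}"

abbreviation real_subspace :: "nat \<Rightarrow> real vec set \<Rightarrow> bool" where
  "real_subspace n V \<equiv> VectorSpace.subspace class_ring V (module_vec TYPE(real) n)"


(* The complex span of a real subspace J, i.e. the set of all x + i y with x, y in J. *)
definition complexification :: "real vec set \<Rightarrow> complex vec set" where
  "complexification J = {v. map_vec Re v \<in> J \<and> map_vec Im v \<in> J}"

(* The next two definitions are meant for a real square matrix M and an M-invariant subspace J.
   The spectrum of a real map is that of its complexification; in finite dimension it consists
   of the eigenvalues. *)
definition spectrum_on :: "real mat \<Rightarrow> real vec set \<Rightarrow> complex set" where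
  "spectrum_on M J =
     {k. \<exists>v \<in> complexification J. v \<noteq> 0\<^sub>v (dim_row M) \<and> cmat M *\<^sub>v v = k \<cdot>\<^sub>v v}"

(* Eigenvalues of the induced map on cosets: v + J is nonzero iff v is not in J, and
   M v + J = k v + J iff M v - k v lies in J (J standing for its complexification). *)
definition spectrum_quot :: "real mat \<Rightarrow> real vec set \<Rightarrow> complex set" where
  "spectrum_quot M J =
     {k. \<exists>v \<in> carrier_vec (dim_row M). v \<notin> complexification J \<and>
           cmat M *\<^sub>v v - k \<cdot>\<^sub>v v \<in> complexification J}"

definition stabilizable :: "complex set \<Rightarrow> real mat \<Rightarrow> real mat \<Rightarrow> bool" where
  "stabilizable Cg A B \<longleftrightarrow>
     (\<exists>F \<in> carrier_mat (dim_col B) (dim_row A). spectrum (cmat (A + B * F)) \<subseteq> Cg)"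

definition detectable :: "complex set \<Rightarrow> real mat \<Rightarrow> real mat \<Rightarrow> bool" where
  "detectable Cg C A \<longleftrightarrow>
     (\<exists>G \<in> carrier_mat (dim_row A) (dim_row C). spectrum (cmat (A + G * C)) \<subseteq> Cg)"


definition output_nulling ::
  "real mat \<Rightarrow> real mat \<Rightarrow> real mat \<Rightarrow> real mat \<Rightarrow> real vec set \<Rightarrow> bool" where
  "output_nulling A B C D V \<longleftrightarrow>
     real_subspace (dim_row A) V \<and>
     mat_image (A @\<^sub>r C) V \<subseteq> (V \<oplus>\<^sub>v {0\<^sub>v (dim_row C)}) + mat_range (B @\<^sub>r D)"

definition output_nulling_friend ::
  "real mat \<Rightarrow> real mat \<Rightarrow> real mat \<Rightarrow> real mat \<Rightarrow> real vec set \<Rightarrow> real mat \<Rightarrow> bool" where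
  "output_nulling_friend A B C D V F \<longleftrightarrow>
     F \<in> carrier_mat (dim_col B) (dim_row A) \<and>
     mat_image ((A + B * F) @\<^sub>r (C + D * F)) V \<subseteq> V \<oplus>\<^sub>v {0\<^sub>v (dim_row C)}"

definition internally_stabilizable ::
  "complex set \<Rightarrow> real mat \<Rightarrow> real mat \<Rightarrow> real mat \<Rightarrow> real mat \<Rightarrow> real vec set \<Rightarrow> bool" where
  "internally_stabilizable Cg A B C D V \<longleftrightarrow>
     (\<exists>F. output_nulling_friend A B C D V F \<and> spectrum_on (A + B * F) V \<subseteq> Cg)"

definition input_containing ::
  "real mat \<Rightarrow> real mat \<Rightarrow> real mat \<Rightarrow> real mat \<Rightarrow> real vec set \<Rightarrow> bool" where
  "input_containing A B C D S \<longleftrightarrow>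
     real_subspace (dim_row A) S \<and>
     mat_image (A @\<^sub>c B) ((S \<oplus>\<^sub>v carrier_vec (dim_col B)) \<inter> mat_kernel (C @\<^sub>c D)) \<subseteq> S"

definition input_containing_friend ::
  "real mat \<Rightarrow> real mat \<Rightarrow> real mat \<Rightarrow> real mat \<Rightarrow> real vec set \<Rightarrow> real mat \<Rightarrow> bool" where
  "input_containing_friend A B C D S G \<longleftrightarrow>
     G \<in> carrier_mat (dim_row A) (dim_row C) \<and>
     mat_image ((A + G * C) @\<^sub>c (B + G * D)) (S \<oplus>\<^sub>v carrier_vec (dim_col B)) \<subseteq> S"

definition externally_detectable ::
  "complex set \<Rightarrow> real mat \<Rightarrow> real mat \<Rightarrow> real mat \<Rightarrow> real mat \<Rightarrow> real vec set \<Rightarrow> bool" where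
  "externally_detectable Cg A B C D S \<longleftrightarrow>
     (\<exists>G. input_containing_friend A B C D S G \<and> spectrum_quot (A + G * C) S \<subseteq> Cg)"

(* Greatest and least with respect to inclusion. *)
definition V_star :: "real mat \<Rightarrow> real mat \<Rightarrow> real mat \<Rightarrow> real mat \<Rightarrow> real vec set" where
  "V_star A B C D = (GREATEST V. output_nulling A B C D V)"

definition S_star :: "real mat \<Rightarrow> real mat \<Rightarrow> real mat \<Rightarrow> real mat \<Rightarrow> real vec set" where
  "S_star A B C D = (LEAST S. input_containing A B C D S)"

definition V_m ::
  "real mat \<Rightarrow> real mat \<Rightarrow> real mat \<Rightarrow> real mat \<Rightarrow> real mat \<Rightarrow> real mat \<Rightarrow> real vec set" where
  "V_m A B H E Dz Gz =
     V_star A (B @\<^sub>c H) E (Dz @\<^sub>c Gz) \<inter> S_star A (B @\<^sub>c H) E (Dz @\<^sub>c Gz)"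

definition S_M ::
  "real mat \<Rightarrow> real mat \<Rightarrow> real mat \<Rightarrow> real mat \<Rightarrow> real mat \<Rightarrow> real mat \<Rightarrow> real vec set" where
  "S_M A H C Gy E Gz =
     V_star A H (C @\<^sub>r E) (Gy @\<^sub>r Gz) + S_star A H (C @\<^sub>r E) (Gy @\<^sub>r Gz)"


definition transfer_function ::
  "real mat \<Rightarrow> real mat \<Rightarrow> real mat \<Rightarrow> real mat \<Rightarrow> complex \<Rightarrow> complex mat" where
  "transfer_function A H C G k =
     cmat C * the (mat_inverse (k \<cdot>\<^sub>m 1\<^sub>m (dim_row A) - cmat A)) * cmat H + cmat G"

(* The transfer function is a rational matrix function of k, with values only outside the
   spectrum of the state matrix. *)
definition transfer_function_zero :: "real mat \<Rightarrow> real mat \<Rightarrow> real mat \<Rightarrow> real mat \<Rightarrow> bool" where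
  "transfer_function_zero A H C G \<longleftrightarrow>
     (\<forall>k. k \<notin> spectrum (cmat A) \<longrightarrow> transfer_function A H C G k = 0\<^sub>m (dim_row C) (dim_col H))"

(* Disturbance decoupling by dynamic output feedback with stability, for the plant
     x' = A x + B u + H w,  y = C x + Dy u + Gy w,  z = E x + Dz u + Gz w
   (x' being the derivative or the shift); s = 0 is a static feedback. *)
definition ddp_output_feedback_solvable ::
  "complex set \<Rightarrow> real mat \<Rightarrow> real mat \<Rightarrow> real mat \<Rightarrow> real mat \<Rightarrow> real mat \<Rightarrow> real mat \<Rightarrow>
   real mat \<Rightarrow> real mat \<Rightarrow> real mat \<Rightarrow> bool" where
  "ddp_output_feedback_solvable Cg A B H C Dy Gy E Dz Gz \<longleftrightarrow>
     (\<exists>s. \<exists>Ac \<in> carrier_mat s s. \<exists>Bc \<in> carrier_mat s (dim_row C).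
      \<exists>Cc \<in> carrier_mat (dim_col B) s. \<exists>Dc \<in> carrier_mat (dim_col B) (dim_row C).
        invertible_mat (1\<^sub>m (dim_row C) - Dy * Dc) \<and>
        (let W = the (mat_inverse (1\<^sub>m (dim_row C) - Dy * Dc));
             Acl = four_block_mat
                     (A + B * Dc * W * C)  (B * Cc + B * Dc * W * Dy * Cc)
                     (Bc * W * C)          (Ac + Bc * W * Dy * Cc);
             Hcl = (H + B * Dc * W * Gy) @\<^sub>r (Bc * W * Gy);
             Ccl = (E + Dz * Dc * W * C) @\<^sub>c (Dz * Cc + Dz * Dc * W * Dy * Cc);
             Gcl = Gz + Dz * Dc * W * Gy
         in transfer_function_zero Acl Hcl Ccl Gcl \<and> spectrum (cmat Acl) \<subseteq> Cg))"

end

theory Submission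
  imports Defs "HOL-Library.Function_Algebras"
begin

text \<open>
  Measuring y - Dy u instead of y removes Dy from the loop: a compensator with direct gain Dc
  becomes one with direct gain K = Dc (I - Dy Dc)^-1, and well-posedness becomes invertibility
  of I + K Dy (ddp_iff_reduced). A transfer function vanishes iff the system has no feedthrough
  and has an invariant subspace L that contains the image of the disturbance matrix and is
  killed by the output matrix (transfer_function_zero_invariant). The problem is therefore to
  find a stable closed loop together with such a subspace L.

  Suppose that L is given. Its projection to the plant states is output nulling, its section,
  the set of all x with (x, 0) in L, is input containing, and the section lies in the
  projection; this gives S* \<subseteq> V*, and one step of the closed loop from a state (x, 0)
  with x \<in> S* gives the inclusion imposed on K, which contains the conditions on the images
  of H and Gz and on the kernels. For the stability conditions, write V1 and S1 for the two
  summands of S_M. Since the set of all (v, 0) with v in V1 is invariant modulo the disturbance,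
  it can be added to L (decoupled_extend), and afterwards L can be restricted to the states
  above V_m + S_M (decoupled_restrict), because this sum is self-bounded. For \<lambda> outside
  the stability region the closed loop matrix minus \<lambda> is bijective on L. Projected to
  the plant, and together with similar properties of V* and S* (Vst_resolvent, Sst_resolvent),
  this says that every v in V_m + S_M is \<lambda>x - Ax - Bu with x in the same space and Ex +
  Dz u = 0 (VM_resolvent); read on the section it says that \<lambda>x - Ax - Hw \<in> S_M and
  Cx + Gy w = 0 force x \<in> S_M (SM_resolvent). These are Hautus conditions, and Hautus
  conditions produce stabilizing friends (out_nulling_stabilization,
  in_containing_stabilization), because an undetected unstable eigenvector is the only
  obstruction to static stabilization (detectable_stabilization).

  Conversely, let F0 be a friend of V_m + S_M and G0 a friend of S_M with the required partial
  stability, and let F2 and G2 stabilize (A, B) and (C, A). The compensator runs an observer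
  \<xi> of the plant with gain G2, an estimate \<eta> of the observer error modulo S_M, and a
  copy \<zeta> of the motion on V_m + S_M. Only the quotient by S_M is ever simulated with G0
  and only the subspace V_m + S_M with F0, so their partial stability is enough
  (compensator_stable). The input is chosen such that a state that starts as the sum of \<zeta>
  and a vector of S_M keeps this form, and on such states z vanishes by the inclusion imposed on
  K (compensator_decouples).
\<close>

section \<open>Vectors as finitely supported functions\<close>

text \<open>A vector of length n is represented by a function that vanishes from n on.  On functions the
  ring operations are pointwise, so identities between vector expressions can be proved by ring
  normalization, with no dimension side conditions.\<close>

type_synonym 'a fvec = "nat \<Rightarrow> 'a"

text \<open>Scalar multiplication by c is pointwise multiplication by the constant function cst c.\<close>

definition cst :: "'a \<Rightarrow> 'a fvec" where
  "cst c = (\<lambda>_. c)"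

lemma cst_apply [simp]: "cst c i = c"
  by (simp add: cst_def)

lemma cst_simps [simp]:
  "cst 0 = (0 :: 'a :: comm_ring_1 fvec)" "cst 1 = (1 :: 'a fvec)"
  by (auto simp: fun_eq_iff)

lemma cst_hom:
  "cst (a + b) = cst a + cst b" "cst (a - b) = cst a - cst b" "cst (- a) = - cst a" "cst (a * b) = cst a * cst b"
  for a b :: "'a :: comm_ring_1"
  by (auto simp: fun_eq_iff)

lemma cst_mult_eq_0_iff [simp]: "cst c * f = 0 \<longleftrightarrow> c = 0 \<or> f = 0" for c :: "'a :: idom"
  by (auto simp: fun_eq_iff)

definition supp :: "nat \<Rightarrow> 'a :: zero fvec set" where
  "supp n = {f. \<forall>i\<ge>n. f i = 0}"

lemma supp_closed [simp]:
  "0 \<in> supp n" "f \<in> supp n \<Longrightarrow> g \<in> supp n \<Longrightarrow> f + g \<in> supp n"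
  "f \<in> supp n \<Longrightarrow> g \<in> supp n \<Longrightarrow> f - g \<in> supp n"
  "f \<in> supp n \<Longrightarrow> - f \<in> supp n"
  "f \<in> supp n \<Longrightarrow> h * f \<in> supp n"
  for f g h :: "'a :: comm_ring_1 fvec"
  by (auto simp: supp_def)

definition trunc :: "nat \<Rightarrow> 'a :: zero fvec \<Rightarrow> 'a fvec" where
  "trunc n f = (\<lambda>i. if i < n then f i else 0)"

lemma trunc_supp [simp]: "trunc n f \<in> supp n"
  by (auto simp: trunc_def supp_def)

lemma trunc_id [simp]: "f \<in> supp n \<Longrightarrow> trunc n f = f"
  by (auto simp: trunc_def supp_def fun_eq_iff)

text \<open>A real matrix acts on real and on complex functions alike, so that each identity of the closed
  loop is derived once and then used both for invariance (real) and for eigenvectors (complex).\<close>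

definition act :: "real mat \<Rightarrow> 'a :: {real_algebra_1, comm_ring_1} fvec \<Rightarrow> 'a fvec" where
  "act M f = (\<lambda>i. if i < dim_row M then \<Sum>j<dim_col M. of_real (M $$ (i, j)) * f j else 0)"

lemma act_supp [simp]: "dim_row M = n \<Longrightarrow> act M f \<in> supp n"
  by (auto simp: act_def supp_def)

lemma act_linear [simp]:
  "act M (f + g) = act M f + act M g" "act M (f - g) = act M f - act M g"
  "act M (- f) = - act M f" "act M 0 = 0" "act M (cst c * f) = cst c * act M f"
  "act M (f * cst c) = act M f * cst c"
  by (auto simp: act_def fun_eq_iff algebra_simps sum.distrib sum_subtractf sum_negf sum_distrib_left)

lemma act_trunc [simp]: "dim_col M = n \<Longrightarrow> act M (trunc n f) = act M f"
  by (auto simp: act_def trunc_def fun_eq_iff intro!: sum.cong)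

lemma act_add: "dim_row M = dim_row N \<Longrightarrow> dim_col M = dim_col N \<Longrightarrow> act (M + N) f = act M f + act N f"
  by (auto simp: act_def fun_eq_iff algebra_simps sum.distrib)

lemma act_minus: "dim_row M = dim_row N \<Longrightarrow> dim_col M = dim_col N \<Longrightarrow> act (M - N) f = act M f - act N f"
  by (auto simp: act_def fun_eq_iff algebra_simps sum_subtractf)

lemma act_uminus: "act (- M) f = - act M f"
  by (auto simp: act_def fun_eq_iff sum_negf)

lemma act_smult: "act (c \<cdot>\<^sub>m M) f = cst (of_real c) * act M f"
  by (auto simp: act_def fun_eq_iff sum_distrib_left algebra_simps)

lemma act_mult: "dim_col M = dim_row N \<Longrightarrow> act (M * N) f = act M (act N f)"
proof (rule ext)
  fix i assume d: "dim_col M = dim_row N"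
  have "(\<Sum>j<dim_col N. of_real (\<Sum>k<dim_row N. M $$ (i, k) * N $$ (k, j)) * f j)
      = (\<Sum>k<dim_row N. of_real (M $$ (i, k)) * (\<Sum>j<dim_col N. of_real (N $$ (k, j)) * f j))"
    by (simp add: sum_distrib_left sum_distrib_right mult.assoc) (rule sum.swap)
  with d show "act (M * N) f i = act M (act N f) i"
    by (auto simp: act_def scalar_prod_def atLeast0LessThan)
qed

lemma act_one [simp]: "act (1\<^sub>m n) f = trunc n f"
  by (auto simp: act_def fun_eq_iff trunc_def if_distrib[of of_real] if_distrib[of "\<lambda>x. x * _"] cong: if_cong)

lemma act_zero [simp]: "act (0\<^sub>m n m) f = 0"
  by (auto simp: act_def fun_eq_iff)

text \<open>The block vector of f and g, where f has length n.\<close>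

definition stack :: "nat \<Rightarrow> 'a fvec \<Rightarrow> 'a fvec \<Rightarrow> 'a fvec" where
  "stack n f g = (\<lambda>i. if i < n then f i else g (i - n))"

definition shift :: "nat \<Rightarrow> 'a fvec \<Rightarrow> 'a fvec" where
  "shift n f = (\<lambda>i. f (i + n))"

lemma stack_split: "stack n (trunc n f) (shift n f) = f"
  by (auto simp: stack_def shift_def trunc_def fun_eq_iff)

lemma stack_supp [simp]: "g \<in> supp s \<Longrightarrow> stack n f g \<in> supp (n + s)"
  by (auto simp: stack_def supp_def)

lemma shift_supp [simp]: "f \<in> supp (n + s) \<Longrightarrow> shift n f \<in> supp s"
  by (auto simp: shift_def supp_def)

lemma trunc_stack [simp]: "f \<in> supp n \<Longrightarrow> trunc n (stack n f g) = f"
  by (auto simp: stack_def trunc_def supp_def fun_eq_iff)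

lemma shift_stack [simp]: "shift n (stack n f g) = g"
  by (auto simp: stack_def shift_def fun_eq_iff)

lemma stack_eq_iff:
  "f \<in> supp n \<Longrightarrow> f' \<in> supp n \<Longrightarrow> stack n f g = stack n f' g' \<longleftrightarrow> f = f' \<and> g = g'"
  by (metis shift_stack trunc_stack)

lemma stack_linear:
  "stack n f g + stack n f' g' = stack n (f + f') (g + g')"
  "stack n f g - stack n f' g' = stack n (f - f') (g - g')"
  "- stack n f g = stack n (- f) (- g)"
  "cst c * stack n f g = stack n (cst c * f) (cst c * g)"
  "stack n 0 0 = (0 :: 'a fvec)"
  for f g f' g' :: "'a :: comm_ring_1 fvec"
  by (auto simp: stack_def fun_eq_iff)

lemma stack_zero_iff: "f \<in> supp n \<Longrightarrow> stack n f g = 0 \<longleftrightarrow> f = 0 \<and> g = 0"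
  for f g :: "'a :: comm_ring_1 fvec"
  using stack_eq_iff[of f n 0 g 0] by (simp add: stack_linear)

lemma sum_split: "(\<Sum>j<m + q. f j) = (\<Sum>j<m. f j) + (\<Sum>j<q. f (m + j))" for f :: "nat \<Rightarrow> 'a :: comm_monoid_add"
  by (induction q) (auto simp: add.assoc)

lemma act_four_block:
  assumes "P \<in> carrier_mat n1 m1" "Q \<in> carrier_mat n1 m2" "R \<in> carrier_mat n2 m1" "S \<in> carrier_mat n2 m2"
  shows "act (four_block_mat P Q R S) (stack m1 f g) = stack n1 (act P f + act Q g) (act R f + act S g)"
  using assms by (auto simp: act_def stack_def fun_eq_iff sum_split)

lemma act_append_cols:
  assumes "P \<in> carrier_mat n1 m1" "Q \<in> carrier_mat n1 m2"
  shows "act (P @\<^sub>c Q) (stack m1 f g) = act P f + act Q g"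
  using assms by (auto simp: act_def stack_def fun_eq_iff sum_split append_cols_def)

lemma act_append_rows:
  assumes "P \<in> carrier_mat n1 m1" "Q \<in> carrier_mat n2 m1"
  shows "act (P @\<^sub>r Q) f = stack n1 (act P f) (act Q f)"
  using assms by (auto simp: act_def stack_def fun_eq_iff append_rows_def)

lemma carrier_append_cols [simp, intro]:
  "P \<in> carrier_mat n m1 \<Longrightarrow> Q \<in> carrier_mat n m2 \<Longrightarrow> (P @\<^sub>c Q) \<in> carrier_mat n (m1 + m2)"
  using four_block_carrier_mat[of P n m1 "0\<^sub>m 0 m2" 0 m2 Q "0\<^sub>m 0 m1"]
  by (auto simp: append_cols_def)

definition fRe :: "complex fvec \<Rightarrow> real fvec" where "fRe f = (\<lambda>i. Re (f i))"
definition fIm :: "complex fvec \<Rightarrow> real fvec" where "fIm f = (\<lambda>i. Im (f i))"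
definition cfn :: "real fvec \<Rightarrow> complex fvec" where "cfn f = (\<lambda>i. of_real (f i))"
definition fcnj :: "complex fvec \<Rightarrow> complex fvec" where "fcnj f = (\<lambda>i. cnj (f i))"

lemma fRe_simps [simp]:
  "fRe (f + g) = fRe f + fRe g" "fRe (f - g) = fRe f - fRe g" "fRe (- f) = - fRe f" "fRe 0 = 0"
  "fRe (cst c * f) = cst (Re c) * fRe f - cst (Im c) * fIm f"
  "fRe (f * cst c) = cst (Re c) * fRe f - cst (Im c) * fIm f" "fRe (cfn h) = h" "fRe (fcnj f) = fRe f"
  by (auto simp: fRe_def fIm_def cfn_def fcnj_def fun_eq_iff)

lemma fIm_simps [simp]:
  "fIm (f + g) = fIm f + fIm g" "fIm (f - g) = fIm f - fIm g" "fIm (- f) = - fIm f" "fIm 0 = 0"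
  "fIm (cst c * f) = cst (Re c) * fIm f + cst (Im c) * fRe f"
  "fIm (f * cst c) = cst (Re c) * fIm f + cst (Im c) * fRe f" "fIm (cfn h) = 0" "fIm (fcnj f) = - fIm f"
  by (auto simp: fRe_def fIm_def cfn_def fcnj_def fun_eq_iff)

lemma cfn_simps [simp]:
  "cfn (f + g) = cfn f + cfn g" "cfn (f - g) = cfn f - cfn g" "cfn (- f) = - cfn f" "cfn 0 = 0"
  "cfn (cst c * h) = cst (of_real c) * cfn h" "cfn (h * cst c) = cfn h * cst (of_real c)"
  by (auto simp: cfn_def fun_eq_iff)

lemma fcnj_simps [simp]:
  "fcnj (f + g) = fcnj f + fcnj g" "fcnj (f - g) = fcnj f - fcnj g" "fcnj (- f) = - fcnj f" "fcnj 0 = 0"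
  "fcnj (cst c * f) = cst (cnj c) * fcnj f" "fcnj (f * cst c) = fcnj f * cst (cnj c)" "fcnj (fcnj f) = f"
  by (auto simp: fcnj_def fun_eq_iff)

lemma complex_fvec_eq: "f = cfn (fRe f) + cst \<i> * cfn (fIm f)"
  by (auto simp: fRe_def fIm_def cfn_def fun_eq_iff complex_eq)

lemma complex_fvec_eqI: "fRe f = fRe g \<Longrightarrow> fIm f = fIm g \<Longrightarrow> f = g"
  by (auto simp: fRe_def fIm_def fun_eq_iff complex_eq_iff)

lemma cfn_eq_0_iff [simp]: "cfn f = 0 \<longleftrightarrow> f = 0"
  by (auto simp: cfn_def fun_eq_iff)

lemma fRe_act [simp]: "fRe (act M f) = act M (fRe f)"
  by (auto simp: act_def fRe_def fun_eq_iff)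

lemma fIm_act [simp]: "fIm (act M f) = act M (fIm f)"
  by (auto simp: act_def fIm_def fun_eq_iff)

lemma cfn_act [simp]: "cfn (act M f) = act M (cfn f)"
  by (auto simp: act_def cfn_def fun_eq_iff)

lemma fcnj_act [simp]: "fcnj (act M f) = act M (fcnj f)"
  by (auto simp: act_def fcnj_def fun_eq_iff)

lemma fRe_supp [simp]: "f \<in> supp n \<Longrightarrow> fRe f \<in> supp n" by (auto simp: supp_def fRe_def)
lemma fIm_supp [simp]: "f \<in> supp n \<Longrightarrow> fIm f \<in> supp n" by (auto simp: supp_def fIm_def)
lemma cfn_supp [simp]: "f \<in> supp n \<Longrightarrow> cfn f \<in> supp n" by (auto simp: supp_def cfn_def)
lemma fcnj_supp [simp]: "f \<in> supp n \<Longrightarrow> fcnj f \<in> supp n" by (auto simp: supp_def fcnj_def)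

lemma fRe_stack [simp]: "fRe (stack n f g) = stack n (fRe f) (fRe g)" by (auto simp: stack_def fRe_def fun_eq_iff)
lemma fIm_stack [simp]: "fIm (stack n f g) = stack n (fIm f) (fIm g)" by (auto simp: stack_def fIm_def fun_eq_iff)

definition fsubspace :: "nat \<Rightarrow> real fvec set \<Rightarrow> bool" where
  "fsubspace n V \<longleftrightarrow> V \<subseteq> supp n \<and> 0 \<in> V \<and> (\<forall>x\<in>V. \<forall>y\<in>V. x + y \<in> V) \<and> (\<forall>c. \<forall>x\<in>V. cst c * x \<in> V)"

lemma fsubspaceD:
  assumes "fsubspace n V"
  shows "x \<in> V \<Longrightarrow> x \<in> supp n" "0 \<in> V" "x \<in> V \<Longrightarrow> y \<in> V \<Longrightarrow> x + y \<in> V"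
    "x \<in> V \<Longrightarrow> cst c * x \<in> V" "x \<in> V \<Longrightarrow> y \<in> V \<Longrightarrow> x - y \<in> V" "x \<in> V \<Longrightarrow> - x \<in> V"
proof -
  show *: "x \<in> V \<Longrightarrow> x \<in> supp n" "0 \<in> V" "x \<in> V \<Longrightarrow> y \<in> V \<Longrightarrow> x + y \<in> V"
    "x \<in> V \<Longrightarrow> cst c * x \<in> V" for x y c
    using assms by (auto simp: fsubspace_def)
  show **: "x \<in> V \<Longrightarrow> - x \<in> V" for x
    using *(4)[of x "-1"] by (simp add: cst_hom)
  show "x \<in> V \<Longrightarrow> y \<in> V \<Longrightarrow> x - y \<in> V"
    using *(3)[of x "-y"] **[of y] by simp
qed

lemma fsubspace_zero: "fsubspace n {0}"
  by (auto simp: fsubspace_def)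

lemma fsubspace_inter: "fsubspace n V \<Longrightarrow> fsubspace n W \<Longrightarrow> fsubspace n (V \<inter> W)"
  by (auto simp: fsubspace_def)

lemma fsubspace_sum: 
  assumes V: "fsubspace n V" and W: "fsubspace n W" shows "fsubspace n (V + W)"
  unfolding fsubspace_def
proof (intro conjI ballI allI subsetI)
  fix x assume "x \<in> V + W"
  then obtain a b where x: "x = a + b" "a \<in> V" "b \<in> W" by (auto elim: set_plus_elim)
  then show "x \<in> supp n" using fsubspaceD(1)[OF V] fsubspaceD(1)[OF W] by simp
  show "cst c * x \<in> V + W" for c
    using set_plus_intro[OF fsubspaceD(4)[OF V x(2)] fsubspaceD(4)[OF W x(3)], of c c] by (simp add: x(1) distrib_left)
  fix y assume "y \<in> V + W"
  then obtain a' b' where y: "y = a' + b'" "a' \<in> V" "b' \<in> W" by (auto elim: set_plus_elim)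
  have "x + y = (a + a') + (b + b')" by (simp add: x y algebra_simps)
  then show "x + y \<in> V + W"
    using set_plus_intro[OF fsubspaceD(3)[OF V x(2) y(2)] fsubspaceD(3)[OF W x(3) y(3)]] by simp
next
  show "0 \<in> V + W" using set_plus_intro[OF fsubspaceD(2)[OF V] fsubspaceD(2)[OF W]] by simp
qed

text \<open>The complex span of a real subspace V.\<close>

definition cx :: "real fvec set \<Rightarrow> complex fvec set" where
  "cx V = {f. fRe f \<in> V \<and> fIm f \<in> V}"

lemma cxD:
  assumes V: "fsubspace n V"
  shows "x \<in> cx V \<Longrightarrow> x \<in> supp n" "0 \<in> cx V" "x \<in> cx V \<Longrightarrow> y \<in> cx V \<Longrightarrow> x + y \<in> cx V"
    "x \<in> cx V \<Longrightarrow> cst c * x \<in> cx V" "x \<in> cx V \<Longrightarrow> y \<in> cx V \<Longrightarrow> x - y \<in> cx V" "x \<in> cx V \<Longrightarrow> - x \<in> cx V"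
    "x \<in> cx V \<Longrightarrow> fcnj x \<in> cx V" "cfn r \<in> cx V \<longleftrightarrow> r \<in> V"
proof -
  show "x \<in> cx V \<Longrightarrow> x \<in> supp n"
    using fsubspaceD(1)[OF V, of "fRe x"] fsubspaceD(1)[OF V, of "fIm x"]
    by (auto simp: cx_def supp_def fRe_def fIm_def complex_eq_iff)
qed (auto simp: cx_def fsubspaceD[OF V])

lemma cx_act: "(\<And>x. x \<in> V \<Longrightarrow> act M x \<in> W) \<Longrightarrow> x \<in> cx V \<Longrightarrow> act M x \<in> cx W"
  by (auto simp: cx_def)

lemma cx_sum: 
  "cx (V + W) = cx V + cx W"
proof (intro equalityI subsetI)
  fix x assume "x \<in> cx (V + W)"
  then obtain a b a' b' where h: "fRe x = a + b" "a \<in> V" "b \<in> W" "fIm x = a' + b'" "a' \<in> V" "b' \<in> W"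
    by (auto simp: cx_def elim!: set_plus_elim)
  have "x = (cfn a + cst \<i> * cfn a') + (cfn b + cst \<i> * cfn b')"
    by (subst complex_fvec_eq) (simp add: h distrib_left add.assoc add.left_commute)
  moreover have "cfn a + cst \<i> * cfn a' \<in> cx V" "cfn b + cst \<i> * cfn b' \<in> cx W"
    using h by (auto simp: cx_def)
  ultimately show "x \<in> cx V + cx W" by (simp add: set_plus_intro)
next
  fix x assume "x \<in> cx V + cx W"
  then obtain a b where "x = a + b" "a \<in> cx V" "b \<in> cx W" by (rule set_plus_elim)
  then show "x \<in> cx (V + W)"
    by (simp add: cx_def set_plus_intro)
qed

section \<open>Linear selections, projections and resolvents\<close>

definition unit_fn :: "nat \<Rightarrow> 'a :: zero_neq_one fvec" where
  "unit_fn j = (\<lambda>i. if i = j then 1 else 0)"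

lemma unit_fn_supp [simp]: "j < n \<Longrightarrow> unit_fn j \<in> supp n"
  by (auto simp: unit_fn_def supp_def)

lemma supp_expand:
  fixes f :: "'a :: comm_ring_1 fvec"
  assumes "f \<in> supp n"
  shows "f = (\<Sum>j<n. cst (f j) * unit_fn j)"
proof -
  have *: "(\<Sum>j<m. cst (f j) * unit_fn j) i = (if i < m then f i else 0)" for i m
    by (induction m) (auto simp: unit_fn_def less_Suc_eq)
  show ?thesis using assms by (auto simp: fun_eq_iff * supp_def)
qed

definition rank_one :: "nat \<Rightarrow> nat \<Rightarrow> real fvec \<Rightarrow> nat \<Rightarrow> real mat" where
  "rank_one m n u k = mat m n (\<lambda>(i, j). if j = k then u i else 0)"

lemma act_rank_one: 
  assumes "u \<in> supp m" "k < n"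
  shows "act (rank_one m n u k) f = cst (f k) * (\<lambda>i. of_real (u i))"
proof (rule ext)
  fix i
  have "(\<Sum>j<n. of_real (if j = k then u i else 0) * f j) = of_real (u i) * f k"
    using assms(2) by (simp add: if_distrib[of of_real] if_distrib[of "\<lambda>x. x * _"] cong: if_cong)
  then show "act (rank_one m n u k) f i = (cst (f k) * (\<lambda>i. of_real (u i))) i"
    using assms by (auto simp: act_def rank_one_def supp_def algebra_simps)
qed

lemma act_rank_one_real: "u \<in> supp m \<Longrightarrow> k < n \<Longrightarrow> act (rank_one m n u k) f = cst (f k) * u"
  for f :: "real fvec"
  by (simp add: act_rank_one)

lemma act_rank_one_complex: "u \<in> supp m \<Longrightarrow> k < n \<Longrightarrow> act (rank_one m n u k) f = cst (f k) * cfn u"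
  by (simp add: act_rank_one cfn_def)

lemma rank_one_carrier [simp]:
  "rank_one m n u k \<in> carrier_mat m n" "dim_row (rank_one m n u k) = m" "dim_col (rank_one m n u k) = n"
  by (auto simp: rank_one_def)

text \<open>Every linear relation contains the graph of a matrix.  The matrix is built coordinate by
  coordinate: F serves all v supported below k, and if the relation has a pair (v0, u0) with v0
  supported below k + 1 and v0(k) = 1, then F is corrected by the rank one term that sends v0 to u0.
  Friends of subspaces and projections are obtained from this lemma.\<close>

lemma linear_selection:
  fixes R :: "(real fvec \<times> real fvec) set"
  assumes U: "fsubspace m U"
    and RU: "\<And>v u. (v, u) \<in> R \<Longrightarrow> v \<in> supp n \<and> u \<in> U"
    and add: "\<And>v u v' u'. (v, u) \<in> R \<Longrightarrow> (v', u') \<in> R \<Longrightarrow> (v + v', u + u') \<in> R"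
    and scale: "\<And>c v u. (v, u) \<in> R \<Longrightarrow> (cst c * v, cst c * u) \<in> R"
    and zero: "(0, 0) \<in> R"
  obtains F where "F \<in> carrier_mat m n" "\<And>x. act F x \<in> U" "\<And>v u. (v, u) \<in> R \<Longrightarrow> (v, act F v) \<in> R"
proof -
  have "\<exists>F \<in> carrier_mat m n. (\<forall>x. act F x \<in> U) \<and> (\<forall>v u. (v, u) \<in> R \<longrightarrow> v \<in> supp k \<longrightarrow> (v, act F v) \<in> R)"
    if "k \<le> n" for k
    using that
  proof (induction k)
    case 0
    have 0: "v = 0" if "v \<in> supp 0" for v :: "real fvec"
      using that by (simp add: supp_def fun_eq_iff)
    have "act (0\<^sub>m m n) x \<in> U" for x :: "real fvec"
      by (simp add: fsubspaceD(2)[OF U])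
    moreover have "(v, act (0\<^sub>m m n) v) \<in> R" if "v \<in> supp 0" for v :: "real fvec"
      using 0[OF that] zero by simp
    ultimately show ?case
      using zero_carrier_mat by blast
  next
    case (Suc k)
    then obtain F where F: "F \<in> carrier_mat m n" "\<And>x. act F x \<in> U"
      "\<And>v u. (v, u) \<in> R \<Longrightarrow> v \<in> supp k \<Longrightarrow> (v, act F v) \<in> R" by auto
    have down: "v \<in> supp k" if "v \<in> supp (Suc k)" "v k = 0" for v :: "real fvec"
      using that by (auto simp: supp_def) (metis le_neq_implies_less Suc_leI)
    show ?case
    proof (cases "\<exists>v u. (v, u) \<in> R \<and> v \<in> supp (Suc k) \<and> v k \<noteq> 0")
      case False
      then show ?thesis using F down by blast
    next
      case True
      then obtain v' u' where vu: "(v', u') \<in> R" "v' \<in> supp (Suc k)" "v' k \<noteq> 0" by blast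
      define v0 where "v0 = cst (1 / v' k) * v'"
      define u0 where "u0 = cst (1 / v' k) * u'"
      have R0: "(v0, u0) \<in> R" "v0 \<in> supp (Suc k)" "v0 k = 1"
        using scale[OF vu(1)] vu by (auto simp: v0_def u0_def supp_def)
      define w where "w = u0 - act F v0"
      have wU: "w \<in> U"
        using RU[OF R0(1)] F(2) fsubspaceD(5)[OF U] by (auto simp: w_def)
      have ws: "w \<in> supp m" using fsubspaceD(1)[OF U wU] .
      define F' where "F' = F + rank_one m n w k"
      have actF': "act F' x = act F x + cst (x k) * w" for x :: "real fvec"
        using F(1) Suc.prems ws by (simp add: F'_def act_add act_rank_one_real)
      have "act F' x \<in> U" for x
        unfolding actF' using F(2) wU fsubspaceD[OF U] by blast
      moreover have "(v, act F' v) \<in> R" if "(v, u) \<in> R" "v \<in> supp (Suc k)" for v u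
      proof -
        define v1 where "v1 = v + cst (- v k) * v0"
        have "(v1, u + cst (- v k) * u0) \<in> R"
          unfolding v1_def by (intro add scale that R0)
        moreover have "v1 \<in> supp k"
          by (rule down) (use that R0 in \<open>auto simp: v1_def supp_def\<close>)
        ultimately have "(v1, act F v1) \<in> R" using F(3) by blast
        from add[OF this scale[OF R0(1)], of "v k"]
        have "(v1 + cst (v k) * v0, act F v1 + cst (v k) * u0) \<in> R" .
        moreover have "v1 + cst (v k) * v0 = v" by (simp add: v1_def fun_eq_iff)
        moreover have "act F v1 + cst (v k) * u0 = act F' v"
          unfolding actF' v1_def w_def by (simp add: algebra_simps cst_hom)
        ultimately show ?thesis by simp
      qed
      moreover have "F' \<in> carrier_mat m n" using F(1) by (simp add: F'_def)
      ultimately show ?thesis by blast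
    qed
  qed
  from this[of n] obtain F where "F \<in> carrier_mat m n" "\<forall>x. act F x \<in> U"
    "\<forall>v u. (v, u) \<in> R \<longrightarrow> v \<in> supp n \<longrightarrow> (v, act F v) \<in> R" by auto
  then show thesis using that RU by blast
qed

lemma projection_matrix:
  assumes V: "fsubspace n V"
  shows "\<exists>P \<in> carrier_mat n n. (\<forall>x :: real fvec. act P x \<in> V) \<and> (\<forall>v\<in>V. act P v = v)
    \<and> (\<forall>x :: complex fvec. act P x \<in> cx V) \<and> (\<forall>v\<in>cx V. act P v = v)"
proof -
  obtain P where P: "P \<in> carrier_mat n n" "\<And>x. act P x \<in> V" "\<And>v u. (v, u) \<in> {(v, v) |v. v \<in> V} \<Longrightarrow> (v, act P v) \<in> {(v, v) |v. v \<in> V}"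
    by (rule linear_selection[OF V, of "{(v, v) |v. v \<in> V}" n]) (use fsubspaceD[OF V] in auto)
  have "act P v = v" if "v \<in> V" for v using P(3)[of v v] that by auto
  moreover have "act P v = v" if "v \<in> cx V" for v
    by (rule complex_fvec_eqI) (use that calculation in \<open>auto simp: cx_def\<close>)
  moreover have "act P x \<in> cx V" for x
    using P(2) by (simp add: cx_def)
  ultimately show ?thesis
    using P(1,2) by blast
qed

text \<open>The pivot positions of an echelon form of V.  Their number is the dimension of V, which bounds the
  length of a strictly increasing chain of subspaces.\<close>

definition pivots :: "real fvec set \<Rightarrow> nat set" where
  "pivots V = {k. \<exists>v\<in>V. v k \<noteq> 0 \<and> v \<in> supp (Suc k)}"

lemma pivots_bound: "fsubspace n V \<Longrightarrow> pivots V \<subseteq> {..<n}"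
proof
  fix k assume V: "fsubspace n V" and "k \<in> pivots V"
  then obtain v where v: "v \<in> V" "v k \<noteq> 0" by (auto simp: pivots_def)
  have "v \<in> supp n" using fsubspaceD(1)[OF V v(1)] .
  with v(2) show "k \<in> {..<n}" by (cases "k < n") (auto simp: supp_def)
qed

text \<open>With equal pivots, the leading entry of any w in W can be cleared by a vector of V, so that
  induction on the support puts w into V.\<close>

lemma pivots_strict_mono:
  assumes V: "fsubspace n V" and W: "fsubspace n W" and "V \<subset> W"
  shows "pivots V \<subset> pivots W"
proof -
  have "W \<subseteq> V" if eq: "pivots W \<subseteq> pivots V"
  proof -
    have "w \<in> V" if "w \<in> W" "w \<in> supp k" for k w
      using that
    proof (induction k arbitrary: w)
      case 0
      then have "w = 0" by (simp add: supp_def fun_eq_iff)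
      then show ?case using fsubspaceD(2)[OF V] by (simp only:)
    next
      case (Suc k)
      have down: "v \<in> supp k" if "v \<in> supp (Suc k)" "v k = 0" for v :: "real fvec"
        using that by (auto simp: supp_def) (metis le_neq_implies_less Suc_leI)
      show ?case
      proof (cases "w k = 0")
        case True
        then show ?thesis using Suc down by blast
      next
        case False
        then have "k \<in> pivots V" using Suc eq by (auto simp: pivots_def)
        then obtain v where v: "v \<in> V" "v k \<noteq> 0" "v \<in> supp (Suc k)" by (auto simp: pivots_def)
        define w' where "w' = w - cst (w k / v k) * v"
        have "w' \<in> W" using v \<open>V \<subset> W\<close> fsubspaceD[OF W] Suc.prems by (auto simp: w'_def)
        moreover have "w' \<in> supp k" by (rule down) (use v Suc.prems in \<open>auto simp: w'_def\<close>)
        ultimately have "w' \<in> V" using Suc.IH by blast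
        from fsubspaceD(3)[OF V this fsubspaceD(4)[OF V v(1)], of "w k / v k"]
        show ?thesis by (simp add: w'_def)
      qed
    qed
    then show ?thesis using fsubspaceD(1)[OF W] by blast
  qed
  moreover have "pivots V \<subseteq> pivots W" using \<open>V \<subset> W\<close> by (auto simp: pivots_def)
  ultimately show ?thesis using \<open>V \<subset> W\<close> by blast
qed

definition fn :: "'a :: zero vec \<Rightarrow> 'a fvec" where
  "fn v = (\<lambda>i. if i < dim_vec v then v $ i else 0)"

lemma fn_supp [simp]: "dim_vec v = n \<Longrightarrow> fn v \<in> supp n"
  by (auto simp: fn_def supp_def)

lemma fn_vec [simp]: "f \<in> supp n \<Longrightarrow> fn (vec n f) = f"
  by (auto simp: fn_def supp_def fun_eq_iff)

lemma vec_fn [simp]: "v \<in> carrier_vec n \<Longrightarrow> vec n (fn v) = v"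
  by (auto simp: fn_def)

lemma fn_inj: "v \<in> carrier_vec n \<Longrightarrow> w \<in> carrier_vec n \<Longrightarrow> fn v = fn w \<longleftrightarrow> v = w"
  by (metis vec_fn)

lemma linear_injective_surjective:
  fixes T :: "'a :: field fvec \<Rightarrow> 'a fvec"
  assumes Tn: "\<And>x. x \<in> supp n \<Longrightarrow> T x \<in> supp n"
    and add: "\<And>x y. T (x + y) = T x + T y" and scale: "\<And>c x. T (cst c * x) = cst c * T x"
    and inj: "\<And>x. x \<in> supp n \<Longrightarrow> T x = 0 \<Longrightarrow> x = 0"
    and y: "y \<in> supp n"
  obtains x where "x \<in> supp n" "T x = y"
proof -
  define M where "M = mat n n (\<lambda>(i, j). T (unit_fn j) i)"
  have T0: "T 0 = 0" using scale[of 0 0] by simp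
  have Tsum: "T (\<Sum>j<m. f j) = (\<Sum>j<m. T (f j))" for f and m :: nat
    by (induction m) (simp_all only: lessThan_0 sum.empty sum.lessThan_Suc T0 add)
  have TM: "fn (M *\<^sub>v v) = T (fn v)" if v: "v \<in> carrier_vec n" for v
  proof (rule ext)
    fix i
    have "T (fn v) = T (\<Sum>j<n. cst (fn v j) * unit_fn j)"
      using supp_expand[of "fn v" n] v by simp
    also have "\<dots> = (\<Sum>j<n. cst (fn v j) * T (unit_fn j))"
      by (simp add: Tsum scale)
    finally have *: "T (fn v) = (\<Sum>j<n. cst (fn v j) * T (unit_fn j))" .
    have **: "(\<Sum>j<m. cst (fn v j) * T (unit_fn j)) i = (\<Sum>j<m. fn v j * T (unit_fn j) i)" for m :: nat
      by (induction m) auto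
    show "fn (M *\<^sub>v v) i = T (fn v) i"
    proof (cases "i < n")
      case True
      have "(\<Sum>j<n. M $$ (i, j) * v $ j) = (\<Sum>j<n. fn v j * T (unit_fn j) i)"
        using v True by (intro sum.cong) (auto simp: M_def fn_def)
      then show ?thesis unfolding * **
        using v True by (auto simp: fn_def M_def scalar_prod_def atLeast0LessThan)
    next
      case False
      have "T (fn v) \<in> supp n" using v by (intro Tn) auto
      with False show ?thesis by (auto simp: fn_def supp_def M_def)
    qed
  qed
  have M: "M \<in> carrier_mat n n" by (simp add: M_def)
  have "det M \<noteq> 0"
  proof
    assume "det M = 0"
    then obtain v where v: "v \<in> carrier_vec n" "v \<noteq> 0\<^sub>v n" "M *\<^sub>v v = 0\<^sub>v n"
      using det_0_iff_vec_prod_zero_field[OF M] by auto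
    have "fn (0\<^sub>v n :: 'a vec) = 0" by (auto simp: fn_def fun_eq_iff)
    then have "T (fn v) = 0" using TM[OF v(1)] v by simp
    then have "fn v = 0" using inj[of "fn v"] v by simp
    then have "fn v = fn (0\<^sub>v n)" by (auto simp: fn_def fun_eq_iff)
    then show False using v fn_inj[of v n "0\<^sub>v n"] by auto
  qed
  then obtain N where N: "N \<in> carrier_mat n n" "M * N = 1\<^sub>m n"
    using det_non_zero_imp_unit[OF M] M unfolding Units_def by (auto simp: ring_mat_def)
  define v where "v = N *\<^sub>v vec n y"
  have v: "v \<in> carrier_vec n" using N by (auto simp: v_def)
  have "M *\<^sub>v v = vec n y"
    unfolding v_def using M N by (simp flip: assoc_mult_mat_vec[of M n n N n "vec n y"])
  then have "T (fn v) = y" using TM[OF v] y by simp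
  then show thesis using that[of "fn v"] v by simp
qed

text \<open>The resolvent preserves every invariant real subspace.  To reduce it to an injective operator
  on the whole space, k - M is continued by the identity on the kernel of a projection onto V.\<close>

lemma resolvent_invariant:
  assumes V: "fsubspace n V" and M: "M \<in> carrier_mat n n"
    and inv: "\<And>x. x \<in> V \<Longrightarrow> act M x \<in> V"
    and inj: "\<And>x. x \<in> supp n \<Longrightarrow> act M x = cst k * x \<Longrightarrow> x = 0"
    and v: "v \<in> cx V"
  obtains x where "x \<in> cx V" "cst k * x - act M x = v"
proof -
  obtain P where P': "P \<in> carrier_mat n n" "\<forall>x :: complex fvec. act P x \<in> cx V"
      "\<forall>v \<in> cx V. act P v = v"
    using projection_matrix[OF V] by (elim bexE conjE) (rule that)
  note P = P'(1) P'(2)[rule_format] P'(3)[rule_format]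
  define T where "T x = cst k * act P x - act M (act P x) + (x - act P x)" for x
  have R: "cst k * act P x - act M (act P x) \<in> cx V" for x
    by (intro cxD(4,5)[OF V] cx_act[of V M V] inv P(2))
  have PT: "act P (T x) = cst k * act P x - act M (act P x)" for x
    unfolding T_def using P(3)[OF R[of x]] P(3)[OF P(2)] by simp
  obtain x where x: "x \<in> supp n" "T x = v"
  proof (rule linear_injective_surjective[of n T v])
    show "T x = 0 \<Longrightarrow> x = 0" if "x \<in> supp n" for x
    proof -
      assume T0: "T x = 0"
      then have "cst k * act P x - act M (act P x) = 0" using PT[of x] by simp
      with T0 have "x = act P x" by (simp add: T_def)
      with \<open>cst k * act P x - act M (act P x) = 0\<close> inj[OF that] show "x = 0" by simp
    qed
  qed (use P M cxD(1)[OF V v] in \<open>simp_all add: T_def algebra_simps\<close>)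
  have "cst k * act P x - act M (act P x) = v"
    using PT[of x] x P(3)[OF v] by simp
  then show thesis using that P(2) by blast
qed

lemma resolvent_exists:
  assumes M: "M \<in> carrier_mat n n"
    and inj: "\<And>x. x \<in> supp n \<Longrightarrow> act M x = cst k * x \<Longrightarrow> x = 0"
    and v: "v \<in> supp n"
  obtains x where "x \<in> supp n" "cst k * x - act M x = (v :: complex fvec)"
  by (rule linear_injective_surjective[of n "\<lambda>x. cst k * x - act M x" v])
    (use M inj v that in \<open>auto simp: right_diff_distrib distrib_left mult.left_commute\<close>)

definition pairing :: "nat \<Rightarrow> 'a :: comm_ring_1 fvec \<Rightarrow> 'a fvec \<Rightarrow> 'a" where
  "pairing n x y = (\<Sum>i<n. x i * y i)"

lemma pairing_linear:
  "pairing n x (y + z) = pairing n x y + pairing n x z"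
  "pairing n x (y - z) = pairing n x y - pairing n x z"
  "pairing n x (cst c * y) = c * pairing n x y"
  "pairing n (cst c * x) y = c * pairing n x y"
  "pairing n 0 y = 0" "pairing n x 0 = 0"
  by (auto simp: pairing_def algebra_simps sum.distrib sum_subtractf sum_distrib_left)

lemma pairing_act:
  assumes "M \<in> carrier_mat m n"
  shows "pairing m x (act M y) = pairing n (act (transpose_mat M) x) y"
proof -
  have "pairing m x (act M y) = (\<Sum>i<m. \<Sum>j<n. x i * (of_real (M $$ (i, j)) * y j))"
    using assms by (auto simp: pairing_def act_def sum_distrib_left)
  also have "\<dots> = (\<Sum>j<n. \<Sum>i<m. x i * (of_real (M $$ (i, j)) * y j))"
    by (rule sum.swap)
  also have "\<dots> = pairing n (act (transpose_mat M) x) y"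
    using assms by (auto simp: pairing_def act_def sum_distrib_right sum_distrib_left mult_ac intro!: sum.cong)
  finally show ?thesis .
qed

lemma pairing_nondegenerate:
  assumes "x \<in> supp n" "\<And>y. y \<in> supp n \<Longrightarrow> pairing n x y = 0"
  shows "x = 0"
proof (rule ext)
  fix i
  have "(\<Sum>j<n. x j * unit_fn i j) = (if i < n then x i else 0)"
    by (simp add: unit_fn_def if_distrib[of "\<lambda>c. _ * c"] cong: if_cong)
  with assms(1) assms(2)[of "unit_fn i"] show "x i = 0 i"
    by (auto simp: supp_def pairing_def not_less split: if_splits)
      (metis le_less_linear unit_fn_supp assms(2) pairing_def)
qed

text \<open>If k - M is onto, then a left eigenvector for k is orthogonal to everything.\<close>

lemma no_eigenvector_transpose:
  assumes M: "M \<in> carrier_mat n n"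
    and inj: "\<And>x. x \<in> supp n \<Longrightarrow> act M x = cst k * x \<Longrightarrow> x = 0"
    and x: "x \<in> supp n" and ev: "act (transpose_mat M) x = cst k * (x :: complex fvec)"
  shows "x = 0"
proof (rule pairing_nondegenerate[OF x])
  fix y :: "complex fvec" assume "y \<in> supp n"
  then obtain z where z: "z \<in> supp n" "cst k * z - act M z = y"
    using resolvent_exists[OF M inj] by blast
  then show "pairing n x y = 0"
    using ev pairing_act[OF M, of x z] by (auto simp: pairing_linear)
qed

section \<open>Static stabilization of detectable pairs\<close>

definition stable_on :: "complex set \<Rightarrow> real mat \<Rightarrow> real fvec set \<Rightarrow> bool" where
  "stable_on Cg M V \<longleftrightarrow> (\<forall>k x. k \<notin> Cg \<longrightarrow> x \<in> cx V \<longrightarrow> act M x = cst k * x \<longrightarrow> x = 0)"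

definition ext_plane :: "real fvec set \<Rightarrow> real fvec \<Rightarrow> real fvec \<Rightarrow> real fvec set" where
  "ext_plane M a b = {m + cst s * a + cst t * b |m s t. m \<in> M}"

lemma ext_planeI: "m \<in> M \<Longrightarrow> m + cst s * a + cst t * b \<in> ext_plane M a b"
  by (auto simp: ext_plane_def)

lemma ext_plane_fsubspace:
  assumes M: "fsubspace n M" and ab: "a \<in> supp n" "b \<in> supp n"
  shows "fsubspace n (ext_plane M a b)"
  unfolding fsubspace_def
proof (intro conjI ballI allI subsetI)
  show "0 \<in> ext_plane M a b"
    using ext_planeI[OF fsubspaceD(2)[OF M], of 0 a 0 b] by simp
next
  fix x assume "x \<in> ext_plane M a b"
  then obtain m s t where x: "x = m + cst s * a + cst t * b" "m \<in> M" by (auto simp: ext_plane_def)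
  then show "x \<in> supp n" using ab fsubspaceD(1)[OF M x(2)] by simp
  show "cst c * x \<in> ext_plane M a b" for c
    using ext_planeI[OF fsubspaceD(4)[OF M x(2)], of c "c * s" a "c * t" b]
    by (simp add: x(1) distrib_left cst_hom mult.assoc)
  fix y assume "y \<in> ext_plane M a b"
  then obtain m' s' t' where y: "y = m' + cst s' * a + cst t' * b" "m' \<in> M" by (auto simp: ext_plane_def)
  have "x + y = (m + m') + cst (s + s') * a + cst (t + t') * b"
    by (simp add: x(1) y(1) cst_hom algebra_simps)
  then show "x + y \<in> ext_plane M a b"
    using ext_planeI[OF fsubspaceD(3)[OF M x(2) y(2)]] by metis
qed

text \<open>Over the complex numbers the plane is spanned by x and its conjugate instead of the real and
  imaginary part of x.\<close>

lemma cx_ext_plane: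
  assumes "v \<in> cx (ext_plane M (fRe x) (fIm x))"
  obtains m \<alpha> \<beta> where "m \<in> cx M" "v = m + cst \<alpha> * x + cst \<beta> * fcnj x"
proof -
  obtain m s t m' s' t' where h: "fRe v = m + cst s * fRe x + cst t * fIm x" "m \<in> M"
    "fIm v = m' + cst s' * fRe x + cst t' * fIm x" "m' \<in> M"
    using assms by (auto simp: cx_def ext_plane_def)
  define \<alpha> where "\<alpha> = (Complex s s' - \<i> * Complex t t') / 2"
  define \<beta> where "\<beta> = (Complex s s' + \<i> * Complex t t') / 2"
  have "v = (cfn m + cst \<i> * cfn m') + cst \<alpha> * x + cst \<beta> * fcnj x"
  proof (rule complex_fvec_eqI)
    have e: "Re \<alpha> = (s + t') / 2" "Im \<alpha> = (s' - t) / 2" "Re \<beta> = (s - t') / 2" "Im \<beta> = (s' + t) / 2"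
      by (auto simp: \<alpha>_def \<beta>_def)
    show "fRe v = fRe ((cfn m + cst \<i> * cfn m') + cst \<alpha> * x + cst \<beta> * fcnj x)"
      unfolding h(1) by (rule ext, simp add: e) (simp add: field_simps)
    show "fIm v = fIm ((cfn m + cst \<i> * cfn m') + cst \<alpha> * x + cst \<beta> * fcnj x)"
      unfolding h(3) by (rule ext, simp add: e) (simp add: field_simps)
  qed
  moreover have "cfn m + cst \<i> * cfn m' \<in> cx M"
    using h by (auto simp: cx_def)
  ultimately show thesis using that by blast
qed

text \<open>On the plane spanned by the eigenvectors for l and l' = cnj l, output injection with the gains
  \<phi> and \<phi>' changes the characteristic polynomial (k - l)(k - l') into
  (k - l)(k - l') - \<phi>(k - l') - \<phi>'(k - l).  The prescribed values make it agree with (k - c)^2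
  at l and at l', hence everywhere.\<close>

lemma pole_shift_scalar:
  fixes c k l l' \<phi> \<phi>' \<alpha> \<beta> :: complex
  assumes "l \<noteq> l'" and p: "\<phi> * (l - l') = - (c - l)\<^sup>2" "\<phi>' * (l' - l) = - (c - l')\<^sup>2"
    and e: "(k - l) * \<alpha> = (\<alpha> + \<beta>) * \<phi>" "(k - l') * \<beta> = (\<alpha> + \<beta>) * \<phi>'" and k: "k \<noteq> c"
  shows "\<alpha> = 0 \<and> \<beta> = 0"
proof -
  have "(k - l') * ((k - l) * \<alpha>) + (k - l) * ((k - l') * \<beta>)
      = (k - l') * ((\<alpha> + \<beta>) * \<phi>) + (k - l) * ((\<alpha> + \<beta>) * \<phi>')"
    by (simp only: e)
  then have "(\<alpha> + \<beta>) * ((k - l) * (k - l') - \<phi> * (k - l') - \<phi>' * (k - l)) = 0"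
    by (simp add: algebra_simps)
  moreover have "(k - l) * (k - l') - \<phi> * (k - l') - \<phi>' * (k - l) = (k - c)\<^sup>2"
  proof -
    have "(l - l') * ((k - l) * (k - l') - \<phi> * (k - l') - \<phi>' * (k - l))
      = (l - l') * (k - l) * (k - l') - (\<phi> * (l - l')) * (k - l') + (\<phi>' * (l' - l)) * (k - l)"
      by (simp add: algebra_simps)
    also have "\<dots> = (l - l') * (k - c)\<^sup>2"
      unfolding p by (simp add: algebra_simps power2_eq_square)
    finally show ?thesis using \<open>l \<noteq> l'\<close> by simp
  qed
  ultimately have "(\<alpha> + \<beta>) * (k - c)\<^sup>2 = 0" by simp
  then have s: "\<alpha> + \<beta> = 0" using assms by simp
  with e have "(k - l) * \<alpha> = 0" "(k - l') * \<beta> = 0" by auto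
  with s \<open>l \<noteq> l'\<close> show ?thesis by (auto simp: add_eq_0_iff)
qed

text \<open>One step of stabilization.  M is an invariant subspace on which A is already stable, and x is an
  unstable eigenvector, which C detects.  Output injection along x (or, if the eigenvalue is not
  real, along the real plane of x) moves the eigenvalue to c and changes A on M only by vectors of
  that line or plane.  As x is not in M, the extended space is again stable: modulo M the new
  eigenvalue is c, and on M the old stability applies.\<close>

lemma stabilize_eigenvector:
  assumes A: "A \<in> carrier_mat n n" and C: "C \<in> carrier_mat p n" and c: "of_real c \<in> Cg"
    and obs: "\<And>k x. k \<notin> Cg \<Longrightarrow> x \<in> supp n \<Longrightarrow> act A x = cst k * x \<Longrightarrow> act C x = 0 \<Longrightarrow> x = (0 :: complex fvec)"
    and M: "fsubspace n M" and inv: "\<And>x. x \<in> M \<Longrightarrow> act A x \<in> M" and st: "stable_on Cg A M"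
    and l: "l \<notin> Cg" and x: "x \<in> supp n" "act A x = cst l * x" "x \<noteq> 0"
  obtains G M' where "G \<in> carrier_mat n p" "M \<subset> M'" "fsubspace n M'" 
    "\<And>x. x \<in> M' \<Longrightarrow> act (A + G * C) x \<in> M'" "stable_on Cg (A + G * C) M'"
proof (cases "l \<in> \<real>")
  case True
  then obtain r where r: "l = of_real r" by (auto elim: Reals_cases)
  have "act A (fRe x) = cst r * fRe x" "act A (fIm x) = cst r * fIm x"
    using arg_cong[OF x(2), of fRe] arg_cong[OF x(2), of fIm] by (auto simp: r)
  moreover have "fRe x \<noteq> 0 \<or> fIm x \<noteq> 0"
    using x(3) complex_fvec_eqI[of x 0] by auto
  ultimately obtain y0 where y0: "y0 \<in> supp n" "act A y0 = cst r * y0" "y0 \<noteq> 0"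
    using x(1) by (metis fIm_supp fRe_supp)
  have "act A (cfn y0) = cst l * cfn y0" 
    using arg_cong[OF y0(2), of cfn] by (simp add: r)
  with obs[OF l, of "cfn y0"] y0 have "cfn (act C y0) \<noteq> 0" by auto
  then have "act C y0 \<noteq> 0" using cfn_eq_0_iff[of "act C y0"] by simp
  then obtain j where j0: "act C y0 j \<noteq> 0" by (auto simp: fun_eq_iff)
  then have j: "j < p" using C by (auto simp: act_def split: if_splits)
  define y where "y = cst (1 / act C y0 j) * y0"
  have y: "y \<in> supp n" "act A y = cst r * y" "act C y j = 1" "y \<noteq> 0"
    using y0 j0 by (auto simp: y_def mult.left_commute)
  have Ay: "act A (cfn y) = cst l * cfn y" 
    using arg_cong[OF y(2), of cfn] by (simp add: r)
  have Cy: "act C (cfn y) j = 1"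
  proof -
    have "cfn (act C y) j = 1" by (simp add: cfn_def y(3))
    then show ?thesis by simp
  qed
  have yM: "y \<notin> M"
  proof
    assume "y \<in> M"
    then have "cfn y \<in> cx M" using cxD(8)[OF M] by simp
    with st l Ay have "cfn y = 0" unfolding stable_on_def by blast
    with y(4) show False by simp
  qed
  \<comment> \<open>Output j of y is 1, so that A + G C sends y to r y + d = c y.\<close>
  define d where "d = cst (c - r) * y"
  have d: "d \<in> supp n" using y by (simp add: d_def)
  define G where "G = rank_one n p d j"
  have act_real: "act (A + G * C) v = act A v + cst (act C v j) * d" for v :: "real fvec"
    using A C d j by (simp add: G_def act_add act_mult act_rank_one_real)
  have act_cx: "act (A + G * C) v = act A v + cst (act C v j) * cfn d" for v :: "complex fvec"
    using A C d j by (simp add: G_def act_add act_mult act_rank_one_complex)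
  define M' where "M' = ext_plane M y 0"
  have M': "fsubspace n M'" unfolding M'_def by (rule ext_plane_fsubspace[OF M y(1)]) simp
  show thesis
  proof (rule that[of G M'])
    show "G \<in> carrier_mat n p" by (simp add: G_def)
    show "M \<subset> M'"
    proof
      show "M \<subseteq> M'" using ext_planeI[of _ M 0 y 0 0] by (auto simp: M'_def)
      have "y \<in> M'" using ext_planeI[OF fsubspaceD(2)[OF M], of 1 y 0 0] by (simp add: M'_def)
      with yM show "M \<noteq> M'" by auto
    qed
    show "fsubspace n M'" by fact
    show "act (A + G * C) v \<in> M'" if vM: "v \<in> M'" for v
    proof -
      obtain m s where v: "v = m + cst s * y" "m \<in> M" using vM by (auto simp: M'_def ext_plane_def)
      have "act (A + G * C) v = act A m + cst (s * r + act C v j * (c - r)) * y + cst 0 * 0"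
        unfolding act_real by (simp add: v(1) d_def y(2) cst_hom algebra_simps)
      then show ?thesis unfolding M'_def using ext_planeI[OF inv[OF v(2)]] by metis
    qed
    show "stable_on Cg (A + G * C) M'"
      unfolding stable_on_def
    proof (intro allI impI)
      fix k v assume k: "k \<notin> Cg" and v: "v \<in> cx M'" and ev: "act (A + G * C) v = cst k * v"
      have y': "y = fRe (cfn y)" "0 = fIm (cfn y)" by auto
      obtain m \<alpha>' \<beta> where m: "m \<in> cx M" "v = m + cst \<alpha>' * cfn y + cst \<beta> * fcnj (cfn y)"
        using cx_ext_plane[of v M "cfn y"] v by (auto simp: M'_def)
      define \<alpha> where "\<alpha> = \<alpha>' + \<beta>"
      have "fcnj (cfn y) = cfn y" by (auto simp: fcnj_def cfn_def)
      then have v: "v = m + cst \<alpha> * cfn y" by (simp add: m(2) \<alpha>_def cst_hom distrib_right add.assoc)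
      define a where "a = k * \<alpha> - \<alpha> * l - (act C m j + \<alpha>) * (of_real c - l)"
      have "act A v + cst (act C v j) * cfn d = cst k * v"
        using ev unfolding act_cx .
      then have am: "act A m - cst k * m = cst a * cfn y"
        by (simp add: v d_def a_def r Ay Cy cst_hom algebra_simps)
      have "act A m - cst k * m \<in> cx M"
        using cxD[OF M] cx_act[OF inv] m(1) by simp
      then have "a = 0"
      proof (rule contrapos_pp)
        assume "a \<noteq> 0"
        show "act A m - cst k * m \<notin> cx M"
        proof
          assume "act A m - cst k * m \<in> cx M"
          then have "cst (1 / a) * (cst a * cfn y) \<in> cx M" unfolding am using cxD(4)[OF M] by blast
          then have "cfn y \<in> cx M" using \<open>a \<noteq> 0\<close> by (simp flip: cst_hom mult.assoc)
          with yM cxD(8)[OF M] show False by simp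
        qed
      qed
      with am have "act A m = cst k * m" by simp
      with st k m(1) have "m = 0" unfolding stable_on_def by blast
      with \<open>a = 0\<close> have "\<alpha> * (k - of_real c) = 0" by (simp add: a_def algebra_simps)
      with k c have "\<alpha> = 0" by auto
      with \<open>m = 0\<close> show "v = 0" by (simp add: v)
    qed
  qed
next
  case False
  then have ll: "l \<noteq> cnj l" by (metis Reals_cnj_iff)
  have "act C x \<noteq> 0" using obs[OF l x(1,2)] x(3) by auto
  then obtain j where j0: "act C x j \<noteq> 0" by (auto simp: fun_eq_iff)
  then have j: "j < p" using C by (auto simp: act_def split: if_splits)
  define z where "z = cst (1 / act C x j) * x"
  have z: "z \<in> supp n" "act A z = cst l * z" "act C z j = 1" "z \<noteq> 0"
    using x j0 by (auto simp: z_def mult.left_commute)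
  have Az': "act A (fcnj z) = cst (cnj l) * fcnj z"
    using arg_cong[OF z(2), of fcnj] by simp
  have Cz': "act C (fcnj z) j = 1"
  proof -
    have "fcnj (act C z) j = 1" by (simp add: fcnj_def z(3))
    then show ?thesis by simp
  qed
  have zM: "z \<notin> cx M" using st l z unfolding stable_on_def by blast
  have zM': "fcnj z \<notin> cx M" using zM cxD(7)[OF M, of "fcnj z"] by auto
  have indep: "a = 0 \<and> b = 0" if "cst a * z + cst b * fcnj z \<in> cx M" for a b
  proof -
    let ?d = "cst a * z + cst b * fcnj z"
    have Ad: "act A ?d \<in> cx M" using cx_act[OF inv] that by blast
    have "act A ?d - cst (cnj l) * ?d \<in> cx M" "act A ?d - cst l * ?d \<in> cx M"
      using cxD[OF M] Ad that by blast+
    moreover have "act A ?d - cst (cnj l) * ?d = cst (a * (l - cnj l)) * z"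
      "act A ?d - cst l * ?d = cst (b * (cnj l - l)) * fcnj z"
      by (simp_all add: z(2) Az' cst_hom algebra_simps)
    ultimately have *: "cst (a * (l - cnj l)) * z \<in> cx M" "cst (b * (cnj l - l)) * fcnj z \<in> cx M"
      by simp_all
    have "cst (1 / e) * (cst e * w) = w" if "e \<noteq> 0" for e and w :: "complex fvec"
      using that by (simp flip: cst_hom mult.assoc)
    then have "w \<in> cx M" if "cst e * w \<in> cx M" "e \<noteq> 0" for e w
      using that cxD(4)[OF M] by metis
    with * zM zM' have "a * (l - cnj l) = 0" "b * (cnj l - l) = 0" by blast+
    with ll show ?thesis by auto
  qed
  define \<phi> where "\<phi> = - (of_real c - l)\<^sup>2 / (l - cnj l)"
  have p1: "\<phi> * (l - cnj l) = - (of_real c - l)\<^sup>2" using ll by (simp add: \<phi>_def)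
  have p2: "cnj \<phi> * (cnj l - l) = - (of_real c - cnj l)\<^sup>2" 
    using arg_cong[OF p1, of cnj] by simp
  \<comment> \<open>The real vector with coordinates \<phi> and cnj \<phi> in the basis z, cnj z; both of these have output
    j equal to 1.\<close>
  define d where "d = cst (2 * Re \<phi>) * fRe z + cst (- 2 * Im \<phi>) * fIm z"
  have d: "d \<in> supp n" using z by (simp add: d_def)
  have cd: "cfn d = cst \<phi> * z + cst (cnj \<phi>) * fcnj z"
    by (rule complex_fvec_eqI) (auto simp: d_def fun_eq_iff)
  define G where "G = rank_one n p d j"
  have act_real: "act (A + G * C) v = act A v + cst (act C v j) * d" for v :: "real fvec"
    using A C d j by (simp add: G_def act_add act_mult act_rank_one_real)
  have act_cx: "act (A + G * C) v = act A v + cst (act C v j) * cfn d" for v :: "complex fvec"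
    using A C d j by (simp add: G_def act_add act_mult act_rank_one_complex)
  define M' where "M' = ext_plane M (fRe z) (fIm z)"
  have M': "fsubspace n M'" unfolding M'_def by (rule ext_plane_fsubspace[OF M]) (use z in auto)
  have AR: "act A (fRe z) = cst (Re l) * fRe z - cst (Im l) * fIm z"
    "act A (fIm z) = cst (Re l) * fIm z + cst (Im l) * fRe z"
    using arg_cong[OF z(2), of fRe] arg_cong[OF z(2), of fIm] by auto
  show thesis
  proof (rule that[of G M'])
    show "G \<in> carrier_mat n p" by (simp add: G_def)
    show "M \<subset> M'"
    proof
      show "M \<subseteq> M'" using ext_planeI[of _ M 0 _ 0 _] by (fastforce simp: M'_def)
      have "fRe z \<in> M'" "fIm z \<in> M'"
        using ext_planeI[OF fsubspaceD(2)[OF M], of 1 "fRe z" 0 "fIm z"]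
          ext_planeI[OF fsubspaceD(2)[OF M], of 0 "fRe z" 1 "fIm z"] by (auto simp: M'_def)
      then have "z \<in> cx M'" by (simp add: cx_def)
      with zM show "M \<noteq> M'" by auto
    qed
    show "fsubspace n M'" by fact
    show "act (A + G * C) v \<in> M'" if vM: "v \<in> M'" for v
    proof -
      obtain m s t where v: "v = m + cst s * fRe z + cst t * fIm z" "m \<in> M" 
        using vM by (auto simp: M'_def ext_plane_def)
      have "act (A + G * C) v = act A m + cst (s * Re l + t * Im l + act C v j * (2 * Re \<phi>)) * fRe z
           + cst (t * Re l - s * Im l - act C v j * (2 * Im \<phi>)) * fIm z"
        unfolding act_real by (rule ext) (simp add: v(1) d_def AR algebra_simps)
      then show ?thesis unfolding M'_def using ext_planeI[OF inv[OF v(2)]] by metis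
    qed
    show "stable_on Cg (A + G * C) M'"
      unfolding stable_on_def
    proof (intro allI impI)
      fix k v assume k: "k \<notin> Cg" and v: "v \<in> cx M'" and ev: "act (A + G * C) v = cst k * v"
      obtain m \<alpha> \<beta> where m: "m \<in> cx M" and v: "v = m + cst \<alpha> * z + cst \<beta> * fcnj z"
        using cx_ext_plane[of v M z] v by (auto simp: M'_def)
      define \<gamma> where "\<gamma> = act C m j + \<alpha> + \<beta>"
      define a where "a = k * \<alpha> - \<alpha> * l - \<gamma> * \<phi>"
      define b where "b = k * \<beta> - \<beta> * cnj l - \<gamma> * cnj \<phi>"
      have Cv: "act C v j = \<gamma>" by (simp add: v z(3) Cz' \<gamma>_def)
      have "act A v + cst (act C v j) * cfn d = cst k * v"
        using ev unfolding act_cx .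
      then have am: "act A m - cst k * m = cst a * z + cst b * fcnj z"
        unfolding Cv cd by (simp add: v z(2) Az' a_def b_def cst_hom algebra_simps)
      have "act A m - cst k * m \<in> cx M"
        using cxD[OF M] cx_act[OF inv] m by simp
      then have ab: "a = 0" "b = 0" using indep unfolding am by auto
      with am have "act A m = cst k * m" by simp
      with st k m have "m = 0" unfolding stable_on_def by blast
      with ab have "\<alpha> = 0 \<and> \<beta> = 0"
        by (intro pole_shift_scalar[OF ll p1 p2, of k]) (use k c in \<open>auto simp: a_def b_def \<gamma>_def algebra_simps\<close>)
      with \<open>m = 0\<close> show "v = 0" by (simp add: v)
    qed
  qed
qed

text \<open>A pair without undetected unstable eigenvectors is stabilized by a real static gain.  Choose
  the gain such that A + G C has a stable invariant subspace of maximal dimension.  If an unstable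
  eigenvector were left, stabilize_eigenvector would enlarge this subspace.  Output injection
  preserves the hypothesis, since it does not change A on the kernel of C.\<close>

lemma detectable_stabilization:
  assumes A: "A \<in> carrier_mat n n" and C: "C \<in> carrier_mat p n" and c: "of_real c \<in> Cg"
    and obs: "\<And>k x. k \<notin> Cg \<Longrightarrow> x \<in> supp n \<Longrightarrow> act A x = cst k * x \<Longrightarrow> act C x = 0 \<Longrightarrow> x = (0 :: complex fvec)"
  obtains G where "G \<in> carrier_mat n p" 
    "\<And>k x. k \<notin> Cg \<Longrightarrow> x \<in> supp n \<Longrightarrow> act (A + G * C) x = cst k * x \<Longrightarrow> x = (0 :: complex fvec)"
proof -
  define good where "good G M \<longleftrightarrow> G \<in> carrier_mat n p \<and> fsubspace n M \<and> (\<forall>x\<in>M. act (A + G * C) x \<in> M) 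
    \<and> stable_on Cg (A + G * C) M" for G M
  have "\<exists>G M. good G M \<and> (\<forall>G' M'. good G' M' \<longrightarrow> card (pivots M') \<le> card (pivots M))"
  proof -
    define S where "S = {card (pivots M) |G M. good G M}"
    have "good (0\<^sub>m n p) {0}"
    proof -
      have "A + 0\<^sub>m n p * C = A" using A C by auto
      moreover have "x = 0" if "x \<in> cx {0}" for x
        by (rule complex_fvec_eqI) (use that in \<open>auto simp: cx_def\<close>)
      ultimately show ?thesis by (auto simp: good_def fsubspace_zero stable_on_def)
    qed
    then have "S \<noteq> {}" by (auto simp: S_def)
    moreover have "S \<subseteq> {..n}"
      using pivots_bound card_mono[of "{..<n}"] by (fastforce simp: S_def good_def)
    then have "finite S" using finite_subset by blast
    ultimately have "Max S \<in> S" "\<And>s. s \<in> S \<Longrightarrow> s \<le> Max S" by auto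
    then show ?thesis unfolding S_def by force
  qed
  then obtain G M where G: "good G M" and max: "\<And>G' M'. good G' M' \<Longrightarrow> card (pivots M') \<le> card (pivots M)"
    by blast
  have Gc: "G \<in> carrier_mat n p" and M: "fsubspace n M" "\<And>x. x \<in> M \<Longrightarrow> act (A + G * C) x \<in> M"
    "stable_on Cg (A + G * C) M" using G by (auto simp: good_def)
  have A': "A + G * C \<in> carrier_mat n n" using A C Gc by auto
  show thesis
  proof (rule that[OF Gc], rule ccontr)
    fix l and x :: "complex fvec"
    assume x: "l \<notin> Cg" "x \<in> supp n" "act (A + G * C) x = cst l * x" "x \<noteq> 0"
    have obs': "z = 0" if "k \<notin> Cg" "z \<in> supp n" "act (A + G * C) z = cst k * z" "act C z = 0" for k z
      using obs[OF that(1,2) _ that(4)] that(3,4) A C Gc by (simp add: act_add act_mult)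
    obtain G' M' where G': "G' \<in> carrier_mat n p" "M \<subset> M'" "fsubspace n M'" 
      "\<And>x. x \<in> M' \<Longrightarrow> act (A + G * C + G' * C) x \<in> M'" "stable_on Cg (A + G * C + G' * C) M'"
      by (rule stabilize_eigenvector[OF A' C c _ M x]) (rule obs', assumption+, rule that, assumption+)
    have e: "A + (G + G') * C = A + G * C + G' * C"
      using A C Gc G' by (simp add: add_mult_distrib_mat[of G n p G' C n] assoc_add_mat[of A n n "G * C" "G' * C"])
    have "good (G + G') M'" using G' Gc by (auto simp: good_def e)
    then have "card (pivots M') \<le> card (pivots M)" by (rule max)
    moreover have "card (pivots M) < card (pivots M')"
      using pivots_strict_mono[OF M(1) G'(3,2)] pivots_bound[OF G'(3)] finite_subset
      by (intro psubset_card_mono) auto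
    ultimately show False by simp
  qed
qed

section \<open>Output nulling and input containing subspaces\<close>

lemma fsubspace_supp [simp]: "fsubspace n (supp n)"
  by (auto simp: fsubspace_def)

lemma act_feedback:
  assumes "A \<in> carrier_mat r n" "B \<in> carrier_mat r m" "F \<in> carrier_mat m n"
  shows "act (A + B * F) x = act A x + act B (act F x)"
  using assms by (simp add: act_add act_mult)

text \<open>The defining inclusion of an output nulling subspace, read pointwise: some input keeps the state in
  V and the output zero.\<close>

definition out_nulling :: "real mat \<Rightarrow> real mat \<Rightarrow> real mat \<Rightarrow> real mat \<Rightarrow> real fvec set \<Rightarrow> bool" where
  "out_nulling A B C D V \<longleftrightarrow> fsubspace (dim_row A) V \<and>
     (\<forall>x\<in>V. \<exists>u. act A x + act B u \<in> V \<and> act C x + act D u = 0)"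

definition in_containing :: "real mat \<Rightarrow> real mat \<Rightarrow> real mat \<Rightarrow> real mat \<Rightarrow> real fvec set \<Rightarrow> bool" where
  "in_containing A B C D S \<longleftrightarrow> fsubspace (dim_row A) S \<and>
     (\<forall>x\<in>S. \<forall>u. act C x + act D u = 0 \<longrightarrow> act A x + act B u \<in> S)"

definition Vst :: "real mat \<Rightarrow> real mat \<Rightarrow> real mat \<Rightarrow> real mat \<Rightarrow> real fvec set" where
  "Vst A B C D = \<Union> {V. out_nulling A B C D V}"

definition Sst :: "real mat \<Rightarrow> real mat \<Rightarrow> real mat \<Rightarrow> real mat \<Rightarrow> real fvec set" where
  "Sst A B C D = \<Inter> {S. in_containing A B C D S}"

lemma out_nulling_sum:
  assumes V: "out_nulling A B C D V" and W: "out_nulling A B C D W"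
  shows "out_nulling A B C D (V + W)"
  unfolding out_nulling_def
proof (intro conjI ballI)
  show "fsubspace (dim_row A) (V + W)" using V W by (auto simp: out_nulling_def intro: fsubspace_sum)
  fix x assume "x \<in> V + W"
  then obtain v w where x: "x = v + w" "v \<in> V" "w \<in> W" by (rule set_plus_elim)
  obtain u where u: "act A v + act B u \<in> V" "act C v + act D u = 0" using V x by (auto simp: out_nulling_def)
  obtain u' where u': "act A w + act B u' \<in> W" "act C w + act D u' = 0" using W x by (auto simp: out_nulling_def)
  have "act A x + act B (u + u') = (act A v + act B u) + (act A w + act B u')"
    by (simp add: x(1) add_ac)
  then have "act A x + act B (u + u') \<in> V + W" using set_plus_intro[OF u(1) u'(1)] by (simp only:)
  moreover have "act C x + act D (u + u') = (act C v + act D u) + (act C w + act D u')"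
    by (simp add: x(1) add_ac)
  then have "act C x + act D (u + u') = 0" by (simp add: u u')
  ultimately show "\<exists>u. act A x + act B u \<in> V + W \<and> act C x + act D u = 0" by blast
qed

lemma set_plus_superset:
  assumes "fsubspace n V" "fsubspace n W"
  shows "V \<subseteq> V + W" "W \<subseteq> V + W"
proof -
  show "V \<subseteq> V + W"
  proof
    fix x assume "x \<in> V"
    from set_plus_intro[OF this fsubspaceD(2)[OF assms(2)]] show "x \<in> V + W" by simp
  qed
  show "W \<subseteq> V + W"
  proof
    fix x assume "x \<in> W"
    from set_plus_intro[OF fsubspaceD(2)[OF assms(1)] this] show "x \<in> V + W" by simp
  qed
qed

lemma out_nulling_zero: "out_nulling A B C D {0}"
  by (auto simp: out_nulling_def fsubspace_zero intro!: exI[of _ 0])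

lemma out_nulling_Vst: "out_nulling A B C D (Vst A B C D)"
proof -
  have "fsubspace (dim_row A) (Vst A B C D)"
    unfolding fsubspace_def
  proof (intro conjI ballI allI subsetI)
    show "0 \<in> Vst A B C D" unfolding Vst_def using out_nulling_zero by blast
  next
    fix x assume "x \<in> Vst A B C D"
    then obtain V where V: "out_nulling A B C D V" "x \<in> V" by (auto simp: Vst_def)
    then have fV: "fsubspace (dim_row A) V" by (simp add: out_nulling_def)
    show "x \<in> supp (dim_row A)" using fsubspaceD(1)[OF fV V(2)] .
    show "cst c * x \<in> Vst A B C D" for c using V fsubspaceD(4)[OF fV V(2)] unfolding Vst_def by blast
    fix y assume "y \<in> Vst A B C D"
    then obtain W where W: "out_nulling A B C D W" "y \<in> W" by (auto simp: Vst_def)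
    have "x + y \<in> V + W" using V(2) W(2) by (rule set_plus_intro)
    with out_nulling_sum[OF V(1) W(1)] show "x + y \<in> Vst A B C D" unfolding Vst_def by blast
  qed
  then show ?thesis unfolding out_nulling_def Vst_def by blast
qed

lemma Vst_greatest: "out_nulling A B C D V \<Longrightarrow> V \<subseteq> Vst A B C D"
  by (auto simp: Vst_def)

lemma in_containing_supp: "A \<in> carrier_mat n n \<Longrightarrow> B \<in> carrier_mat n m \<Longrightarrow> in_containing A B C D (supp n)"
  by (auto simp: in_containing_def)

lemma in_containing_Sst:
  assumes "A \<in> carrier_mat n n" "B \<in> carrier_mat n m"
  shows "in_containing A B C D (Sst A B C D)"
proof -
  have "supp n \<in> {S. in_containing A B C D S}" using in_containing_supp[OF assms] by simp
  moreover have "n = dim_row A" using assms by auto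
  ultimately show ?thesis
    unfolding in_containing_def Sst_def fsubspace_def by blast
qed

lemma Sst_least: "in_containing A B C D S \<Longrightarrow> Sst A B C D \<subseteq> S"
  by (auto simp: Sst_def)

lemma out_nulling_friend:
  assumes A: "A \<in> carrier_mat n n" and B: "B \<in> carrier_mat n m" 
    and V: "out_nulling A B C D V" and D: "D \<in> carrier_mat p m"
  obtains F where "F \<in> carrier_mat m n" 
    "\<And>x. x \<in> V \<Longrightarrow> act A x + act B (act F x) \<in> V" "\<And>x. x \<in> V \<Longrightarrow> act C x + act D (act F x) = 0"
proof -
  have fV: "fsubspace n V" using V A by (auto simp: out_nulling_def)
  define R where "R = {(x, u). x \<in> V \<and> u \<in> supp m \<and> act A x + act B u \<in> V \<and> act C x + act D u = 0}"
  obtain F where F: "F \<in> carrier_mat m n" "\<And>v u. (v, u) \<in> R \<Longrightarrow> (v, act F v) \<in> R"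
  proof (rule linear_selection[OF fsubspace_supp, of R n m])
    fix v u v' u' assume a: "(v, u) \<in> R" "(v', u') \<in> R"
    have "act A (v + v') + act B (u + u') = (act A v + act B u) + (act A v' + act B u')" 
      "act C (v + v') + act D (u + u') = (act C v + act D u) + (act C v' + act D u')"
      by (simp_all add: add_ac)
    with a show "(v + v', u + u') \<in> R" by (simp add: R_def fsubspaceD[OF fV] del: act_linear)
  next
    fix c v u assume a: "(v, u) \<in> R"
    have "act A (cst c * v) + act B (cst c * u) = cst c * (act A v + act B u)" 
      "act C (cst c * v) + act D (cst c * u) = cst c * (act C v + act D u)"
      by (simp_all add: distrib_left)
    with a show "(cst c * v, cst c * u) \<in> R" by (simp add: R_def fsubspaceD[OF fV] del: act_linear)
  qed (auto simp: R_def fsubspaceD[OF fV])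
  have "(x, act F x) \<in> R" if x: "x \<in> V" for x
  proof -
    obtain u where "act A x + act B u \<in> V" "act C x + act D u = 0" using V x by (auto simp: out_nulling_def)
    then have "(x, trunc m u) \<in> R" using x B D by (auto simp: R_def)
    then show ?thesis by (rule F(2))
  qed
  then show thesis using that[OF F(1)] by (auto simp: R_def)
qed

lemma in_containing_friend:
  assumes A: "A \<in> carrier_mat n n" and B: "B \<in> carrier_mat n m" and C: "C \<in> carrier_mat p n"
    and S: "in_containing A B C D S" and D: "D \<in> carrier_mat p m"
  obtains G where "G \<in> carrier_mat n p" 
    "\<And>x u. x \<in> S \<Longrightarrow> act A x + act B u + act G (act C x + act D u) \<in> S"
proof -
  have fS: "fsubspace n S" using S A by (auto simp: in_containing_def)
  define R where "R = {(y, z). z \<in> supp n \<and> (\<exists>x\<in>S. \<exists>u. y = act C x + act D u \<and> act A x + act B u + z \<in> S)}"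
  obtain G where G: "G \<in> carrier_mat n p" "\<And>v u. (v, u) \<in> R \<Longrightarrow> (v, act G v) \<in> R"
  proof (rule linear_selection[OF fsubspace_supp, of R p n])
    fix y z y' z' assume a: "(y, z) \<in> R" "(y', z') \<in> R"
    then obtain x u x' u' where h: "z \<in> supp n" "z' \<in> supp n" "x \<in> S" "x' \<in> S" 
      "y = act C x + act D u" "y' = act C x' + act D u'" 
      "act A x + act B u + z \<in> S" "act A x' + act B u' + z' \<in> S" by (auto simp: R_def)
    have "act A (x + x') + act B (u + u') + (z + z') = (act A x + act B u + z) + (act A x' + act B u' + z')"
      by (simp add: add_ac)
    then have "act A (x + x') + act B (u + u') + (z + z') \<in> S"
      using fsubspaceD(3)[OF fS h(7,8)] by (simp only:)
    moreover have "y + y' = act C (x + x') + act D (u + u')"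
      by (simp add: add_ac h)
    moreover have "z + z' \<in> supp n" "x + x' \<in> S" using h by (simp_all add: fsubspaceD[OF fS])
    ultimately show "(y + y', z + z') \<in> R" unfolding R_def by blast
  next
    fix c y z assume a: "(y, z) \<in> R"
    then obtain x u where h: "z \<in> supp n" "x \<in> S" "y = act C x + act D u" 
      "act A x + act B u + z \<in> S" by (auto simp: R_def)
    have "act A (cst c * x) + act B (cst c * u) + cst c * z = cst c * (act A x + act B u + z)"
      by (simp add: distrib_left)
    then have "act A (cst c * x) + act B (cst c * u) + cst c * z \<in> S"
      using fsubspaceD(4)[OF fS h(4)] by (simp only:)
    moreover have "cst c * y = act C (cst c * x) + act D (cst c * u)"
      by (simp add: distrib_left h)
    moreover have "cst c * z \<in> supp n" "cst c * x \<in> S" using h by (simp_all add: fsubspaceD[OF fS])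
    ultimately show "(cst c * y, cst c * z) \<in> R" unfolding R_def by blast
  next
    show "(0, 0) \<in> R" unfolding R_def by (auto simp: fsubspaceD[OF fS] intro!: bexI[of _ 0] exI[of _ 0])
  next
    fix y z assume "(y, z) \<in> R"
    then show "y \<in> supp p \<and> z \<in> supp n" using C D by (auto simp: R_def)
  qed auto
  have "act A x + act B u + act G (act C x + act D u) \<in> S" if x: "x \<in> S" for x u
  proof -
    let ?y = "act C x + act D u"
    have "(?y, - (act A x + act B u)) \<in> R"
      using x A B by (auto simp: R_def fsubspaceD[OF fS] intro!: bexI[of _ x] exI[of _ u])
    from G(2)[OF this] obtain x' u' where h: "x' \<in> S" "?y = act C x' + act D u'" 
      "act A x' + act B u' + act G ?y \<in> S" unfolding R_def by blast
    have "act C (x - x') + act D (u - u') = ?y - (act C x' + act D u')" by (simp add: algebra_simps)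
    also have "\<dots> = 0" using h(2) by simp
    finally have "act A (x - x') + act B (u - u') \<in> S" using S fsubspaceD(5)[OF fS x h(1)] unfolding in_containing_def by blast
    from fsubspaceD(3)[OF fS this h(3)] show ?thesis by (simp add: algebra_simps)
  qed
  then show thesis using that[OF G(1)] by blast
qed

text \<open>The Hautus condition on V yields a stabilizing friend.  Let F0 be any friend and J a projection onto
  the inputs that neither leave V nor reach the output.  The pair (A + B F0, B J) restricted to V
  and continued by c on a complement of V satisfies the Hautus condition on the whole space.  So its
  transpose is stabilized by detectable_stabilization, and F0 + J F1 is a friend for every F1.\<close>

lemma out_nulling_stabilization:
  assumes A: "A \<in> carrier_mat n n" and B: "B \<in> carrier_mat n m" and C: "C \<in> carrier_mat p n"
    and D: "D \<in> carrier_mat p m" and c: "of_real c \<in> Cg"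
    and V: "out_nulling A B C D V"
    and onto: "\<And>k v. k \<notin> Cg \<Longrightarrow> v \<in> cx V \<Longrightarrow> 
      \<exists>x\<in>cx V. \<exists>u. v = cst k * x - act A x - act B u \<and> act C x + act D u = 0"
  obtains F where "F \<in> carrier_mat m n" 
    "\<And>x. x \<in> V \<Longrightarrow> act A x + act B (act F x) \<in> V" "\<And>x. x \<in> V \<Longrightarrow> act C x + act D (act F x) = 0"
    "stable_on Cg (A + B * F) V"
proof -
  have fV: "fsubspace n V" using V A by (auto simp: out_nulling_def)
  obtain F0 where F0: "F0 \<in> carrier_mat m n" "\<And>x. x \<in> V \<Longrightarrow> act A x + act B (act F0 x) \<in> V" 
    "\<And>x. x \<in> V \<Longrightarrow> act C x + act D (act F0 x) = 0"
    by (rule out_nulling_friend[OF A B V D]) (rule that, assumption+)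
  define U0 where "U0 = {u \<in> supp m. act B u \<in> V \<and> act D u = 0}"
  have fU: "fsubspace m U0" unfolding fsubspace_def U0_def by (auto simp: fsubspaceD[OF fV])
  obtain P where P: "P \<in> carrier_mat n n" "\<forall>x :: real fvec. act P x \<in> V" "\<forall>v \<in> V. act P v = v"
    "\<forall>x :: complex fvec. act P x \<in> cx V" "\<forall>v\<in>cx V. act P v = v"
    using projection_matrix[OF fV] by (elim bexE conjE) (rule that)
  obtain J where J: "J \<in> carrier_mat m m" "\<forall>x :: real fvec. act J x \<in> U0" "\<forall>v \<in> U0. act J v = v"
    "\<forall>x :: complex fvec. act J x \<in> cx U0" "\<forall>v\<in>cx U0. act J v = v"
    using projection_matrix[OF fU] by (elim bexE conjE) (rule that)
  \<comment> \<open>The complement of V receives the stable eigenvalue c and needs no control.\<close>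
  define A' where "A' = (A + B * F0) * P + c \<cdot>\<^sub>m (1\<^sub>m n - P)"
  define B' where "B' = B * J"
  have A': "A' \<in> carrier_mat n n" and B': "B' \<in> carrier_mat n m"
    using A B F0 P J by (auto simp: A'_def B'_def)
  have act_A': "act A' x = act A (act P x) + act B (act F0 (act P x)) + cst (of_real c) * (x - act P x)"
    if "x \<in> supp n" for x :: "complex fvec"
    using A B F0(1) P(1) that by (simp add: A'_def act_add act_mult act_smult act_minus)
  have act_A'V: "act A' x = act A x + act B (act F0 x)" if "x \<in> cx V" for x
    using act_A' P(5) that cxD(1)[OF fV] by simp
  have act_B': "act B' x = act B (act J x)" for x :: "complex fvec"
    using B J(1) by (simp add: B'_def act_mult)
  obtain G where G: "G \<in> carrier_mat n m"
    "\<And>k x. k \<notin> Cg \<Longrightarrow> x \<in> supp n \<Longrightarrow> act (transpose_mat A' + G * transpose_mat B') x = cst k * x \<Longrightarrow> x = (0 :: complex fvec)"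
  proof (rule detectable_stabilization[of "transpose_mat A'" n "transpose_mat B'" m c Cg])
    fix k and x :: "complex fvec"
    assume k: "k \<notin> Cg" and x: "x \<in> supp n" 
      and ev: "act (transpose_mat A') x = cst k * x" "act (transpose_mat B') x = 0"
    have kc: "k - of_real c \<noteq> 0" using k c by auto
    show "x = 0"
    proof (rule pairing_nondegenerate[OF x])
      fix y :: "complex fvec" assume y: "y \<in> supp n"
      define q where "q = cst (1 / (k - of_real c)) * (y - act P y)"
      have q: "q \<in> supp n" using y P(1) by (auto simp: q_def)
      have Pq: "act P q = 0" using P(4,5) by (simp add: q_def)
      have kq: "cst k * q - act A' q = y - act P y"
      proof -
        have "cst k * q - act A' q = cst (k - of_real c) * q"
          by (simp add: act_A'[OF q] Pq cst_hom left_diff_distrib)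
        also have "\<dots> = cst ((k - of_real c) * (1 / (k - of_real c))) * (y - act P y)"
          unfolding q_def by (simp only: cst_hom mult.assoc)
        finally show ?thesis using kc by simp
      qed
      have "act P y \<in> cx V" using P(4) by blast
      then obtain z u where z: "z \<in> cx V" "act P y = cst k * z - act A z - act B u" "act C z + act D u = 0"
        using onto[OF k] by blast
      define u' where "u' = trunc m (u - act F0 z)"
      have Bu': "act B u' = act B u - act B (act F0 z)" "act D u' = act D u - act D (act F0 z)"
        using B D F0(1) by (auto simp: u'_def)
      have AF: "act A z + act B (act F0 z) \<in> cx V"
        using z(1) F0(2)[of "fRe z"] F0(2)[of "fIm z"] by (simp add: cx_def)
      have CF: "act C z + act D (act F0 z) = 0"
        by (rule complex_fvec_eqI) (use z(1) F0(3)[of "fRe z"] F0(3)[of "fIm z"] in \<open>simp_all add: cx_def\<close>)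
      have "act B u' = cst k * z - act P y - (act A z + act B (act F0 z))"
        unfolding Bu' z(2) by (simp add: algebra_simps)
      then have "act B u' \<in> cx V"
        using cxD[OF fV] z(1) AF \<open>act P y \<in> cx V\<close> by simp
      moreover have D0: "act D u' = 0"
        using z(3) CF unfolding Bu' by (metis add_diff_cancel_left diff_self)
      moreover have "act D (fRe u') = 0" "act D (fIm u') = 0"
        using arg_cong[OF D0, of fRe] arg_cong[OF D0, of fIm] by simp_all
      moreover have "u' \<in> supp m" by (simp add: u'_def)
      ultimately have "u' \<in> cx U0"
        using fRe_supp[of u' m] fIm_supp[of u' m] by (simp add: cx_def U0_def)
      then have Ju': "act J u' = u'" using J(5) by blast
      have "y = (y - act P y) + act P y" by simp
      also have "\<dots> = (cst k * q - act A' q) + (cst k * z - act A' z - act B' u')"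
        unfolding kq by (simp add: z(2) act_A'V[OF z(1)] act_B' Ju' Bu' algebra_simps)
      also have "\<dots> = cst k * (q + z) - act A' (q + z) - act B' u'" by (simp add: algebra_simps)
      finally have y_eq: "y = cst k * (q + z) - act A' (q + z) - act B' u'" .
      show "pairing n x y = 0"
        unfolding y_eq using pairing_act[OF A', of x "q + z"] pairing_act[OF B', of x u']
        by (simp add: pairing_linear ev distrib_left del: act_linear)
    qed
  qed (use A' B' c in auto)
  define F1 where "F1 = transpose_mat G"
  have F1: "F1 \<in> carrier_mat m n" using G by (auto simp: F1_def)
  have tr: "transpose_mat (transpose_mat A' + G * transpose_mat B') = A' + B' * F1"
    using A' B' G(1) by (simp add: F1_def transpose_add[of _ n n] transpose_mult[of _ n m])
  have stab: "x = 0" if "k \<notin> Cg" "x \<in> supp n" "act (A' + B' * F1) x = cst k * x" for k and x :: "complex fvec"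
    by (rule no_eigenvector_transpose[OF _ G(2)[OF that(1)] that(2)])
      (use that(3) tr A' B' G(1) in auto)
  define F where "F = F0 + J * F1"
  have F: "F \<in> carrier_mat m n" using F0(1) F1 J by (auto simp: F_def)
  have actF: "act F x = act F0 x + act J (act F1 x)" for x :: "'a :: {real_algebra_1, comm_ring_1} fvec"
    using F0(1) F1 J by (simp add: F_def act_add act_mult)
  show thesis
  proof (rule that[OF F])
    fix x assume x: "x \<in> V"
    have J': "act B (act J (act F1 x)) \<in> V" "act D (act J (act F1 x)) = 0"
      using J(2) by (auto simp: U0_def)
    show "act A x + act B (act F x) \<in> V"
      using fsubspaceD(3)[OF fV F0(2)[OF x] J'(1)] by (simp add: actF add.assoc)
    show "act C x + act D (act F x) = 0"
      using F0(3)[OF x] J'(2) by (simp add: actF flip: add.assoc)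
  next
    show "stable_on Cg (A + B * F) V"
      unfolding stable_on_def
    proof (intro allI impI)
      fix k x assume k: "k \<notin> Cg" and x: "x \<in> cx V" and ev: "act (A + B * F) x = cst k * x"
      have "act (A' + B' * F1) x = act (A + B * F) x"
        using A B F F1 A' B' by (simp add: act_feedback[of _ n n _ m] act_A'V[OF x] act_B' actF add.assoc)
      with ev show "x = 0" using stab[OF k cxD(1)[OF fV x]] by simp
    qed
  qed
qed

definition stable_quot :: "complex set \<Rightarrow> real mat \<Rightarrow> real fvec set \<Rightarrow> bool" where
  "stable_quot Cg M S \<longleftrightarrow> 
     (\<forall>k x. k \<notin> Cg \<longrightarrow> x \<in> supp (dim_row M) \<longrightarrow> act M x - cst k * x \<in> cx S \<longrightarrow> x \<in> cx S)"

text \<open>The dual statement.  Let G0 be any friend of S, R = 1 - P with a projection P onto S, and J = 1 - Q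
  with a projection Q onto C S + im D.  The compression of A + G0 C by R, continued by c on S,
  together with the output J C R, has no undetected unstable eigenvector, and G0 + G1 J is a friend
  for every G1.\<close>

lemma in_containing_stabilization:
  assumes A: "A \<in> carrier_mat n n" and B: "B \<in> carrier_mat n m" and C: "C \<in> carrier_mat p n"
    and D: "D \<in> carrier_mat p m" and c: "of_real c \<in> Cg"
    and S: "in_containing A B C D S"
    and inj: "\<And>k x u. k \<notin> Cg \<Longrightarrow> x \<in> supp n \<Longrightarrow> cst k * x - act A x - act B u \<in> cx S \<Longrightarrow>
       act C x + act D u = 0 \<Longrightarrow> x \<in> cx S"
  obtains G where "G \<in> carrier_mat n p" 
    "\<And>x u. x \<in> S \<Longrightarrow> act A x + act B u + act G (act C x + act D u) \<in> S"
    "stable_quot Cg (A + G * C) S"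
proof -
  have fS: "fsubspace n S" using S A by (auto simp: in_containing_def)
  obtain G0 where G0: "G0 \<in> carrier_mat n p" 
    "\<And>x u. x \<in> S \<Longrightarrow> act A x + act B u + act G0 (act C x + act D u) \<in> S"
    by (rule in_containing_friend[OF A B C S D]) (rule that, assumption+)
  have G0x: "act A x + act B u + act G0 (act C x + act D u) \<in> cx S" if "x \<in> cx S" for x u
    using that G0(2)[of "fRe x" "fRe u"] G0(2)[of "fIm x" "fIm u"] by (auto simp: cx_def)
  define Y0 where "Y0 = {act C x + act D u |x u. x \<in> S}"
  have Y0I: "act C x + act D u \<in> Y0" if "x \<in> S" for x u using that by (auto simp: Y0_def)
  have fY: "fsubspace p Y0" unfolding fsubspace_def
  proof (intro conjI ballI allI subsetI)
    show "0 \<in> Y0" using Y0I[OF fsubspaceD(2)[OF fS], of 0] by simp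
  next
    fix y assume "y \<in> Y0"
    then obtain x u where y: "y = act C x + act D u" "x \<in> S" by (auto simp: Y0_def)
    then show "y \<in> supp p" using C D by simp
    show "cst a * y \<in> Y0" for a
      using Y0I[OF fsubspaceD(4)[OF fS y(2)], of a "cst a * u"] by (simp add: y(1) distrib_left)
    fix y' assume "y' \<in> Y0"
    then obtain x' u' where y': "y' = act C x' + act D u'" "x' \<in> S" by (auto simp: Y0_def)
    show "y + y' \<in> Y0"
      using Y0I[OF fsubspaceD(3)[OF fS y(2) y'(2)], of "u + u'"] by (simp add: y(1) y'(1) add_ac)
  qed
  obtain P where P: "P \<in> carrier_mat n n" "\<forall>x :: real fvec. act P x \<in> S" "\<forall>v \<in> S. act P v = v"
    "\<forall>x :: complex fvec. act P x \<in> cx S" "\<forall>v\<in>cx S. act P v = v"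
    using projection_matrix[OF fS] by (elim bexE conjE) (rule that)
  obtain Q where Q: "Q \<in> carrier_mat p p" "\<forall>x :: real fvec. act Q x \<in> Y0" "\<forall>v \<in> Y0. act Q v = v"
    "\<forall>x :: complex fvec. act Q x \<in> cx Y0" "\<forall>v\<in>cx Y0. act Q v = v"
    using projection_matrix[OF fY] by (elim bexE conjE) (rule that)
  define R where "R = 1\<^sub>m n - P"
  define J where "J = 1\<^sub>m p - Q"
  have R: "R \<in> carrier_mat n n" and J: "J \<in> carrier_mat p p" using P Q by (auto simp: R_def J_def)
  have act_R: "act R x = x - act P x" if "x \<in> supp n" for x :: "complex fvec"
    using P(1) that by (simp add: R_def act_minus)
  have act_J: "act J x = x - act Q x" if "x \<in> supp p" for x :: "complex fvec"
    using Q(1) that by (simp add: J_def act_minus)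
  have RS: "act R x = 0" if "x \<in> cx S" for x using act_R[OF cxD(1)[OF fS that]] P(5) that by simp
  have RR: "act R (act R x) = act R x" if "x \<in> supp n" for x :: "complex fvec"
    using RS[of "act P x"] P(1,4) by (simp add: act_R[OF that])
  have PR: "act P (act R x) = 0" if "x \<in> supp n" for x :: "complex fvec"
    using P(4,5) by (simp add: act_R[OF that])
  have R0: "x \<in> cx S" if "x \<in> supp n" "act R x = 0" for x
    using P(4) act_R[OF that(1)] that(2) by (metis eq_iff_diff_eq_0)
  have xR: "x - act R x \<in> cx S" if "x \<in> supp n" for x using P(4) act_R[OF that] by simp
  have JY: "act J (act C x + act D u) = 0" if "x \<in> cx S" for x and u :: "complex fvec"
  proof -
    have "act C x + act D u \<in> cx Y0"
      using that Y0I[of "fRe x" "fRe u"] Y0I[of "fIm x" "fIm u"] by (auto simp: cx_def)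
    then have "act Q (act C x + act D u) = act C x + act D u" using Q(5) by (rule bspec[rotated])
    moreover have "act C x + act D u \<in> supp p" using C D by simp
    ultimately show ?thesis using act_J by (simp only: diff_self)
  qed
  define A' where "A' = R * (A + G0 * C) * R + c \<cdot>\<^sub>m P"
  define C' where "C' = J * C * R"
  have A': "A' \<in> carrier_mat n n" and C': "C' \<in> carrier_mat p n"
    using A C G0 P J R by (auto simp: A'_def C'_def)
  have act_A': "act A' x = act R (act A (act R x) + act G0 (act C (act R x))) + cst (of_real c) * act P x"
    for x :: "complex fvec"
    using A C G0(1) P(1) R by (simp add: A'_def act_add act_mult act_smult)
  have act_C': "act C' x = act J (act C (act R x))" for x :: "complex fvec"
    using C J R by (simp add: C'_def act_mult)
  have inj': "x = 0" if k: "k \<notin> Cg" and x: "x \<in> supp n" and ev: "act A' x = cst k * x" and Cx: "act C' x = 0"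
    for k and x :: "complex fvec"
  proof -
    have kc: "of_real c - k \<noteq> 0" using k c by auto
    have "act P (act A' x) = cst (of_real c) * act P x"
    proof -
      let ?w = "act A (act R x) + act G0 (act C (act R x))"
      have "?w \<in> supp n" using A G0(1) by auto
      then have "act P (act R ?w) = 0" by (rule PR)
      then show ?thesis using P(4,5) by (simp add: act_A')
    qed
    then have "cst (of_real c - k) * act P x = 0" by (simp add: ev cst_hom left_diff_distrib)
    with kc have Px: "act P x = 0" by simp
    then have Rx: "act R x = x" using act_R[OF x] by simp
    have sC: "act C x \<in> supp p" using C by simp
    have "act J (act C x) = 0" using Cx by (simp add: act_C' Rx)
    then have "act C x = act Q (act C x)" using act_J[OF sC] by simp
    then have "act C x \<in> cx Y0" using Q(4) by metis
    then obtain s u s' u' where su: "fRe (act C x) = act C s + act D u" "s \<in> S"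
      "fIm (act C x) = act C s' + act D u'" "s' \<in> S" unfolding cx_def Y0_def by blast
    define t where "t = cfn s + cst \<i> * cfn s'"
    define w where "w = cfn u + cst \<i> * cfn u'"
    have tS: "t \<in> cx S" using su by (auto simp: t_def cx_def)
    have Cx_eq: "act C x = act C t + act D w"
      by (rule complex_fvec_eqI) (use su in \<open>auto simp: t_def w_def\<close>)
    have "act R (act A x + act G0 (act C x)) = cst k * x" using ev by (simp add: act_A' Rx Px)
    moreover have "act A x + act G0 (act C x) \<in> supp n" using A G0(1) by auto
    ultimately have 1: "(act A x + act G0 (act C x)) - cst k * x \<in> cx S" using xR by metis
    have 2: "act A t + act B w + act G0 (act C x) \<in> cx S" using G0x[OF tS, of w] by (simp add: Cx_eq)
    have "(act A t + act B w + act G0 (act C x)) - ((act A x + act G0 (act C x)) - cst k * x) - cst k * t \<in> cx S"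
      by (rule cxD(5)[OF fS cxD(5)[OF fS 2 1] cxD(4)[OF fS tS]])
    moreover have "(act A t + act B w + act G0 (act C x)) - ((act A x + act G0 (act C x)) - cst k * x) - cst k * t
      = cst k * (x - t) - act A (x - t) - act B (- w)"
      by (simp add: algebra_simps)
    ultimately have "cst k * (x - t) - act A (x - t) - act B (- w) \<in> cx S" by (simp only:)
    moreover have "act C (x - t) + act D (- w) = 0" by (simp add: Cx_eq)
    moreover have "x - t \<in> supp n" using x cxD(1)[OF fS tS] by simp
    ultimately have "x - t \<in> cx S" using inj[OF k] by blast
    from cxD(3)[OF fS this tS] have "x \<in> cx S" by simp
    then show "x = 0" using RS Rx by simp
  qed
  obtain G1 where G1: "G1 \<in> carrier_mat n p"
    "\<And>k x. k \<notin> Cg \<Longrightarrow> x \<in> supp n \<Longrightarrow> act (A' + G1 * C') x = cst k * x \<Longrightarrow> x = (0 :: complex fvec)"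
    by (rule detectable_stabilization[OF A' C' c]) (rule inj', assumption+, rule that, assumption+)
  define G where "G = G0 + G1 * J"
  have G: "G \<in> carrier_mat n p" using G0(1) G1(1) J by (auto simp: G_def)
  have actG: "act G y = act G0 y + act G1 (act J y)" for y :: "'a :: {real_algebra_1, comm_ring_1} fvec"
    using G0(1) G1(1) J by (simp add: G_def act_add act_mult)
  show thesis
  proof (rule that[OF G])
    fix x u assume x: "x \<in> S"
    have "act J (act C x + act D u) = 0"
    proof -
      have 1: "act Q (act C x + act D u) = act C x + act D u" using Q(3) Y0I[OF x] by (rule bspec)
      have 2: "act C x + act D u \<in> supp p" using C D by simp
      show ?thesis
        using Q(1) by (simp only: J_def act_minus index_one_mat carrier_matD act_one trunc_id[OF 2] 1 diff_self)
    qed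
    then show "act A x + act B u + act G (act C x + act D u) \<in> S"
      using G0(2)[OF x, of u] by (simp only: actG act_linear(4) add_0_right)
  next
    show "stable_quot Cg (A + G * C) S"
      unfolding stable_quot_def
    proof (intro allI impI)
      fix k x assume k: "k \<notin> Cg" and x': "x \<in> supp (dim_row (A + G * C))" 
        and ev: "act (A + G * C) x - cst k * x \<in> cx S"
      have x: "x \<in> supp n" using x' G A C by simp
      have kc: "k - of_real c \<noteq> 0" using k c by auto
      define z where "z = act R x"
      have z: "z \<in> supp n" using R by (simp add: z_def)
      have xz: "x - z \<in> cx S" using xR[OF x] by (simp add: z_def)
      have Rz: "act R z = z" using RR[OF x] by (simp add: z_def)
      have Pz: "act P z = 0" using act_R[OF z] Rz by simp
      have JC: "act J (act C x) = act J (act C z)"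
        using JY[OF xz, of 0] by simp
      have 1: "act A (x - z) + act G0 (act C (x - z)) \<in> cx S" using G0x[OF xz, of 0] by simp
      have 2: "act A x + act G0 (act C x) + act G1 (act J (act C z)) - cst k * x \<in> cx S"
        using ev A G C by (simp add: act_feedback[of _ n n _ p] actG JC add.assoc)
      have "(act A x + act G0 (act C x) + act G1 (act J (act C z)) - cst k * x)
          - (act A (x - z) + act G0 (act C (x - z))) + cst k * (x - z) \<in> cx S"
        by (rule cxD(3)[OF fS cxD(5)[OF fS 2 1] cxD(4)[OF fS xz]])
      moreover have "(act A x + act G0 (act C x) + act G1 (act J (act C z)) - cst k * x)
          - (act A (x - z) + act G0 (act C (x - z))) + cst k * (x - z)
          = act A z + act G0 (act C z) + act G1 (act J (act C z)) - cst k * z"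
        by (simp add: algebra_simps)
      ultimately have w: "act A z + act G0 (act C z) + act G1 (act J (act C z)) - cst k * z \<in> cx S" by (simp only:)
      have "act A z + act G0 (act C z) \<in> supp n" using A G0 by simp
      from xR[OF this] have 3: "act A z + act G0 (act C z) - act A' z \<in> cx S"
        by (simp add: act_A' Rz Pz)
      have "(act A z + act G0 (act C z) + act G1 (act J (act C z)) - cst k * z) - (act A z + act G0 (act C z) - act A' z) \<in> cx S"
        by (rule cxD(5)[OF fS w 3])
      then have d: "act A' z + act G1 (act C' z) - cst k * z \<in> cx S" (is "?d \<in> _")
        by (simp add: act_C' Rz algebra_simps)
      define q where "q = cst (1 / (k - of_real c)) * ?d"
      have q: "q \<in> cx S" unfolding q_def by (rule cxD(4)[OF fS d])
      have kq: "cst (k - of_real c) * q = ?d"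
        using kc by (simp add: q_def flip: mult.assoc cst_hom)
      have "act A' q = cst (of_real c) * q" "act C' q = 0"
        using q P(5) by (simp_all add: act_A' act_C' RS)
      then have "act (A' + G1 * C') (z + q) = cst k * (z + q)"
        using A' G1(1) C' kq by (simp add: act_feedback[of _ n n _ p] cst_hom algebra_simps)
      moreover have "z + q \<in> supp n" using z cxD(1)[OF fS q] by simp
      ultimately have "z + q = 0" using G1(2)[OF k] by blast
      then have "z = - q" by (simp add: eq_neg_iff_add_eq_0)
      then have "z \<in> cx S" using cxD(6)[OF fS q] by simp
      from cxD(3)[OF fS xz this] show "x \<in> cx S" by simp
    qed
  qed
qed

text \<open>If \<lambda>x - Ax - Bu lies in V* and the output is zero, then adding the real and imaginary part of x to
  V* leaves it output nulling, because A x + B u lies in V* + span x.  By maximality x is in V*.\<close>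

lemma Vst_resolvent:
  assumes A: "A \<in> carrier_mat n n" and x: "x \<in> supp n"
    and v: "cst k * x - act A x - act B u \<in> cx (Vst A B C D)" and z: "act C x + act D u = 0"
  shows "x \<in> cx (Vst A B C D)"
proof -
  let ?V = "Vst A B C D" and ?W = "ext_plane (Vst A B C D) (fRe x) (fIm x)"
  define v where "v = cst k * x - act A x - act B u"
  have V: "out_nulling A B C D ?V" by (rule out_nulling_Vst)
  have fV: "fsubspace n ?V" using V A by (auto simp: out_nulling_def)
  have vV: "fRe v \<in> ?V" "fIm v \<in> ?V" using v by (auto simp: v_def cx_def)
  have zR: "act C (fRe x) + act D (fRe u) = 0" "act C (fIm x) + act D (fIm u) = 0"
    using arg_cong[OF z, of fRe] arg_cong[OF z, of fIm] by auto
  have AR: "act A (fRe x) + act B (fRe u) = - fRe v + cst (Re k) * fRe x + cst (- Im k) * fIm x"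
    "act A (fIm x) + act B (fIm u) = - fIm v + cst (Im k) * fRe x + cst (Re k) * fIm x"
    by (simp_all add: v_def cst_hom algebra_simps)
  have "out_nulling A B C D ?W"
    unfolding out_nulling_def
  proof (intro conjI ballI)
    show "fsubspace (dim_row A) ?W" using ext_plane_fsubspace[OF fV, of "fRe x" "fIm x"] x A by simp
    fix w assume "w \<in> ?W"
    then obtain m s t where w: "w = m + cst s * fRe x + cst t * fIm x" "m \<in> ?V" by (auto simp: ext_plane_def)
    obtain u0 where u0: "act A m + act B u0 \<in> ?V" "act C m + act D u0 = 0" using V w by (auto simp: out_nulling_def)
    let ?u = "u0 + cst s * fRe u + cst t * fIm u"
    have "act A w + act B ?u = (act A m + act B u0) + cst s * (act A (fRe x) + act B (fRe u))
        + cst t * (act A (fIm x) + act B (fIm u))"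
      by (simp add: w(1) algebra_simps)
    also have "\<dots> = (act A m + act B u0 - cst s * fRe v - cst t * fIm v) 
        + cst (s * Re k + t * Im k) * fRe x + cst (t * Re k - s * Im k) * fIm x"
      unfolding AR by (simp add: cst_hom algebra_simps)
    finally have "act A w + act B ?u \<in> ?W"
      using ext_planeI[of "act A m + act B u0 - cst s * fRe v - cst t * fIm v" ?V] u0(1) vV fsubspaceD[OF fV] by metis
    moreover have "act C w + act D ?u = (act C m + act D u0) + cst s * (act C (fRe x) + act D (fRe u))
        + cst t * (act C (fIm x) + act D (fIm u))"
      by (simp add: w(1) algebra_simps)
    then have "act C w + act D ?u = 0" by (simp add: u0 zR)
    ultimately show "\<exists>u. act A w + act B u \<in> ?W \<and> act C w + act D u = 0" by blast
  qed
  then have "?W \<subseteq> ?V" by (rule Vst_greatest)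
  moreover have "fRe x \<in> ?W" "fIm x \<in> ?W"
    using ext_planeI[OF fsubspaceD(2)[OF fV], of 1 "fRe x" 0 "fIm x"] 
      ext_planeI[OF fsubspaceD(2)[OF fV], of 0 "fRe x" 1 "fIm x"] by auto
  ultimately show ?thesis by (auto simp: cx_def)
qed

text \<open>The vectors s of S* that are \<lambda>x - Ax - Bu with x in S* and zero output form an input containing
  subspace: if s is one of them and C s + D u = 0, then A s + B u = \<lambda>s - (\<lambda>s - As - Bu) is a
  combination of two vectors of this form.  By minimality they are all of S*.\<close>

lemma Sst_resolvent:
  assumes A: "A \<in> carrier_mat n n" and B: "B \<in> carrier_mat n m" and s: "s \<in> cx (Sst A B C D)"
  shows "\<exists>x\<in>cx (Sst A B C D). \<exists>u. s = cst k * x - act A x - act B u \<and> act C x + act D u = 0"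
proof -
  let ?S = "Sst A B C D"
  define T where "T = {cst k * x - act A x - act B u |x u. x \<in> cx ?S \<and> act C x + act D u = 0}"
  have S: "in_containing A B C D ?S" by (rule in_containing_Sst[OF A B])
  have fS: "fsubspace n ?S" using S A by (auto simp: in_containing_def)
  have TI: "cst k * x - act A x - act B u \<in> T" if "x \<in> cx ?S" "act C x + act D u = 0" for x u
    using that by (auto simp: T_def)
  have T0: "0 \<in> T" using TI[OF cxD(2)[OF fS], of 0] by simp
  have Tadd: "a + b \<in> T" if "a \<in> T" "b \<in> T" for a b
  proof -
    obtain x u where a: "a = cst k * x - act A x - act B u" "x \<in> cx ?S" "act C x + act D u = 0"
      using \<open>a \<in> T\<close> by (auto simp: T_def)
    obtain y w where b: "b = cst k * y - act A y - act B w" "y \<in> cx ?S" "act C y + act D w = 0"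
      using \<open>b \<in> T\<close> by (auto simp: T_def)
    have "act C (x + y) + act D (u + w) = (act C x + act D u) + (act C y + act D w)" by (simp add: add_ac)
    then have "act C (x + y) + act D (u + w) = 0" by (simp add: a b)
    from TI[OF cxD(3)[OF fS a(2) b(2)] this] show ?thesis
      by (simp add: a(1) b(1) algebra_simps)
  qed
  have Tscale: "cst c * a \<in> T" if "a \<in> T" for c a
  proof -
    obtain x u where a: "a = cst k * x - act A x - act B u" "x \<in> cx ?S" "act C x + act D u = 0"
      using \<open>a \<in> T\<close> by (auto simp: T_def)
    have "act C (cst c * x) + act D (cst c * u) = cst c * (act C x + act D u)" by (simp add: distrib_left)
    then have "act C (cst c * x) + act D (cst c * u) = 0" by (simp add: a)
    from TI[OF cxD(4)[OF fS a(2)] this] show ?thesis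
      by (simp add: a(1) algebra_simps)
  qed
  define T' where "T' = {v \<in> ?S. cfn v \<in> T}"
  have "in_containing A B C D T'"
    unfolding in_containing_def
  proof (intro conjI ballI allI impI)
    have "fsubspace n T'" unfolding fsubspace_def T'_def using fsubspaceD[OF fS] T0 Tadd Tscale by auto
    then show "fsubspace (dim_row A) T'" using A by simp
    fix v u assume v: "v \<in> T'" and z: "act C v + act D u = 0"
    have z': "act C (cfn v) + act D (cfn u) = 0" using arg_cong[OF z, of cfn] by simp
    have "cfn v \<in> cx ?S" using v cxD(8)[OF fS] by (auto simp: T'_def)
    from TI[OF this z'] have "cst (-1) * (cst k * cfn v - act A (cfn v) - act B (cfn u)) \<in> T" by (rule Tscale)
    moreover have "cst k * cfn v \<in> T" using v Tscale by (auto simp: T'_def)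
    ultimately have "cst k * cfn v + cst (-1) * (cst k * cfn v - act A (cfn v) - act B (cfn u)) \<in> T"
      by (intro Tadd)
    moreover have "cst k * cfn v + cst (-1) * (cst k * cfn v - act A (cfn v) - act B (cfn u)) = cfn (act A v + act B u)"
      by (simp add: cst_hom)
    ultimately have "cfn (act A v + act B u) \<in> T" by simp
    moreover have "act A v + act B u \<in> ?S" using S v z by (auto simp: in_containing_def T'_def)
    ultimately show "act A v + act B u \<in> T'" by (simp add: T'_def)
  qed
  then have "?S \<subseteq> T'" by (rule Sst_least)
  then have "cfn (fRe s) \<in> T" "cfn (fIm s) \<in> T" using s by (auto simp: cx_def T'_def)
  then have "cfn (fRe s) + cst \<i> * cfn (fIm s) \<in> T" using Tadd Tscale by blast
  then have "s \<in> T" using complex_fvec_eq[of s] by metis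
  then show ?thesis by (auto simp: T_def)
qed

section \<open>Vanishing transfer functions\<close>

lemma fn_cmat:
  assumes "v \<in> carrier_vec (dim_col M)"
  shows "fn (cmat M *\<^sub>v v) = act M (fn v)"
  using assms by (auto simp: fn_def act_def fun_eq_iff scalar_prod_def atLeast0LessThan intro!: sum.cong)

lemma fn_mat:
  assumes "v \<in> carrier_vec (dim_col M)"
  shows "fn (M *\<^sub>v v) = act M (fn v)"
  using assms by (auto simp: fn_def act_def fun_eq_iff scalar_prod_def atLeast0LessThan intro!: sum.cong)

lemma fn_algebra:
  "v \<in> carrier_vec n \<Longrightarrow> w \<in> carrier_vec n \<Longrightarrow> fn (v + w) = fn v + fn w"
  "v \<in> carrier_vec n \<Longrightarrow> w \<in> carrier_vec n \<Longrightarrow> fn (v - w) = fn v - fn w"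
  "fn (k \<cdot>\<^sub>v v) = cst k * fn v" "fn (0\<^sub>v n) = 0"
  for v w :: "'a :: comm_ring_1 vec"
  by (auto simp: fn_def fun_eq_iff)

lemma fn_eq_0_iff: "v \<in> carrier_vec n \<Longrightarrow> fn v = 0 \<longleftrightarrow> v = 0\<^sub>v n" for v :: "'a :: comm_ring_1 vec"
  using fn_inj[of v n "0\<^sub>v n"] by (simp add: fn_algebra)

definition no_eigenvector :: "real mat \<Rightarrow> complex \<Rightarrow> bool" where
  "no_eigenvector M k \<longleftrightarrow> (\<forall>x\<in>supp (dim_row M). act M x = cst k * x \<longrightarrow> x = 0)"

lemma spectrum_iff:
  assumes M: "M \<in> carrier_mat n n"
  shows "k \<notin> spectrum (cmat M) \<longleftrightarrow> no_eigenvector M k"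
proof
  assume k: "k \<notin> spectrum (cmat M)"
  show "no_eigenvector M k" unfolding no_eigenvector_def
  proof (intro ballI impI)
    fix x assume x: "x \<in> supp (dim_row M)" "act M x = cst k * x"
    have v: "vec n x \<in> carrier_vec n" by simp
    have "fn (cmat M *\<^sub>v vec n x) = fn (k \<cdot>\<^sub>v vec n x)"
      using x M by (simp add: fn_cmat fn_algebra)
    moreover have "cmat M *\<^sub>v vec n x \<in> carrier_vec n" "k \<cdot>\<^sub>v vec n x \<in> carrier_vec n" using M by auto
    ultimately have "cmat M *\<^sub>v vec n x = k \<cdot>\<^sub>v vec n x" using fn_inj by blast
    moreover have "dim_row (cmat M) = n" using M by simp
    ultimately have "vec n x = 0\<^sub>v n"
      using k v unfolding spectrum_def eigenvalue_def eigenvector_def mem_Collect_eq by metis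
    then have "fn (vec n x) = 0" by (simp add: fn_algebra)
    then show "x = 0" using x M by simp
  qed
next
  assume k: "no_eigenvector M k"
  show "k \<notin> spectrum (cmat M)"
  proof
    assume "k \<in> spectrum (cmat M)"
    then obtain v where v: "v \<in> carrier_vec n" "v \<noteq> 0\<^sub>v n" "cmat M *\<^sub>v v = k \<cdot>\<^sub>v v"
      using M unfolding spectrum_def eigenvalue_def eigenvector_def by auto
    have "act M (fn v) = cst k * fn v" using arg_cong[OF v(3), of fn] v(1) M by (simp add: fn_cmat fn_algebra)
    then have "fn v = 0" using k v(1) M by (simp add: no_eigenvector_def)
    then show False using v fn_eq_0_iff by blast
  qed
qed

lemma mat_zeroI:
  fixes M :: "'a :: comm_ring_1 mat"
  assumes "M \<in> carrier_mat r q" "\<And>w. w \<in> carrier_vec q \<Longrightarrow> M *\<^sub>v w = 0\<^sub>v r"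
  shows "M = 0\<^sub>m r q"
proof (rule eq_matI)
  fix i j assume ij: "i < dim_row (0\<^sub>m r q)" "j < dim_col (0\<^sub>m r q)"
  have "(M *\<^sub>v unit_vec q j) $ i = M $$ (i, j)"
    using assms(1) ij by (simp add: scalar_prod_right_unit)
  with assms(2)[of "unit_vec q j"] ij show "M $$ (i, j) = 0\<^sub>m r q $$ (i, j)" by simp
qed (use assms in auto)

text \<open>The transfer function vanishes iff every forced response C x + G w is zero, where x solves
  kx - Ax = Hw.\<close>

lemma transfer_function_zero_iff:
  assumes A: "A \<in> carrier_mat N N" and H: "H \<in> carrier_mat N q" and C: "C \<in> carrier_mat r N" and G: "G \<in> carrier_mat r q"
  shows "transfer_function_zero A H C G \<longleftrightarrow>
    (\<forall>k x w. no_eigenvector A k \<longrightarrow> x \<in> supp N \<longrightarrow> cst k * x - act A x = act H w \<longrightarrow> act C x + act G w = 0)"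
proof -
  have "transfer_function A H C G k = 0\<^sub>m r q \<longleftrightarrow>
    (\<forall>x w. x \<in> supp N \<longrightarrow> cst k * x - act A x = act H w \<longrightarrow> act C x + act G w = 0)"
    if k: "no_eigenvector A k" for k
  proof -
    define X where "X = k \<cdot>\<^sub>m 1\<^sub>m N - cmat A"
    have X: "X \<in> carrier_mat N N" using A by (auto simp: X_def)
    have XV: "X *\<^sub>v v = k \<cdot>\<^sub>v v - cmat A *\<^sub>v v" if "v \<in> carrier_vec N" for v
    proof -
      have "(k \<cdot>\<^sub>m 1\<^sub>m N) *\<^sub>v v = k \<cdot>\<^sub>v v"
        using that by (intro eq_vecI) (auto simp: scalar_prod_left_unit row_smult)
      then show ?thesis
        using that A by (simp add: X_def minus_mult_distrib_mat_vec[of _ N N])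
    qed
    have fnX: "fn (X *\<^sub>v v) = cst k * fn v - act A (fn v)" if "v \<in> carrier_vec N" for v
    proof -
      have "cmat A *\<^sub>v v \<in> carrier_vec N" "k \<cdot>\<^sub>v v \<in> carrier_vec N" using A that by auto
      then show ?thesis using that A by (simp add: XV fn_algebra(2)[of _ N] fn_algebra(3) fn_cmat)
    qed
    have "det X \<noteq> 0"
    proof
      assume "det X = 0"
      then obtain v where v: "v \<in> carrier_vec N" "v \<noteq> 0\<^sub>v N" "X *\<^sub>v v = 0\<^sub>v N"
        using det_0_iff_vec_prod_zero_field[OF X] by auto
      have "cst k * fn v - act A (fn v) = 0" using fnX[OF v(1)] v(3) by (simp add: fn_algebra)
      then have "fn v = 0" using k v(1) A by (auto simp: no_eigenvector_def)
      then show False using v fn_eq_0_iff by blast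
    qed
    then have "X \<in> Units (ring_mat TYPE(complex) N ())" by (rule det_non_zero_imp_unit[OF X])
    then obtain R where "mat_inverse X = Some R"
      using mat_inverse(1)[OF X, where b = "()"] by (cases "mat_inverse X") auto
    then have R: "the (mat_inverse X) = R" "X * R = 1\<^sub>m N" "R * X = 1\<^sub>m N" "R \<in> carrier_mat N N"
      using mat_inverse(2)[OF X] by auto
    define T where "T = transfer_function A H C G k"
    have T: "T = cmat C * R * cmat H + cmat G"
      using A by (simp add: T_def transfer_function_def R(1) flip: X_def)
    have Tc: "T \<in> carrier_mat r q" using C H G by (simp add: T)
    have fnT: "fn (T *\<^sub>v w) = act C (fn (R *\<^sub>v (cmat H *\<^sub>v w))) + act G (fn w)" if w: "w \<in> carrier_vec q" for w
    proof -
      have "T *\<^sub>v w = cmat C *\<^sub>v (R *\<^sub>v (cmat H *\<^sub>v w)) + cmat G *\<^sub>v w"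
        unfolding T using C H G R(4) w
        by (simp add: add_mult_distrib_mat_vec[of _ r q] assoc_mult_mat_vec[of _ r N _ q] assoc_mult_mat_vec[of _ r N _ N])
      moreover have "R *\<^sub>v (cmat H *\<^sub>v w) \<in> carrier_vec N" using R(4) H w by auto
      moreover have "cmat C *\<^sub>v (R *\<^sub>v (cmat H *\<^sub>v w)) \<in> carrier_vec r" "cmat G *\<^sub>v w \<in> carrier_vec r"
        using C G R(4) H w by auto
      ultimately show ?thesis using C G w by (simp add: fn_algebra(1)[of _ r] fn_cmat)
    qed
    show ?thesis
    proof
      assume "transfer_function A H C G k = 0\<^sub>m r q"
      then have T0: "T = 0\<^sub>m r q" by (simp add: T_def)
      show "\<forall>x w. x \<in> supp N \<longrightarrow> cst k * x - act A x = act H w \<longrightarrow> act C x + act G w = 0"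
      proof (intro allI impI)
        fix x w assume x: "x \<in> supp N" and eq: "cst k * x - act A x = act H w"
        let ?v = "vec N x" and ?w = "vec q w"
        have fw: "fn ?w = trunc q w" by (auto simp: fn_def trunc_def)
        have "fn (X *\<^sub>v ?v) = fn (cmat H *\<^sub>v ?w)"
          using H x eq by (simp add: fnX fn_cmat fw)
        moreover have "X *\<^sub>v ?v \<in> carrier_vec N" "cmat H *\<^sub>v ?w \<in> carrier_vec N" using X H by auto
        ultimately have "X *\<^sub>v ?v = cmat H *\<^sub>v ?w" using fn_inj by blast
        then have "R *\<^sub>v (cmat H *\<^sub>v ?w) = R *\<^sub>v (X *\<^sub>v ?v)" by simp
        also have "\<dots> = ?v" using R X by (simp flip: assoc_mult_mat_vec[of R N N X N ?v])
        finally have "fn (T *\<^sub>v ?w) = act C x + act G w"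
          using fnT[of ?w] x G by (simp add: fw)
        moreover have "T *\<^sub>v ?w = 0\<^sub>v r" unfolding T0 by auto
        ultimately show "act C x + act G w = 0" by (simp add: fn_algebra)
      qed
    next
      assume h: "\<forall>x w. x \<in> supp N \<longrightarrow> cst k * x - act A x = act H w \<longrightarrow> act C x + act G w = 0"
      have "T = 0\<^sub>m r q"
      proof (rule mat_zeroI[OF Tc])
        fix w :: "complex vec" assume w: "w \<in> carrier_vec q"
        let ?v = "R *\<^sub>v (cmat H *\<^sub>v w)"
        have v: "?v \<in> carrier_vec N" using R(4) H w by auto
        have "X *\<^sub>v ?v = cmat H *\<^sub>v w" using R X H w by (simp flip: assoc_mult_mat_vec[of X N N R N "cmat H *\<^sub>v w"])
        then have "cst k * fn ?v - act A (fn ?v) = act H (fn w)"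
          using fnX[OF v] H w by (simp add: fn_cmat)
        moreover have "fn ?v \<in> supp N" using R(4) by simp
        ultimately have "fn (T *\<^sub>v w) = 0" using h fnT[OF w] by metis
        moreover have "T *\<^sub>v w \<in> carrier_vec r" using Tc w by auto
        ultimately show "T *\<^sub>v w = 0\<^sub>v r" using fn_eq_0_iff by blast
      qed
      then show "transfer_function A H C G k = 0\<^sub>m r q" by (simp add: T_def)
    qed
  qed
  then show ?thesis
    using A C H unfolding transfer_function_zero_def by (simp add: spectrum_iff[OF A])
qed

definition entry_sum :: "real mat \<Rightarrow> real" where
  "entry_sum M = (\<Sum>i<dim_row M. \<Sum>j<dim_col M. \<bar>M $$ (i, j)\<bar>)"

definition norm1 :: "nat \<Rightarrow> complex fvec \<Rightarrow> real" where
  "norm1 n x = (\<Sum>i<n. cmod (x i))"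

lemma norm1_nonneg: "0 \<le> norm1 n x" by (simp add: norm1_def sum_nonneg)

lemma norm1_act:
  assumes "M \<in> carrier_mat m n"
  shows "norm1 m (act M x) \<le> entry_sum M * norm1 n x"
proof -
  have "norm1 m (act M x) \<le> (\<Sum>i<m. \<Sum>j<n. \<bar>M $$ (i, j)\<bar> * norm1 n x)"
    unfolding norm1_def[of m]
  proof (intro sum_mono)
    fix i assume "i \<in> {..<m}"
    then have "cmod (act M x i) \<le> (\<Sum>j<n. cmod (of_real (M $$ (i, j)) * x j))"
      using assms by (auto simp: act_def intro: norm_sum)
    also have "\<dots> \<le> (\<Sum>j<n. \<bar>M $$ (i, j)\<bar> * norm1 n x)"
    proof (intro sum_mono)
      fix j assume "j \<in> {..<n}"
      then have "cmod (x j) \<le> norm1 n x" unfolding norm1_def by (intro member_le_sum) auto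
      then show "cmod (of_real (M $$ (i, j)) * x j) \<le> \<bar>M $$ (i, j)\<bar> * norm1 n x"
        by (simp add: norm_mult mult_left_mono)
    qed
    finally show "cmod (act M x i) \<le> (\<Sum>j<n. \<bar>M $$ (i, j)\<bar> * norm1 n x)" .
  qed
  also have "\<dots> = entry_sum M * norm1 n x"
    using assms by (simp add: entry_sum_def sum_distrib_right)
  finally show ?thesis .
qed

lemma norm1_eq_0:
  assumes x: "x \<in> supp n" "norm1 n x \<le> 0"
  shows "x = 0"
proof (rule ext)
  fix i
  have "norm1 n x = 0" using x(2) norm1_nonneg[of n x] by simp
  then have "\<forall>i<n. cmod (x i) = 0" unfolding norm1_def by (subst (asm) sum_nonneg_eq_0_iff) auto
  with x(1) show "x i = 0 i" by (cases "i < n") (auto simp: supp_def)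
qed

text \<open>For large t the solutions of ty - Ay = b are small; this replaces the limit of the resolvent at
  infinity.\<close>

lemma resolvent_bound:
  assumes A: "A \<in> carrier_mat n n" and y: "cst (of_real t) * y - act A y = b" and t: "t > 0"
  shows "(t - entry_sum A) * norm1 n y \<le> norm1 n b"
proof -
  have "t * norm1 n y = norm1 n (cst (of_real t) * y)"
    using t by (simp add: norm1_def norm_mult sum_distrib_left)
  also have "cst (of_real t) * y = b + act A y" using y by auto
  also have "norm1 n (b + act A y) \<le> norm1 n b + norm1 n (act A y)"
    unfolding norm1_def sum.distrib[symmetric] by (intro sum_mono) (simp add: norm_triangle_ineq)
  finally show ?thesis using norm1_act[OF A, of y] by (simp add: left_diff_distrib)
qed

lemma entry_sum_nonneg: "0 \<le> entry_sum M" by (simp add: entry_sum_def sum_nonneg)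

lemma no_eigenvector_large:
  assumes A: "A \<in> carrier_mat n n" and t: "t > entry_sum A"
  shows "no_eigenvector A (of_real t)"
  unfolding no_eigenvector_def
proof (intro ballI impI)
  fix x :: "complex fvec" assume x: "x \<in> supp (dim_row A)" "act A x = cst (of_real t) * x"
  have "t > 0" using t entry_sum_nonneg[of A] by simp
  with resolvent_bound[OF A, of t x 0] x(2) have "(t - entry_sum A) * norm1 n x \<le> 0"
    by (simp add: norm1_def)
  with t have "norm1 n x \<le> 0" by (simp add: mult_le_0_iff)
  with x(1) A show "x = 0" by (intro norm1_eq_0) auto
qed

lemma resolvent_limit:
  fixes g :: "complex fvec"
  assumes A: "A \<in> carrier_mat n n" and C: "C \<in> carrier_mat r n" and g: "g \<in> supp r"
    and ex: "\<And>t. t > entry_sum A \<Longrightarrow> \<exists>y. cst (of_real t) * y - act A y = b \<and> act C y = g"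
  shows "g = 0"
proof (rule norm1_eq_0[OF g], rule ccontr)
  assume "\<not> norm1 r g \<le> 0"
  then have pos: "norm1 r g > 0" by simp
  define c where "c = entry_sum C * norm1 n b"
  have c: "c \<ge> 0" unfolding c_def by (intro mult_nonneg_nonneg entry_sum_nonneg norm1_nonneg)
  \<comment> \<open>The response to b at t would be the constant g, but it is bounded by c / (t - entry_sum A), which
    is smaller than the norm of g for this t.\<close>
  define t where "t = entry_sum A + (c + 1) / norm1 r g"
  have t: "t > entry_sum A" using pos c by (simp add: t_def)
  have t0: "t > 0" using t entry_sum_nonneg[of A] by simp
  obtain y where y: "cst (of_real t) * y - act A y = b" "act C y = g" using ex[OF t] by blast
  have "norm1 r g \<le> entry_sum C * norm1 n y" using norm1_act[OF C, of y] y(2) by simp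
  then have "(t - entry_sum A) * norm1 r g \<le> (t - entry_sum A) * (entry_sum C * norm1 n y)"
    using t by (intro mult_left_mono) auto
  also have "\<dots> = entry_sum C * ((t - entry_sum A) * norm1 n y)" by simp
  also have "\<dots> \<le> c" unfolding c_def
    using resolvent_bound[OF A y(1) t0] entry_sum_nonneg by (intro mult_left_mono) auto
  finally show False using pos by (simp add: t_def)
qed

text \<open>If the transfer function vanishes, the responses for k tending to infinity show G = 0, and L is the
  set of all x whose responses C (k - A)^-1 x vanish for all k.  It is invariant because
  k C (k - A)^-1 x = C x + C (k - A)^-1 A x shows that -C x is the response to A x for every
  k, so that C x = 0 by letting k tend to infinity.  Conversely, the resolvent preserves L.\<close>

lemma transfer_function_zero_invariant:
  assumes A: "A \<in> carrier_mat N N" and H: "H \<in> carrier_mat N q" and C: "C \<in> carrier_mat r N" and G: "G \<in> carrier_mat r q"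
  shows "transfer_function_zero A H C G \<longleftrightarrow> (\<forall>w :: real fvec. act G w = 0) \<and>
    (\<exists>L. fsubspace N L \<and> (\<forall>x\<in>L. act A x \<in> L \<and> act C x = 0) \<and> (\<forall>w. act H w \<in> L))"
proof
  assume "transfer_function_zero A H C G"
  then have tz: "act C x + act G w = 0" 
    if "no_eigenvector A k" "x \<in> supp N" "cst k * x - act A x = act H w" for k x w
    using that unfolding transfer_function_zero_iff[OF assms] by blast
  have ex: "\<exists>y\<in>supp N. cst k * y - act A y = b" if "no_eigenvector A k" "b \<in> supp N" for k b
    using resolvent_exists[OF A, of k b] that A by (metis carrier_matD(1) no_eigenvector_def)
  have G0: "act G w = 0" for w :: "real fvec"
  proof -
    have "- act G (cfn w) = 0"
    proof (rule resolvent_limit[OF A C, of _ "cfn (act H w)"])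
      fix t assume "t > entry_sum A"
      then have k: "no_eigenvector A (of_real t)" by (rule no_eigenvector_large[OF A])
      have "act H (cfn w) \<in> supp N" using H by simp
      then obtain y where y: "y \<in> supp N" "cst (of_real t) * y - act A y = act H (cfn w)"
        using ex[OF k] by blast
      have "act C y = - act G (cfn w)" using tz[OF k y] by (simp add: eq_neg_iff_add_eq_0)
      with y show "\<exists>y. cst (of_real t) * y - act A y = cfn (act H w) \<and> act C y = - act G (cfn w)" by auto
    qed (use G in simp)
    then show ?thesis using cfn_eq_0_iff[of "act G w"] by simp
  qed
  have G0': "act G w = 0" for w :: "complex fvec"
    by (rule complex_fvec_eqI) (simp_all add: G0)
  define L where "L = {x \<in> supp N. \<forall>k. no_eigenvector A k \<longrightarrow> 
      (\<exists>y\<in>supp N. cst k * y - act A y = cfn x \<and> act C y = 0)}"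
  have L: "fsubspace N L" unfolding fsubspace_def
  proof (intro conjI ballI allI)
    show "L \<subseteq> supp N" by (auto simp: L_def)
    show "0 \<in> L" by (auto simp: L_def intro!: bexI[of _ 0])
  next
    fix x y assume xy: "x \<in> L" "y \<in> L"
    have "\<exists>z\<in>supp N. cst k * z - act A z = cfn (x + y) \<and> act C z = 0" if k: "no_eigenvector A k" for k
    proof -
      obtain a b where ab: "a \<in> supp N" "cst k * a - act A a = cfn x" "act C a = 0"
        "b \<in> supp N" "cst k * b - act A b = cfn y" "act C b = 0" using xy k unfolding L_def by blast
      have "cst k * (a + b) - act A (a + b) = (cst k * a - act A a) + (cst k * b - act A b)"
        by (simp add: algebra_simps)
      with ab show ?thesis by (intro bexI[of _ "a + b"]) auto
    qed
    with xy show "x + y \<in> L" by (auto simp: L_def)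
  next
    fix c x assume x: "x \<in> L"
    have "\<exists>z\<in>supp N. cst k * z - act A z = cfn (cst c * x) \<and> act C z = 0" if k: "no_eigenvector A k" for k
    proof -
      obtain a where a: "a \<in> supp N" "cst k * a - act A a = cfn x" "act C a = 0"
        using x k unfolding L_def by blast
      have "cst k * (cst (of_real c) * a) - act A (cst (of_real c) * a) = cst (of_real c) * (cst k * a - act A a)"
        by (simp add: algebra_simps)
      with a show ?thesis by (intro bexI[of _ "cst (of_real c) * a"]) auto
    qed
    with x show "cst c * x \<in> L" by (auto simp: L_def)
  qed
  have step: "cst k * act A y - act A (act A y) = act A (cfn x) \<and> act C (act A y) = - act C (cfn x)"
    if "cst k * y - act A y = cfn x" "act C y = 0" for k x y
  proof
    have "cst k * act A y - act A (act A y) = act A (cst k * y - act A y)" by simp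
    then show "cst k * act A y - act A (act A y) = act A (cfn x)" using that by simp
    have "act C (cst k * y - act A y) = act C (cfn x)" using that by simp
    then show "act C (act A y) = - act C (cfn x)" using that(2) by (simp add: minus_equation_iff)
  qed
  have C0: "act C x = 0" if x: "x \<in> L" for x
  proof -
    have "- act C (cfn x) = 0"
    proof (rule resolvent_limit[OF A C, of _ "act A (cfn x)"])
      fix t assume "t > entry_sum A"
      then have k: "no_eigenvector A (of_real t)" by (rule no_eigenvector_large[OF A])
      obtain y where "y \<in> supp N" "cst (of_real t) * y - act A y = cfn x" "act C y = 0"
        using x k unfolding L_def by blast
      with step show "\<exists>y. cst (of_real t) * y - act A y = act A (cfn x) \<and> act C y = - act C (cfn x)" by blast
    qed (use C in simp)
    then show ?thesis using cfn_eq_0_iff[of "act C x"] by simp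
  qed
  have inv: "act A x \<in> L" if x: "x \<in> L" for x
  proof -
    have "act C (cfn x) = 0" using arg_cong[OF C0[OF x], of cfn] by simp
    then have "\<exists>z\<in>supp N. cst k * z - act A z = cfn (act A x) \<and> act C z = 0" if k: "no_eigenvector A k" for k
    proof -
      obtain y where "y \<in> supp N" "cst k * y - act A y = cfn x" "act C y = 0"
        using x k unfolding L_def by blast
      with step \<open>act C (cfn x) = 0\<close> show ?thesis
        using A by (intro bexI[of _ "act A y"]) auto
    qed
    then show ?thesis using A by (auto simp: L_def)
  qed
  have "act H w \<in> L" for w
  proof -
    have "\<exists>z\<in>supp N. cst k * z - act A z = cfn (act H w) \<and> act C z = 0" if k: "no_eigenvector A k" for k
    proof -
      have "cfn (act H w) \<in> supp N" using H by simp
      then obtain y where y: "y \<in> supp N" "cst k * y - act A y = act H (cfn w)" using ex[OF k] by auto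
      with tz[OF k y] G0' show ?thesis by auto
    qed
    then show ?thesis using H by (auto simp: L_def)
  qed
  with G0 L C0 inv show "(\<forall>w :: real fvec. act G w = 0) \<and>
    (\<exists>L. fsubspace N L \<and> (\<forall>x\<in>L. act A x \<in> L \<and> act C x = 0) \<and> (\<forall>w. act H w \<in> L))" by blast
next
  assume "(\<forall>w :: real fvec. act G w = 0) \<and>
    (\<exists>L. fsubspace N L \<and> (\<forall>x\<in>L. act A x \<in> L \<and> act C x = 0) \<and> (\<forall>w. act H w \<in> L))"
  then obtain L where G0: "\<And>w :: real fvec. act G w = 0" and L: "fsubspace N L" "\<And>x. x \<in> L \<Longrightarrow> act A x \<in> L"
    "\<And>x. x \<in> L \<Longrightarrow> act C x = 0" "\<And>w. act H w \<in> L" by blast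
  show "transfer_function_zero A H C G"
    unfolding transfer_function_zero_iff[OF assms]
  proof (intro allI impI)
    fix k x w assume k: "no_eigenvector A k" and x: "x \<in> supp N" and eq: "cst k * x - act A x = act H w"
    have free: "z = 0" if "z \<in> supp N" "act A z = cst k * z" for z
      using k that A by (auto simp: no_eigenvector_def)
    have "act H w \<in> cx L" using L(4) by (simp add: cx_def)
    then obtain y where y: "y \<in> cx L" "cst k * y - act A y = act H w"
      using resolvent_invariant[OF L(1) A L(2) free] by metis
    have "cst k * x - act A x = cst k * y - act A y" by (simp add: eq y(2))
    then have "act A (x - y) = cst k * (x - y)" by (simp add: algebra_simps)
    moreover have "x - y \<in> supp N" using x cxD(1)[OF L(1) y(1)] by simp
    ultimately have "x - y = 0" by (intro free)
    then have "x \<in> cx L" using y by simp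
    then have "act C x = 0" using L(3) by (intro complex_fvec_eqI) (simp_all add: cx_def)
    moreover have "act G w = 0" by (rule complex_fvec_eqI) (simp_all add: G0)
    ultimately show "act C x + act G w = 0" by simp
  qed
qed

section \<open>Removing the feedthrough from input to measurement\<close>

text \<open>Matrix identities can be checked on functions, where ring normalization applies.\<close>

lemma mat_eqI_act:
  assumes X: "X \<in> carrier_mat n m" and Y: "Y \<in> carrier_mat n m"
    and eq: "\<And>f :: real fvec. f \<in> supp m \<Longrightarrow> act X f = act Y f"
  shows "X = Y"
proof (rule eq_matI)
  fix i j assume ij: "i < dim_row Y" "j < dim_col Y"
  have "act Z (unit_fn j) i = Z $$ (i, j)" if "Z \<in> carrier_mat n m" for Z
    using that ij Y by (simp add: act_def unit_fn_def if_distrib[of "\<lambda>c. _ * c"] cong: if_cong)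
  with X Y eq[of "unit_fn j"] ij show "X $$ (i, j) = Y $$ (i, j)" by (metis carrier_matD(2) unit_fn_supp)
qed (use X Y in auto)

lemma invertible_mat_obtain:
  assumes "X \<in> carrier_mat n n" "invertible_mat X"
  obtains Y where "Y \<in> carrier_mat n n" "X * Y = 1\<^sub>m n" "Y * X = 1\<^sub>m n"
proof -
  obtain Y where Y: "X * Y = 1\<^sub>m (dim_row X)" "Y * X = 1\<^sub>m (dim_row Y)"
    using assms unfolding invertible_mat_def inverts_mat_def by auto
  have "dim_col (X * Y) = n" "dim_col (Y * X) = dim_row Y" using Y assms by auto
  then have "Y \<in> carrier_mat n n" using assms by auto
  with Y assms that show thesis by auto
qed

lemma invertible_matI:
  assumes "X \<in> carrier_mat n n" "Y \<in> carrier_mat n n" "X * Y = 1\<^sub>m n" "Y * X = 1\<^sub>m n"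
  shows "invertible_mat X"
  using assms unfolding invertible_mat_def inverts_mat_def by auto

lemma the_mat_inverse:
  assumes X: "X \<in> carrier_mat n n" and Y: "Y \<in> carrier_mat n n" "X * Y = 1\<^sub>m n" "Y * X = 1\<^sub>m n"
  shows "the (mat_inverse X) = Y"
proof -
  have "X \<in> Units (ring_mat TYPE('a) n ())"
    using assms unfolding Units_def by (auto simp: ring_mat_def)
  then obtain W where "mat_inverse X = Some W"
    using mat_inverse(1)[OF X, where b = "()"] by (cases "mat_inverse X") auto
  then have W: "the (mat_inverse X) = W" "X * W = 1\<^sub>m n" "W \<in> carrier_mat n n"
    using mat_inverse(2)[OF X] by auto
  have "W = (Y * X) * W" using W Y by simp
  also have "\<dots> = Y * (X * W)" using X Y W by (intro assoc_mult_mat)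
  finally show ?thesis using W Y by simp
qed

lemma act_inverse: 
  assumes "X \<in> carrier_mat n m" "Y \<in> carrier_mat m n" "X * Y = 1\<^sub>m n" 
  shows "act X (act Y f) = trunc n f"
  using assms by (simp flip: act_mult)

text \<open>The problem for the plant with measurement y - Dy u, where the compensator has direct gain K and
  K has to satisfy the well-posedness condition of the original loop.\<close>

definition reduced_solvable ::
  "complex set \<Rightarrow> real mat \<Rightarrow> real mat \<Rightarrow> real mat \<Rightarrow> real mat \<Rightarrow> real mat \<Rightarrow> real mat \<Rightarrow>
   real mat \<Rightarrow> real mat \<Rightarrow> real mat \<Rightarrow> bool" where
  "reduced_solvable Cg A B H C Dy Gy E Dz Gz \<longleftrightarrow>
     (\<exists>s. \<exists>Ac \<in> carrier_mat s s. \<exists>Bc \<in> carrier_mat s (dim_row C).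
      \<exists>Cc \<in> carrier_mat (dim_col B) s. \<exists>K \<in> carrier_mat (dim_col B) (dim_row C).
        invertible_mat (1\<^sub>m (dim_col B) + K * Dy) \<and>
        transfer_function_zero (four_block_mat (A + B * K * C) (B * Cc) (Bc * C) Ac)
          ((H + B * K * Gy) @\<^sub>r (Bc * Gy)) ((E + Dz * K * C) @\<^sub>c (Dz * Cc)) (Gz + Dz * K * Gy) \<and>
        spectrum (cmat (four_block_mat (A + B * K * C) (B * Cc) (Bc * C) Ac)) \<subseteq> Cg)"

text \<open>With W = (I - Dy Dc)^-1 the substitution is K = Dc W, and
  (I + K Dy)^-1 = I - Dc Dy.  Conversely, with M = (I + K Dy)^-1 it is
  Dc = M K and W = I + Dy K.\<close>

lemma ddp_iff_reduced:
  assumes A: "A \<in> carrier_mat n n" and B: "B \<in> carrier_mat n m" and H: "H \<in> carrier_mat n q"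
    and C: "C \<in> carrier_mat p n" and Dy: "Dy \<in> carrier_mat p m" and Gy: "Gy \<in> carrier_mat p q"
    and E: "E \<in> carrier_mat r n" and Dz: "Dz \<in> carrier_mat r m" and Gz: "Gz \<in> carrier_mat r q"
  shows "ddp_output_feedback_solvable Cg A B H C Dy Gy E Dz Gz \<longleftrightarrow> reduced_solvable Cg A B H C Dy Gy E Dz Gz"
proof
  assume "ddp_output_feedback_solvable Cg A B H C Dy Gy E Dz Gz"
  then obtain s Ac Bc Cc Dc W where c: "Ac \<in> carrier_mat s s" "Bc \<in> carrier_mat s p"
    "Cc \<in> carrier_mat m s" "Dc \<in> carrier_mat m p" 
    and inv: "invertible_mat (1\<^sub>m p - Dy * Dc)" and W: "W = the (mat_inverse (1\<^sub>m p - Dy * Dc))"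
    and tz: "transfer_function_zero 
      (four_block_mat (A + B * Dc * W * C)  (B * Cc + B * Dc * W * Dy * Cc) (Bc * W * C) (Ac + Bc * W * Dy * Cc))
      ((H + B * Dc * W * Gy) @\<^sub>r (Bc * W * Gy)) 
      ((E + Dz * Dc * W * C) @\<^sub>c (Dz * Cc + Dz * Dc * W * Dy * Cc)) (Gz + Dz * Dc * W * Gy)"
    and sp: "spectrum (cmat (four_block_mat (A + B * Dc * W * C)  (B * Cc + B * Dc * W * Dy * Cc) 
      (Bc * W * C) (Ac + Bc * W * Dy * Cc))) \<subseteq> Cg"
    using B C unfolding ddp_output_feedback_solvable_def Let_def by auto
  define Y where "Y = 1\<^sub>m p - Dy * Dc"
  have Y: "Y \<in> carrier_mat p p" using Dy c by (auto simp: Y_def)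
  obtain W' where "W' \<in> carrier_mat p p" "Y * W' = 1\<^sub>m p" "W' * Y = 1\<^sub>m p"
    using invertible_mat_obtain[OF Y] inv by (auto simp: Y_def)
  moreover from this have "W = W'" using the_mat_inverse[OF Y] W by (simp add: Y_def)
  ultimately have W: "W \<in> carrier_mat p p" "Y * W = 1\<^sub>m p" "W * Y = 1\<^sub>m p" by auto
  have actY: "act Y f = f - act Dy (act Dc f)" if "f \<in> supp p" for f :: "real fvec"
    using Dy c that by (simp add: Y_def act_minus act_mult)
  have YW: "act Dy (act Dc (act W f)) = act W f - f" if "f \<in> supp p" for f :: "real fvec"
    using act_inverse[OF Y W(1,2), of f] W(1) that by (simp add: actY algebra_simps)
  have WY: "act W (act Dy (act Dc f)) = act W f - f" if "f \<in> supp p" for f :: "real fvec"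
    using act_inverse[OF W(1) Y W(3), of f] that by (simp add: actY algebra_simps)
  define K where "K = Dc * W"
  have K: "K \<in> carrier_mat m p" using c W by (simp add: K_def)
  have e1: "X * Dc * W * Z = X * K * Z" if "X \<in> carrier_mat i m" "Z \<in> carrier_mat p j" for X Z i j
    using that c W by (simp add: K_def assoc_mult_mat[of X i m Dc p W p])
  have e2: "X * Cc + X * Dc * W * Dy * Cc = X * (Cc + K * Dy * Cc)" if "X \<in> carrier_mat i m" for X i
    by (rule mat_eqI_act[of _ i s]) 
      (use that c W Dy K in \<open>auto simp: act_add act_mult K_def\<close>)
  have e3: "Ac + Bc * W * Dy * Cc = Ac + (Bc * W) * Dy * Cc" by simp
  have inv': "invertible_mat (1\<^sub>m m + K * Dy)"
  proof (rule invertible_matI[of _ m "1\<^sub>m m - Dc * Dy"])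
    show "(1\<^sub>m m + K * Dy) * (1\<^sub>m m - Dc * Dy) = 1\<^sub>m m"
      by (rule mat_eqI_act[of _ m m])
        (use c W Dy K in \<open>auto simp: act_add act_mult act_minus K_def WY algebra_simps\<close>)
    show "(1\<^sub>m m - Dc * Dy) * (1\<^sub>m m + K * Dy) = 1\<^sub>m m"
      by (rule mat_eqI_act[of _ m m])
        (use c W Dy K in \<open>auto simp: act_add act_mult act_minus K_def YW algebra_simps\<close>)
  qed (use c Dy K in auto)
  show "reduced_solvable Cg A B H C Dy Gy E Dz Gz"
    unfolding reduced_solvable_def
  proof (rule exI[of _ s], rule bexI[of _ "Ac + Bc * W * Dy * Cc"], rule bexI[of _ "Bc * W"],
      rule bexI[of _ "Cc + K * Dy * Cc"], rule bexI[of _ K], intro conjI)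
    show "invertible_mat (1\<^sub>m (dim_col B) + K * Dy)" using inv' B by simp
  qed (use tz sp c W K B C Dy e1[OF B C] e1[OF B Gy] e1[OF Dz C] e1[OF Dz Gy] e2[OF B] e2[OF Dz] in auto)
next
  assume "reduced_solvable Cg A B H C Dy Gy E Dz Gz"
  then obtain s Ac Bc Cc K where c: "Ac \<in> carrier_mat s s" "Bc \<in> carrier_mat s p"
    "Cc \<in> carrier_mat m s" "K \<in> carrier_mat m p" 
    and inv: "invertible_mat (1\<^sub>m m + K * Dy)" 
    and tz: "transfer_function_zero (four_block_mat (A + B * K * C) (B * Cc) (Bc * C) Ac)
          ((H + B * K * Gy) @\<^sub>r (Bc * Gy)) ((E + Dz * K * C) @\<^sub>c (Dz * Cc)) (Gz + Dz * K * Gy)"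
    and sp: "spectrum (cmat (four_block_mat (A + B * K * C) (B * Cc) (Bc * C) Ac)) \<subseteq> Cg"
    using B C unfolding reduced_solvable_def by auto
  define N where "N = 1\<^sub>m m + K * Dy"
  have N: "N \<in> carrier_mat m m" using Dy c by (auto simp: N_def)
  obtain M where M: "M \<in> carrier_mat m m" "N * M = 1\<^sub>m m" "M * N = 1\<^sub>m m"
    using invertible_mat_obtain[OF N] inv by (auto simp: N_def)
  have actN: "act N f = f + act K (act Dy f)" if "f \<in> supp m" for f :: "real fvec"
    using Dy c that by (simp add: N_def act_add act_mult)
  have NM: "act K (act Dy (act M f)) = f - act M f" if "f \<in> supp m" for f :: "real fvec"
    using act_inverse[OF N M(1,2), of f] M(1) that by (simp add: actN algebra_simps)
  have MN: "act M (act K (act Dy f)) = f - act M f" if "f \<in> supp m" for f :: "real fvec"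
    using act_inverse[OF M(1) N M(3), of f] that by (simp add: actN algebra_simps)
  define Dc where "Dc = M * K"
  have Dc: "Dc \<in> carrier_mat m p" using c M by (simp add: Dc_def)
  define W where "W = 1\<^sub>m p + Dy * K"
  have W: "W \<in> carrier_mat p p" using Dy c by (simp add: W_def)
  define Y where "Y = 1\<^sub>m p - Dy * Dc"
  have Y: "Y \<in> carrier_mat p p" using Dy Dc by (auto simp: Y_def)
  have YW: "Y * W = 1\<^sub>m p"
    by (rule mat_eqI_act[of _ p p])
      (use c W Dy Dc M Y in \<open>auto simp: act_add act_mult act_minus Y_def W_def Dc_def MN algebra_simps\<close>)
  have WY: "W * Y = 1\<^sub>m p"
    by (rule mat_eqI_act[of _ p p])
      (use c W Dy Dc M Y in \<open>auto simp: act_add act_mult act_minus Y_def W_def Dc_def NM algebra_simps\<close>)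
  have inv': "invertible_mat Y" by (rule invertible_matI[OF Y W YW WY])
  have W': "the (mat_inverse Y) = W" by (rule the_mat_inverse[OF Y W YW WY])
  define Cc' where "Cc' = M * Cc"
  define Bc' where "Bc' = Bc * Y"
  define Ac' where "Ac' = Ac - Bc * Dy * M * Cc"
  have c': "Cc' \<in> carrier_mat m s" "Bc' \<in> carrier_mat s p" "Ac' \<in> carrier_mat s s"
    using c M Y Dy by (auto simp: Cc'_def Bc'_def Ac'_def)
  have e1: "X * Dc * W * Z = X * K * Z" if "X \<in> carrier_mat i m" "Z \<in> carrier_mat p j" for X Z i j
    by (rule mat_eqI_act[of _ i j])
      (use that c W Dy Dc M in \<open>auto simp: act_add act_mult W_def Dc_def MN\<close>)
  have e2: "X * Cc' + X * Dc * W * Dy * Cc' = X * Cc" if "X \<in> carrier_mat i m" for X i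
    by (rule mat_eqI_act[of _ i s])
      (use that c W Dy Dc M c' in \<open>auto simp: act_add act_mult W_def Dc_def Cc'_def MN NM\<close>)
  have e3: "Bc' * W = Bc"
  proof (rule mat_eqI_act[of _ s p])
    fix f :: "real fvec" assume f: "f \<in> supp p"
    have "act (Bc' * W) f = act Bc (act Y (act W f))" using c(2) W Y by (simp add: act_mult Bc'_def)
    also have "act Y (act W f) = f" using act_inverse[OF Y W YW, of f] f by simp
    finally show "act (Bc' * W) f = act Bc f" .
  qed (use c(2) c'(2) W in auto)
  have e4: "Ac' + Bc * Dy * Cc' = Ac"
  proof (rule mat_eqI_act[of _ s s])
    fix f :: "real fvec" assume f: "f \<in> supp s"
    have "act (Ac' + Bc * Dy * Cc') f = act Ac' f + act Bc (act Dy (act Cc' f))"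
      using c(2) Dy c' by (simp add: act_add act_mult)
    also have "act Ac' f = act Ac f - act Bc (act Dy (act M (act Cc f)))"
      using c Dy M(1) by (simp add: Ac'_def act_minus act_mult)
    also have "act Cc' f = act M (act Cc f)" using c M(1) by (simp add: Cc'_def act_mult)
    finally show "act (Ac' + Bc * Dy * Cc') f = act Ac f" by simp
  qed (use c c' Dy in auto)
  have Ye: "1\<^sub>m (dim_row C) - Dy * Dc = Y" using C by (simp add: Y_def)
  note eqs = Ye W' e1[OF B C] e1[OF B Gy] e1[OF Dz C] e1[OF Dz Gy] e2[OF B] e2[OF Dz] e3 e4
  show "ddp_output_feedback_solvable Cg A B H C Dy Gy E Dz Gz"
    unfolding ddp_output_feedback_solvable_def Let_def
  proof (rule exI[of _ s], rule bexI[of _ Ac'], rule bexI[of _ Bc'], rule bexI[of _ Cc'], rule bexI[of _ Dc],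
      intro conjI)
    show "invertible_mat (1\<^sub>m (dim_row C) - Dy * Dc)" using inv' Ye by simp
  qed (simp_all only: Y_def[symmetric] eqs tz sp carrier_matD[OF B] carrier_matD[OF C] c' Dc)
qed

text \<open>The closed loop has states (x, \<xi>), input u = K C x + Cc \<xi> and no feedthrough from u to the
  measurement.\<close>

definition closed_loop_decoupled :: 
  "nat \<Rightarrow> nat \<Rightarrow> real mat \<Rightarrow> real mat \<Rightarrow> real mat \<Rightarrow> real mat \<Rightarrow> real mat \<Rightarrow> real mat \<Rightarrow> real mat \<Rightarrow>
   real mat \<Rightarrow> real mat \<Rightarrow> real mat \<Rightarrow> real mat \<Rightarrow> real fvec set \<Rightarrow> bool" where
  "closed_loop_decoupled n s A B H C Gy E Dz Ac Bc Cc K L \<longleftrightarrow> fsubspace (n + s) L \<and>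
     (\<forall>x \<xi>. x \<in> supp n \<longrightarrow> \<xi> \<in> supp s \<longrightarrow> stack n x \<xi> \<in> L \<longrightarrow>
        stack n (act A x + act B (act K (act C x) + act Cc \<xi>)) (act Bc (act C x) + act Ac \<xi>) \<in> L \<and>
        act E x + act Dz (act K (act C x) + act Cc \<xi>) = 0) \<and>
     (\<forall>w. stack n (act H w + act B (act K (act Gy w))) (act Bc (act Gy w)) \<in> L)"

definition closed_loop_stable ::
  "complex set \<Rightarrow> nat \<Rightarrow> nat \<Rightarrow> real mat \<Rightarrow> real mat \<Rightarrow> real mat \<Rightarrow> real mat \<Rightarrow> real mat \<Rightarrow> real mat \<Rightarrow> real mat \<Rightarrow> bool" where
  "closed_loop_stable Cg n s A B C Ac Bc Cc K \<longleftrightarrow> 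
     (\<forall>k x \<xi>. k \<notin> Cg \<longrightarrow> x \<in> supp n \<longrightarrow> \<xi> \<in> supp s \<longrightarrow> 
        act A x + act B (act K (act C x) + act Cc \<xi>) = cst k * x \<longrightarrow> act Bc (act C x) + act Ac \<xi> = cst k * \<xi> \<longrightarrow>
        x = 0 \<and> \<xi> = (0 :: complex fvec))"

context
  fixes n m q p r s :: nat and A B H C Gy E Dz Gz Ac Bc Cc K :: "real mat"
  assumes A: "A \<in> carrier_mat n n" and B: "B \<in> carrier_mat n m" and H: "H \<in> carrier_mat n q"
    and C: "C \<in> carrier_mat p n" and Gy: "Gy \<in> carrier_mat p q"
    and E: "E \<in> carrier_mat r n" and Dz: "Dz \<in> carrier_mat r m" and Gz: "Gz \<in> carrier_mat r q"
    and Ac: "Ac \<in> carrier_mat s s" and Bc: "Bc \<in> carrier_mat s p" and Cc: "Cc \<in> carrier_mat m s" 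
    and K: "K \<in> carrier_mat m p"
begin

lemma act_closed_loop:
  "act (four_block_mat (A + B * K * C) (B * Cc) (Bc * C) Ac) (stack n x \<xi>) = 
     stack n (act A x + act B (act K (act C x) + act Cc \<xi>)) (act Bc (act C x) + act Ac \<xi>)"
  "act ((H + B * K * Gy) @\<^sub>r (Bc * Gy)) w = stack n (act H w + act B (act K (act Gy w))) (act Bc (act Gy w))"
  "act ((E + Dz * K * C) @\<^sub>c (Dz * Cc)) (stack n x \<xi>) = act E x + act Dz (act K (act C x) + act Cc \<xi>)"
  "act (Gz + Dz * K * Gy) w = act Gz w + act Dz (act K (act Gy w))"
proof -
  show "act (four_block_mat (A + B * K * C) (B * Cc) (Bc * C) Ac) (stack n x \<xi>) = 
     stack n (act A x + act B (act K (act C x) + act Cc \<xi>)) (act Bc (act C x) + act Ac \<xi>)"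
    using A B C Ac Bc Cc K
    by (subst act_four_block[of _ n n _ s _ s]) (auto simp: act_add act_mult add.assoc)
  show "act ((H + B * K * Gy) @\<^sub>r (Bc * Gy)) w = stack n (act H w + act B (act K (act Gy w))) (act Bc (act Gy w))"
    using B H Gy Bc K by (subst act_append_rows[of _ n q _ s]) (auto simp: act_add act_mult)
  show "act ((E + Dz * K * C) @\<^sub>c (Dz * Cc)) (stack n x \<xi>) = act E x + act Dz (act K (act C x) + act Cc \<xi>)"
    using E Dz C Cc K by (subst act_append_cols[of _ r n _ s]) (auto simp: act_add act_mult add.assoc)
  show "act (Gz + Dz * K * Gy) w = act Gz w + act Dz (act K (act Gy w))"
    using Gz Dz Gy K by (simp add: act_add act_mult)
qed

lemma closed_loop_carrier:
  "four_block_mat (A + B * K * C) (B * Cc) (Bc * C) Ac \<in> carrier_mat (n + s) (n + s)"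
  "(H + B * K * Gy) @\<^sub>r (Bc * Gy) \<in> carrier_mat (n + s) q"
  "(E + Dz * K * C) @\<^sub>c (Dz * Cc) \<in> carrier_mat r (n + s)"
  "Gz + Dz * K * Gy \<in> carrier_mat r q"
  using A B H C Gy E Dz Gz Ac Bc Cc K by (auto intro!: four_block_carrier_mat carrier_append_cols)

lemma closed_loop_transfer_iff:
  "transfer_function_zero (four_block_mat (A + B * K * C) (B * Cc) (Bc * C) Ac)
     ((H + B * K * Gy) @\<^sub>r (Bc * Gy)) ((E + Dz * K * C) @\<^sub>c (Dz * Cc)) (Gz + Dz * K * Gy) \<longleftrightarrow>
   (\<forall>w :: real fvec. act Gz w + act Dz (act K (act Gy w)) = 0) \<and> 
   (\<exists>L. closed_loop_decoupled n s A B H C Gy E Dz Ac Bc Cc K L)"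
proof -
  have "(\<forall>x\<in>L. P x) \<longleftrightarrow> (\<forall>x \<xi>. x \<in> supp n \<longrightarrow> \<xi> \<in> supp s \<longrightarrow> stack n x \<xi> \<in> L \<longrightarrow> P (stack n x \<xi>))" 
    if "fsubspace (n + s) L" for L P
  proof -
    have "trunc n l \<in> supp n \<and> shift n l \<in> supp s \<and> stack n (trunc n l) (shift n l) = l" if "l \<in> L" for l
      using fsubspaceD(1)[OF \<open>fsubspace (n + s) L\<close> that] by (simp add: stack_split)
    then show ?thesis by metis
  qed
  then show ?thesis
    unfolding transfer_function_zero_invariant[OF closed_loop_carrier] act_closed_loop(2,4)
      closed_loop_decoupled_def
    by (simp add: act_closed_loop(1,3) cong: conj_cong)
qed

lemma closed_loop_no_eigenvector:
  assumes "closed_loop_stable Cg n s A B C Ac Bc Cc K" "k \<notin> Cg" 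
    "l \<in> supp (n + s)" "act (four_block_mat (A + B * K * C) (B * Cc) (Bc * C) Ac) l = cst k * l"
  shows "l = (0 :: complex fvec)"
proof -
  let ?x = "trunc n l" and ?\<xi> = "shift n l"
  have l: "?x \<in> supp n" "?\<xi> \<in> supp s" "l = stack n ?x ?\<xi>"
    using assms(3) by (simp_all add: stack_split)
  have "stack n (act A ?x + act B (act K (act C ?x) + act Cc ?\<xi>)) (act Bc (act C ?x) + act Ac ?\<xi>)
      = stack n (cst k * ?x) (cst k * ?\<xi>)"
    using assms(4) act_closed_loop(1)[of ?x ?\<xi>] l(3) by (metis stack_linear(4))
  then have "act A ?x + act B (act K (act C ?x) + act Cc ?\<xi>) = cst k * ?x"
    "act Bc (act C ?x) + act Ac ?\<xi> = cst k * ?\<xi>"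
    using l A B by (simp_all add: stack_eq_iff)
  then have "?x = 0" "?\<xi> = 0" using assms(1,2) l(1,2) unfolding closed_loop_stable_def by blast+
  then show ?thesis using l(3) by (simp add: stack_linear)
qed

lemma closed_loop_spectrum_iff:
  "spectrum (cmat (four_block_mat (A + B * K * C) (B * Cc) (Bc * C) Ac)) \<subseteq> Cg \<longleftrightarrow>
   closed_loop_stable Cg n s A B C Ac Bc Cc K"
proof -
  let ?M = "four_block_mat (A + B * K * C) (B * Cc) (Bc * C) Ac"
  have d: "dim_row ?M = n + s" using closed_loop_carrier(1) by auto
  have "closed_loop_stable Cg n s A B C Ac Bc Cc K" if h: "\<And>k. k \<notin> Cg \<Longrightarrow> no_eigenvector ?M k"
    unfolding closed_loop_stable_def
  proof (intro allI impI)
    fix k x \<xi> assume a: "k \<notin> Cg" "x \<in> supp n" "\<xi> \<in> supp s"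
      "act A x + act B (act K (act C x) + act Cc \<xi>) = cst k * x" "act Bc (act C x) + act Ac \<xi> = cst k * \<xi>"
    have "act ?M (stack n x \<xi>) = cst k * stack n x \<xi>" by (simp only: act_closed_loop a stack_linear)
    then have "stack n x \<xi> = 0" using h[OF a(1)] a(2,3) d by (simp add: no_eigenvector_def)
    then show "x = 0 \<and> \<xi> = 0" using a(2) by (simp add: stack_zero_iff)
  qed
  moreover have "no_eigenvector ?M k" if "closed_loop_stable Cg n s A B C Ac Bc Cc K" "k \<notin> Cg" for k
    unfolding no_eigenvector_def d using closed_loop_no_eigenvector[OF that] by blast
  ultimately show ?thesis
    using spectrum_iff[OF closed_loop_carrier(1)] by blast
qed

lemma closed_loop_resolvent:
  assumes L: "closed_loop_decoupled n s A B H C Gy E Dz Ac Bc Cc K L" 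
    and st: "closed_loop_stable Cg n s A B C Ac Bc Cc K" and k: "k \<notin> Cg" and v: "v \<in> cx L"
  obtains x \<xi> where "x \<in> supp n" "\<xi> \<in> supp s" "stack n x \<xi> \<in> cx L"
    "v = stack n (cst k * x - act A x - act B (act K (act C x) + act Cc \<xi>)) (cst k * \<xi> - act Bc (act C x) - act Ac \<xi>)"
proof -
  let ?M = "four_block_mat (A + B * K * C) (B * Cc) (Bc * C) Ac"
  have fL: "fsubspace (n + s) L" using L by (simp add: closed_loop_decoupled_def)
  have inv: "act ?M l \<in> L" if "l \<in> L" for l
  proof -
    have "l \<in> supp (n + s)" using fsubspaceD(1)[OF fL that] .
    then have l: "trunc n l \<in> supp n" "shift n l \<in> supp s" "stack n (trunc n l) (shift n l) = l"
      by (simp_all add: stack_split)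
    then show ?thesis
      using L that act_closed_loop(1)[of "trunc n l" "shift n l"] unfolding closed_loop_decoupled_def by metis
  qed
  obtain l where l: "l \<in> cx L" "cst k * l - act ?M l = v"
    by (rule resolvent_invariant[OF fL closed_loop_carrier(1) inv closed_loop_no_eigenvector[OF st k] v])
      (assumption | rule that)+
  let ?x = "trunc n l" and ?\<xi> = "shift n l"
  have "l \<in> supp (n + s)" by (rule cxD(1)[OF fL l(1)])
  then have x: "?x \<in> supp n" "?\<xi> \<in> supp s" "stack n ?x ?\<xi> = l" by (simp_all add: stack_split)
  have "v = cst k * stack n ?x ?\<xi> - act ?M (stack n ?x ?\<xi>)" using l x by simp
  also have "\<dots> = stack n (cst k * ?x - act A ?x - act B (act K (act C ?x) + act Cc ?\<xi>)) 
      (cst k * ?\<xi> - act Bc (act C ?x) - act Ac ?\<xi>)"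
    unfolding act_closed_loop by (simp add: stack_linear diff_diff_eq)
  finally show thesis using that x l by metis
qed

end

lemma ddp_iff:
  assumes A: "A \<in> carrier_mat n n" and B: "B \<in> carrier_mat n m" and H: "H \<in> carrier_mat n q"
    and C: "C \<in> carrier_mat p n" and Dy: "Dy \<in> carrier_mat p m" and Gy: "Gy \<in> carrier_mat p q"
    and E: "E \<in> carrier_mat r n" and Dz: "Dz \<in> carrier_mat r m" and Gz: "Gz \<in> carrier_mat r q"
  shows "ddp_output_feedback_solvable Cg A B H C Dy Gy E Dz Gz \<longleftrightarrow> 
    (\<exists>s. \<exists>Ac \<in> carrier_mat s s. \<exists>Bc \<in> carrier_mat s p. \<exists>Cc \<in> carrier_mat m s. \<exists>K \<in> carrier_mat m p. \<exists>L.
      invertible_mat (1\<^sub>m m + K * Dy) \<and> (\<forall>w :: real fvec. act Gz w + act Dz (act K (act Gy w)) = 0) \<and>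
      closed_loop_decoupled n s A B H C Gy E Dz Ac Bc Cc K L \<and> closed_loop_stable Cg n s A B C Ac Bc Cc K)"
proof -
  have dims: "dim_row C = p" "dim_col B = m" using C B by auto
  show ?thesis
    unfolding ddp_iff_reduced[OF assms] reduced_solvable_def dims
    using closed_loop_transfer_iff[OF A B H C Gy E Dz Gz] closed_loop_spectrum_iff[OF A B H C Gy E Dz Gz]
    by (auto cong: bex_cong)
qed

section \<open>Subspaces of a decoupled stable closed loop\<close>

lemma act_append_cols_shift:
  assumes "P \<in> carrier_mat n1 m" "Q \<in> carrier_mat n1 q"
  shows "act (P @\<^sub>c Q) u = act P u + act Q (shift m u)"
  using act_append_cols[OF assms, of "trunc m u" "shift m u"] assms by (simp add: stack_split)

lemma out_nulling_append_cols:
  assumes "A \<in> carrier_mat n n" "B \<in> carrier_mat n m" "H \<in> carrier_mat n q" "D \<in> carrier_mat r m" "G \<in> carrier_mat r q"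
  shows "out_nulling A (B @\<^sub>c H) E (D @\<^sub>c G) V \<longleftrightarrow> fsubspace n V \<and> 
    (\<forall>x\<in>V. \<exists>u w. act A x + act B u + act H w \<in> V \<and> act E x + act D u + act G w = 0)"
proof -
  have "(\<exists>u. act A x + act (B @\<^sub>c H) u \<in> V \<and> act E x + act (D @\<^sub>c G) u = 0) \<longleftrightarrow>
    (\<exists>u w. act A x + act B u + act H w \<in> V \<and> act E x + act D u + act G w = 0)" for x
  proof
    assume "\<exists>u. act A x + act (B @\<^sub>c H) u \<in> V \<and> act E x + act (D @\<^sub>c G) u = 0"
    then obtain u where u: "act A x + act (B @\<^sub>c H) u \<in> V \<and> act E x + act (D @\<^sub>c G) u = 0" ..
    have "act A x + act B u + act H (shift m u) \<in> V \<and> act E x + act D u + act G (shift m u) = 0"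
      using u act_append_cols_shift[OF assms(2,3), of u] act_append_cols_shift[OF assms(4,5), of u]
      by (simp add: add.assoc)
    then show "\<exists>u w. act A x + act B u + act H w \<in> V \<and> act E x + act D u + act G w = 0" by blast
  next
    assume "\<exists>u w. act A x + act B u + act H w \<in> V \<and> act E x + act D u + act G w = 0"
    then obtain u w where u: "act A x + act B u + act H w \<in> V \<and> act E x + act D u + act G w = 0" by blast
    have "act A x + act (B @\<^sub>c H) (stack m u w) \<in> V \<and> act E x + act (D @\<^sub>c G) (stack m u w) = 0"
      using u act_append_cols[OF assms(2,3), of u w] act_append_cols[OF assms(4,5), of u w]
      by (simp add: add.assoc)
    then show "\<exists>u. act A x + act (B @\<^sub>c H) u \<in> V \<and> act E x + act (D @\<^sub>c G) u = 0" by blast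
  qed
  then show ?thesis using assms(1) by (auto simp: out_nulling_def)
qed

lemma in_containing_append_cols:
  assumes "A \<in> carrier_mat n n" "B \<in> carrier_mat n m" "H \<in> carrier_mat n q" "D \<in> carrier_mat r m" "G \<in> carrier_mat r q"
  shows "in_containing A (B @\<^sub>c H) E (D @\<^sub>c G) S \<longleftrightarrow> fsubspace n S \<and> 
    (\<forall>x\<in>S. \<forall>u w. act E x + act D u + act G w = 0 \<longrightarrow> act A x + act B u + act H w \<in> S)"
proof -
  have "(\<forall>u. act E x + act (D @\<^sub>c G) u = 0 \<longrightarrow> act A x + act (B @\<^sub>c H) u \<in> S) \<longleftrightarrow>
    (\<forall>u w. act E x + act D u + act G w = 0 \<longrightarrow> act A x + act B u + act H w \<in> S)" for x
  proof
    assume h: "\<forall>u. act E x + act (D @\<^sub>c G) u = 0 \<longrightarrow> act A x + act (B @\<^sub>c H) u \<in> S"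
    show "\<forall>u w. act E x + act D u + act G w = 0 \<longrightarrow> act A x + act B u + act H w \<in> S"
    proof (intro allI impI)
      fix u w assume "act E x + act D u + act G w = 0"
      then show "act A x + act B u + act H w \<in> S"
        using h[rule_format, of "stack m u w"] act_append_cols[OF assms(2,3), of u w] act_append_cols[OF assms(4,5), of u w]
        by (simp add: add.assoc)
    qed
  next
    assume h: "\<forall>u w. act E x + act D u + act G w = 0 \<longrightarrow> act A x + act B u + act H w \<in> S"
    show "\<forall>u. act E x + act (D @\<^sub>c G) u = 0 \<longrightarrow> act A x + act (B @\<^sub>c H) u \<in> S"
    proof (intro allI impI)
      fix u assume "act E x + act (D @\<^sub>c G) u = 0"
      then show "act A x + act (B @\<^sub>c H) u \<in> S"
        using h[rule_format, of u "shift m u"] act_append_cols_shift[OF assms(2,3), of u] act_append_cols_shift[OF assms(4,5), of u]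
        by (simp add: add.assoc)
    qed
  qed
  then show ?thesis using assms(1) by (auto simp: in_containing_def)
qed

lemma append_rows_zero_iff:
  assumes "C \<in> carrier_mat p n" "E \<in> carrier_mat r n" "Gy \<in> carrier_mat p q" "Gz \<in> carrier_mat r q"
  shows "act (C @\<^sub>r E) x + act (Gy @\<^sub>r Gz) w = 0 \<longleftrightarrow> act C x + act Gy w = 0 \<and> act E x + act Gz w = 0"
  using assms by (simp add: act_append_rows[OF assms(1,2)] act_append_rows[OF assms(3,4)] stack_linear(1) stack_zero_iff)

lemma out_nulling_append_rows:
  assumes "A \<in> carrier_mat n n" "C \<in> carrier_mat p n" "E \<in> carrier_mat r n" "Gy \<in> carrier_mat p q" "Gz \<in> carrier_mat r q"
  shows "out_nulling A H (C @\<^sub>r E) (Gy @\<^sub>r Gz) V \<longleftrightarrow> fsubspace n V \<and> 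
    (\<forall>x\<in>V. \<exists>w. act A x + act H w \<in> V \<and> act C x + act Gy w = 0 \<and> act E x + act Gz w = 0)"
  using assms(1) by (simp add: out_nulling_def append_rows_zero_iff[OF assms(2-5)])

lemma in_containing_append_rows:
  assumes "A \<in> carrier_mat n n" "C \<in> carrier_mat p n" "E \<in> carrier_mat r n" "Gy \<in> carrier_mat p q" "Gz \<in> carrier_mat r q"
  shows "in_containing A H (C @\<^sub>r E) (Gy @\<^sub>r Gz) S \<longleftrightarrow> fsubspace n S \<and> 
    (\<forall>x\<in>S. \<forall>w. act C x + act Gy w = 0 \<longrightarrow> act E x + act Gz w = 0 \<longrightarrow> act A x + act H w \<in> S)"
  using assms(1) by (auto simp: in_containing_def append_rows_zero_iff[OF assms(2-5)])

definition Vm where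
  "Vm A B H E Dz Gz = Vst A (B @\<^sub>c H) E (Dz @\<^sub>c Gz) \<inter> Sst A (B @\<^sub>c H) E (Dz @\<^sub>c Gz)"

definition SM where
  "SM A H C Gy E Gz = Vst A H (C @\<^sub>r E) (Gy @\<^sub>r Gz) + Sst A H (C @\<^sub>r E) (Gy @\<^sub>r Gz)"

context
  fixes n m q p r :: nat and A B H C Gy E Dz Gz :: "real mat"
  assumes A: "A \<in> carrier_mat n n" and B: "B \<in> carrier_mat n m" and H: "H \<in> carrier_mat n q"
    and C: "C \<in> carrier_mat p n" and Gy: "Gy \<in> carrier_mat p q"
    and E: "E \<in> carrier_mat r n" and Dz: "Dz \<in> carrier_mat r m" and Gz: "Gz \<in> carrier_mat r q"
begin

text \<open>
  V0 and S0 are the subspaces V* and S* of the control path from u to z and of the path from w to y.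
  V1 and S1 belong to the system with input w and both outputs, V2 and S2 to the system with both
  inputs and output z.  R2 is V_m and N1 is S_M.
\<close>

abbreviation "V0 \<equiv> Vst A B E Dz"
abbreviation "S0 \<equiv> Sst A H C Gy"
abbreviation "V1 \<equiv> Vst A H (C @\<^sub>r E) (Gy @\<^sub>r Gz)"
abbreviation "S1 \<equiv> Sst A H (C @\<^sub>r E) (Gy @\<^sub>r Gz)"
abbreviation "V2 \<equiv> Vst A (B @\<^sub>c H) E (Dz @\<^sub>c Gz)"
abbreviation "S2 \<equiv> Sst A (B @\<^sub>c H) E (Dz @\<^sub>c Gz)"
abbreviation "R2 \<equiv> Vm A B H E Dz Gz"
abbreviation "N1 \<equiv> SM A H C Gy E Gz"
abbreviation "VM \<equiv> R2 + N1"

lemma Vst_fsubspace: "fsubspace n (Vst A X Y Z)"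
  using out_nulling_Vst[of A X Y Z] A by (simp add: out_nulling_def)

lemma Sst_fsubspace: "X \<in> carrier_mat n i \<Longrightarrow> fsubspace n (Sst A X Y Z)"
  using in_containing_Sst[OF A, of X i Y Z] A by (simp add: in_containing_def)

lemma append_BH_carrier: "B @\<^sub>c H \<in> carrier_mat n (m + q)" 
  using B H by auto

lemma V2_out_nulling:
  "x \<in> V2 \<Longrightarrow> \<exists>u w. act A x + act B u + act H w \<in> V2 \<and> 
     act E x + act Dz u + act Gz w = 0"
  using out_nulling_Vst[of A "B @\<^sub>c H" E "Dz @\<^sub>c Gz"] unfolding out_nulling_append_cols[OF A B H Dz Gz] by blast

lemma S2_in_containing:
  "x \<in> S2 \<Longrightarrow> act E x + act Dz u + act Gz w = 0 \<Longrightarrow> 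
     act A x + act B u + act H w \<in> S2"
  using in_containing_Sst[OF A append_BH_carrier, of E "Dz @\<^sub>c Gz"] unfolding in_containing_append_cols[OF A B H Dz Gz] by blast

lemma V1_out_nulling:
  "x \<in> V1 \<Longrightarrow> \<exists>w. act A x + act H w \<in> V1 \<and> 
     act C x + act Gy w = 0 \<and> act E x + act Gz w = 0"
  using out_nulling_Vst[of A H "C @\<^sub>r E" "Gy @\<^sub>r Gz"] unfolding out_nulling_append_rows[OF A C E Gy Gz] by blast

lemma S1_in_containing:
  "x \<in> S1 \<Longrightarrow> act C x + act Gy w = 0 \<Longrightarrow> act E x + act Gz w = 0 \<Longrightarrow>
     act A x + act H w \<in> S1"
  using in_containing_Sst[OF A H, of "C @\<^sub>r E" "Gy @\<^sub>r Gz"] unfolding in_containing_append_rows[OF A C E Gy Gz] by blast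

lemma S_in_containing:
  "x \<in> S0 \<Longrightarrow> act C x + act Gy w = 0 \<Longrightarrow> act A x + act H w \<in> S0"
  using in_containing_Sst[OF A H, of C Gy] unfolding in_containing_def by blast

lemma V_sub_V2: "V0 \<subseteq> V2"
proof (rule Vst_greatest)
  have "\<exists>u w. act A x + act B u + act H w \<in> V0 \<and> act E x + act Dz u + act Gz w = 0" 
    if x: "x \<in> V0" for x
  proof -
    obtain u where "act A x + act B u \<in> V0" "act E x + act Dz u = 0"
      using out_nulling_Vst[of A B E Dz] x by (auto simp: out_nulling_def)
    then show ?thesis by (intro exI[of _ u] exI[of _ 0]) simp
  qed
  then show "out_nulling A (B @\<^sub>c H) E (Dz @\<^sub>c Gz) (V0)"
    unfolding out_nulling_append_cols[OF A B H Dz Gz] using Vst_fsubspace by blast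
qed

lemma S1_sub_S: "S1 \<subseteq> S0"
  by (rule Sst_least) (unfold in_containing_append_rows[OF A C E Gy Gz], use S_in_containing Sst_fsubspace[OF H] in blast)

lemma S1_sub_S2: "S1 \<subseteq> S2"
proof (rule Sst_least)
  show "in_containing A H (C @\<^sub>r E) (Gy @\<^sub>r Gz) (S2)"
    unfolding in_containing_append_rows[OF A C E Gy Gz] using S2_in_containing[of _ 0] Sst_fsubspace[OF append_BH_carrier] by auto
qed

lemma Vm_fsubspace: "fsubspace n (R2)"
  unfolding Vm_def by (intro fsubspace_inter Vst_fsubspace Sst_fsubspace[OF append_BH_carrier])

lemma SM_fsubspace: "fsubspace n (N1)"
  unfolding SM_def by (intro fsubspace_sum Vst_fsubspace Sst_fsubspace[OF H])

lemma Vm_self_bounded: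
  assumes "act B u + act H w \<in> V0" "act Dz u + act Gz w = 0"
  shows "act B u + act H w \<in> R2"
proof -
  have "act A 0 + act B u + act H w \<in> S2"
    by (rule S2_in_containing) (use assms(2) fsubspaceD(2)[OF Sst_fsubspace[OF append_BH_carrier]] in auto)
  then show ?thesis using assms V_sub_V2 by (auto simp: Vm_def)
qed

text \<open>Two inputs that keep a state of V in V* with zero output differ by an input whose effect lies in
  the intersection of V* with [B H] ker [Dz Gz], which is contained in V_m.\<close>

lemma self_bounded:
  assumes V: "out_nulling A B E Dz V" "R2 \<subseteq> V" and x: "x \<in> V"
    and v: "act A x + act B u + act H w \<in> V0" and z: "act E x + act Dz u + act Gz w = 0"
  shows "act A x + act B u + act H w \<in> V"
proof -
  have fV: "fsubspace n V" using V A by (simp add: out_nulling_def)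
  obtain u0 where u0: "act A x + act B u0 \<in> V" "act E x + act Dz u0 = 0" using V(1) x by (auto simp: out_nulling_def)
  have "(act A x + act B u + act H w) - (act A x + act B u0) \<in> V0"
    using fsubspaceD(5)[OF Vst_fsubspace v] u0(1) Vst_greatest[OF V(1)] by blast
  moreover have "(act A x + act B u + act H w) - (act A x + act B u0) = act B (u - u0) + act H w" by (simp add: algebra_simps)
  ultimately have "act B (u - u0) + act H w \<in> V0" by (simp only:)
  moreover have "act Dz (u - u0) + act Gz w = (act E x + act Dz u + act Gz w) - (act E x + act Dz u0)"
    by (simp add: algebra_simps)
  then have "act Dz (u - u0) + act Gz w = 0" by (simp add: z u0)
  ultimately have "act B (u - u0) + act H w \<in> V" using Vm_self_bounded V(2) by blast
  from fsubspaceD(3)[OF fV u0(1) this] show ?thesis by (simp add: algebra_simps)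
qed

context
  fixes s :: nat and Ac Bc Cc K :: "real mat" and Cg :: "complex set"
  assumes Ac: "Ac \<in> carrier_mat s s" and Bc: "Bc \<in> carrier_mat s p" and Cc: "Cc \<in> carrier_mat m s" 
    and K: "K \<in> carrier_mat m p" and G0: "\<And>w :: real fvec. act Gz w + act Dz (act K (act Gy w)) = 0"
    and st: "closed_loop_stable Cg n s A B C Ac Bc Cc K"
begin

abbreviation "decoupled \<equiv> closed_loop_decoupled n s A B H C Gy E Dz Ac Bc Cc K"

lemma decoupledD:
  assumes "decoupled L"
  shows "fsubspace (n + s) L"
    "x \<in> supp n \<Longrightarrow> \<xi> \<in> supp s \<Longrightarrow> stack n x \<xi> \<in> L \<Longrightarrow>
        stack n (act A x + act B (act K (act C x) + act Cc \<xi>)) (act Bc (act C x) + act Ac \<xi>) \<in> L"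
    "x \<in> supp n \<Longrightarrow> \<xi> \<in> supp s \<Longrightarrow> stack n x \<xi> \<in> L \<Longrightarrow> act E x + act Dz (act K (act C x) + act Cc \<xi>) = 0"
    "stack n (act H w + act B (act K (act Gy w))) (act Bc (act Gy w)) \<in> L"
  using assms unfolding closed_loop_decoupled_def by blast+

text \<open>The closed loop supplies the input that keeps the plant part of L output nulling.\<close>

lemma projection_in_Vst:
  assumes L: "decoupled L" and x: "x \<in> supp n" "\<xi> \<in> supp s" "stack n x \<xi> \<in> L"
  shows "x \<in> V0"
proof -
  define V where "V = trunc n ` L"
  have fL: "fsubspace (n + s) L" by (rule decoupledD(1)[OF L])
  have VI: "y \<in> V" if "y \<in> supp n" "stack n y \<eta> \<in> L" for y \<eta>
    using that unfolding V_def by (metis image_eqI trunc_stack)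
  have VE: "\<exists>\<eta>\<in>supp s. stack n y \<eta> \<in> L" "y \<in> supp n" if "y \<in> V" for y
  proof -
    obtain l where l: "l \<in> L" "y = trunc n l" using \<open>y \<in> V\<close> by (auto simp: V_def)
    then show "y \<in> supp n" by simp
    have "shift n l \<in> supp s" using fsubspaceD(1)[OF fL l(1)] by simp
    then show "\<exists>\<eta>\<in>supp s. stack n y \<eta> \<in> L" using l stack_split[of n l] by metis
  qed
  have "fsubspace n V" unfolding fsubspace_def
  proof (intro conjI ballI allI subsetI)
    show "y \<in> supp n" if "y \<in> V" for y by (rule VE(2)[OF that])
    show "0 \<in> V" using VI[of 0 0] fsubspaceD(2)[OF fL] by (simp add: stack_linear)
    show "a + b \<in> V" if ab: "a \<in> V" "b \<in> V" for a b
    proof -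
      obtain \<alpha> \<beta> where "stack n a \<alpha> \<in> L" "stack n b \<beta> \<in> L" using VE(1)[OF ab(1)] VE(1)[OF ab(2)] by blast
      then have "stack n (a + b) (\<alpha> + \<beta>) \<in> L" using fsubspaceD(3)[OF fL] by (metis stack_linear(1))
      then show ?thesis using VI VE(2) ab by simp
    qed
    show "cst c * a \<in> V" if a: "a \<in> V" for a c
    proof -
      obtain \<alpha> where "stack n a \<alpha> \<in> L" using VE(1)[OF a] by blast
      then have "stack n (cst c * a) (cst c * \<alpha>) \<in> L" using fsubspaceD(4)[OF fL] by (metis stack_linear(4))
      then show ?thesis using VI VE(2)[OF a] by simp
    qed
  qed
  moreover have "\<exists>u. act A y + act B u \<in> V \<and> act E y + act Dz u = 0" if y: "y \<in> V" for y
  proof -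
    obtain \<eta> where \<eta>: "\<eta> \<in> supp s" "stack n y \<eta> \<in> L" using VE(1)[OF y] by blast
    show ?thesis
      using decoupledD(2,3)[OF L VE(2)[OF y] \<eta>] VI A B by (intro exI[of _ "act K (act C y) + act Cc \<eta>"]) auto
  qed
  ultimately have "out_nulling A B E Dz V" using A by (auto simp: out_nulling_def)
  then show ?thesis using Vst_greatest VI[OF x(1,3)] by blast
qed

text \<open>The plant states x with (x, 0) in L form an input containing subspace: if C x + Gy w = 0, then
  the compensator receives nothing and stays at zero.\<close>

lemma Sst_in_section:
  assumes L: "decoupled L" and x: "x \<in> S0"
  shows "stack n x 0 \<in> L"
proof -
  define S where "S = {x \<in> supp n. stack n x 0 \<in> L}"
  have fL: "fsubspace (n + s) L" by (rule decoupledD(1)[OF L])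
  have "fsubspace n S" unfolding fsubspace_def
  proof (intro conjI ballI allI)
    show "S \<subseteq> supp n" by (auto simp: S_def)
    show "0 \<in> S" using fsubspaceD(2)[OF fL] by (simp add: S_def stack_linear)
    show "a + b \<in> S" if "a \<in> S" "b \<in> S" for a b
      using that fsubspaceD(3)[OF fL, of "stack n a 0" "stack n b 0"] by (simp add: S_def stack_linear)
    show "cst c * a \<in> S" if "a \<in> S" for a c
      using that fsubspaceD(4)[OF fL, of "stack n a 0" c] by (simp add: S_def stack_linear)
  qed
  moreover have "act A y + act H w \<in> S" if y: "y \<in> S" and z: "act C y + act Gy w = 0" for y w
  proof -
    have y': "y \<in> supp n" "stack n y 0 \<in> L" using y by (auto simp: S_def)
    have "stack n (act A y + act B (act K (act C y))) (act Bc (act C y)) 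
        + stack n (act H w + act B (act K (act Gy w))) (act Bc (act Gy w)) \<in> L"
      using fsubspaceD(3)[OF fL decoupledD(2)[OF L y'(1) _ y'(2)] decoupledD(4)[OF L, of w]] by simp
    moreover have "act C y = - act Gy w" using z by (simp add: eq_neg_iff_add_eq_0)
    ultimately have "stack n (act A y + act H w) 0 \<in> L" by (simp add: stack_linear add_ac)
    then show ?thesis using A H by (simp add: S_def)
  qed
  ultimately have "in_containing A H C Gy S" using A by (auto simp: in_containing_def)
  then have "S0 \<subseteq> S" by (rule Sst_least)
  then show ?thesis using x by (auto simp: S_def)
qed

lemma Sst_sub_Vst:
  assumes L: "decoupled L"
  shows "S0 \<subseteq> V0"
proof
  fix x assume x: "x \<in> S0"
  show "x \<in> V0"
    by (rule projection_in_Vst[OF L fsubspaceD(1)[OF Sst_fsubspace[OF H] x] _ Sst_in_section[OF L x]]) simp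
qed

lemma feedthrough_maps_Sst_to_Vst:
  assumes L: "decoupled L" and x: "x \<in> S0"
  shows "act A x + act B (act K (act C x)) + (act H w + act B (act K (act Gy w))) \<in> V0"
    "act E x + act Dz (act K (act C x)) + (act Gz w + act Dz (act K (act Gy w))) = 0"
proof -
  have fL: "fsubspace (n + s) L" by (rule decoupledD(1)[OF L])
  have x': "x \<in> supp n" "stack n x 0 \<in> L" 
    using Sst_in_section[OF L x] fsubspaceD(1)[OF Sst_fsubspace[OF H] x] by auto
  have "stack n (act A x + act B (act K (act C x)) + (act H w + act B (act K (act Gy w)))) 
      (act Bc (act C x) + act Bc (act Gy w)) \<in> L"
    using fsubspaceD(3)[OF fL decoupledD(2)[OF L x'(1) _ x'(2)] decoupledD(4)[OF L, of w]] by (simp add: stack_linear)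
  then show "act A x + act B (act K (act C x)) + (act H w + act B (act K (act Gy w))) \<in> V0"
    by (rule projection_in_Vst[OF L, rotated 2]) (use A B H Bc in auto)
  show "act E x + act Dz (act K (act C x)) + (act Gz w + act Dz (act K (act Gy w))) = 0"
    using decoupledD(3)[OF L x'(1) _ x'(2)] G0[of w] by simp
qed

lemma disturbance_in_Vm:
  assumes L: "decoupled L"
  shows "act H w + act B (act K (act Gy w)) \<in> R2"
proof -
  have "act B (act K (act Gy w)) + act H w \<in> R2"
    by (rule Vm_self_bounded) 
      (use feedthrough_maps_Sst_to_Vst(1)[OF L, of 0 w] G0[of w] fsubspaceD(2)[OF Sst_fsubspace[OF H]] in \<open>simp_all add: add.commute\<close>)
  then show ?thesis by (simp add: add.commute)
qed

text \<open>For v in V1 choose w with A v + H w \<in> V1 and zero outputs.  Then the closed loop sends (v, 0) to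
  (A v + H w, 0) minus the effect of the disturbance w, so V1 x 0 is invariant modulo L, and the
  output of (v, 0) is minus the feedthrough of w, which is zero.\<close>

lemma decoupled_extend:
  assumes L: "decoupled L"
  shows "decoupled (L + (\<lambda>v. stack n v 0) ` V1)" (is "decoupled (L + ?J)")
proof -
  let ?V = "V1"
  have fL: "fsubspace (n + s) L" by (rule decoupledD(1)[OF L])
  have fV: "fsubspace n ?V" by (rule Vst_fsubspace)
  have fJ: "fsubspace (n + s) ?J" unfolding fsubspace_def
  proof (intro conjI ballI allI)
    show "?J \<subseteq> supp (n + s)" by auto
    show "0 \<in> ?J" using fsubspaceD(2)[OF fV] by (auto simp: stack_linear intro!: image_eqI[of _ _ 0])
    show "a + b \<in> ?J" if "a \<in> ?J" "b \<in> ?J" for a b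
      using that fsubspaceD(3)[OF fV] by (auto simp: stack_linear)
    show "cst c * a \<in> ?J" if "a \<in> ?J" for a c
      using that fsubspaceD(4)[OF fV] by (auto simp: stack_linear)
  qed
  have sub: "L \<subseteq> L + ?J" by (rule set_plus_superset[OF fL fJ])
  have "stack n (act A x + act B (act K (act C x) + act Cc \<xi>)) (act Bc (act C x) + act Ac \<xi>) \<in> L + ?J \<and> 
      act E x + act Dz (act K (act C x) + act Cc \<xi>) = 0" 
    if x: "x \<in> supp n" "\<xi> \<in> supp s" "stack n x \<xi> \<in> L + ?J" for x \<xi>
  proof -
    obtain l v where lv: "stack n x \<xi> = l + stack n v 0" "l \<in> L" "v \<in> ?V"
      using x(3) by (auto elim!: set_plus_elim)
    have v: "v \<in> supp n" by (rule fsubspaceD(1)[OF fV lv(3)])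
    have "l = stack n x \<xi> - stack n v 0" using lv(1) by simp
    then have l: "stack n (x - v) \<xi> \<in> L" using lv(2) by (simp add: stack_linear)
    obtain w where w: "act A v + act H w \<in> ?V" "act C v + act Gy w = 0" "act E v + act Gz w = 0"
      using V1_out_nulling[OF lv(3)] by blast
    have Cv: "act C v = - act Gy w" using w(2) by (simp add: eq_neg_iff_add_eq_0)
    have Ev: "act E v = - act Gz w" using w(3) by (simp add: eq_neg_iff_add_eq_0)
    define h where "h = stack n (act H w + act B (act K (act Gy w))) (act Bc (act Gy w))"
    have h: "h \<in> L" unfolding h_def by (rule decoupledD(4)[OF L])
    have xv: "x - v \<in> supp n" using x v by simp
    define l' where "l' = stack n (act A (x - v) + act B (act K (act C (x - v)) + act Cc \<xi>)) (act Bc (act C (x - v)) + act Ac \<xi>)"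
    have l': "l' \<in> L" unfolding l'_def by (rule decoupledD(2)[OF L xv x(2) l])
    have "stack n (act A x + act B (act K (act C x) + act Cc \<xi>)) (act Bc (act C x) + act Ac \<xi>)
        = (l' - h) + stack n (act A v + act H w) 0"
      by (simp add: l'_def h_def stack_linear Cv algebra_simps)
    moreover have "(l' - h) + stack n (act A v + act H w) 0 \<in> L + ?J"
      using fsubspaceD(5)[OF fL l' h] w(1) by (intro set_plus_intro) auto
    moreover have "act E x + act Dz (act K (act C x) + act Cc \<xi>) = 0"
    proof -
    have "act E (x - v) + act Dz (act K (act C (x - v)) + act Cc \<xi>) = 0"
      by (rule decoupledD(3)[OF L xv x(2) l])
    moreover have "act E x + act Dz (act K (act C x) + act Cc \<xi>) = 
        (act E (x - v) + act Dz (act K (act C (x - v)) + act Cc \<xi>)) - (act Gz w + act Dz (act K (act Gy w)))"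
      by (simp add: Cv Ev algebra_simps)
    ultimately show ?thesis by (simp only: G0 diff_self)
    qed
    ultimately show ?thesis by simp
  qed
  then show ?thesis
    unfolding closed_loop_decoupled_def using fsubspace_sum[OF fL fJ] sub decoupledD(4)[OF L] by blast
qed

text \<open>S1 lies in S* \<subseteq> V* and in the least input containing subspace of the system with input [B H], hence
  in V_m.  So S1 can be dropped from V_m + S_M.\<close>

lemma S1_sub_Vm:
  assumes L: "decoupled L"
  shows "S1 \<subseteq> R2"
  using S1_sub_S Sst_sub_Vst[OF L] V_sub_V2 S1_sub_S2 by (auto simp: Vm_def)

lemma VM_eq:
  assumes L: "decoupled L"
  shows "VM = R2 + V1"
proof
  show "R2 + N1 \<subseteq> R2 + V1"
  proof
    fix x assume "x \<in> R2 + N1"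
    then obtain a b c where x: "x = a + (b + c)" "a \<in> R2" "b \<in> V1" "c \<in> S1"
      unfolding SM_def by (auto elim!: set_plus_elim)
    have "a + c \<in> R2" using fsubspaceD(3)[OF Vm_fsubspace x(2)] S1_sub_Vm[OF L] x(4) by blast
    from set_plus_intro[OF this x(3)] show "x \<in> R2 + V1" by (simp add: x(1) add_ac)
  qed
  have "V1 \<subseteq> N1" unfolding SM_def by (rule set_plus_superset[OF Vst_fsubspace Sst_fsubspace[OF H]])
  then show "R2 + V1 \<subseteq> R2 + N1" by (intro set_plus_mono2) auto
qed

lemma VM_out_nulling:
  assumes L: "decoupled L"
  shows "out_nulling A B E Dz (VM)"
proof -
  have fVm: "fsubspace n R2" by (rule Vm_fsubspace)
  have fV: "fsubspace n (R2 + V1)" by (intro fsubspace_sum Vm_fsubspace Vst_fsubspace)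
  have d: "act H w + act B (act K (act Gy w)) \<in> R2" for w by (rule disturbance_in_Vm[OF L])
  have "\<exists>u. act A x + act B u \<in> R2 + V1 \<and> act E x + act Dz u = 0" if xV: "x \<in> R2 + V1" for x
  proof -
    obtain a b where x: "x = a + b" "a \<in> R2" "b \<in> V1" using xV by (auto elim!: set_plus_elim)
    obtain u w where u: "act A a + act B u + act H w \<in> V2" 
      "act E a + act Dz u + act Gz w = 0" using V2_out_nulling[of a] x(2) unfolding Vm_def by blast
    then have a: "act A a + act B u + act H w \<in> R2" using S2_in_containing x(2) by (auto simp: Vm_def)
    obtain w' where w': "act A b + act H w' \<in> V1" "act E b + act Gz w' = 0" using V1_out_nulling[OF x(3)] by blast
    let ?u = "u - act K (act Gy w) - act K (act Gy w')"
    have "act A x + act B ?u = ((act A a + act B u + act H w) - (act H w + act B (act K (act Gy w)))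
       - (act H w' + act B (act K (act Gy w')))) + (act A b + act H w')"
      by (simp add: x(1) algebra_simps)
    also have "\<dots> \<in> R2 + V1"
      by (intro set_plus_intro fsubspaceD(5)[OF fVm] a d w')
    finally have "act A x + act B ?u \<in> R2 + V1" .
    moreover have "act E x + act Dz ?u = (act E a + act Dz u + act Gz w) - (act Gz w + act Dz (act K (act Gy w)))
       - (act Gz w' + act Dz (act K (act Gy w'))) + (act E b + act Gz w')"
      by (simp add: x(1) algebra_simps)
    then have "act E x + act Dz ?u = 0" by (simp add: u w' G0)
    ultimately show ?thesis by blast
  qed
  then show ?thesis unfolding VM_eq[OF L] using fV A by (simp add: out_nulling_def)
qed

lemma decoupled_restrict:
  assumes L: "decoupled L"
  shows "decoupled {l \<in> L. trunc n l \<in> VM}" (is "decoupled ?L")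
proof -
  have fL: "fsubspace (n + s) L" by (rule decoupledD(1)[OF L])
  have fV: "fsubspace n VM" by (intro fsubspace_sum Vm_fsubspace SM_fsubspace)
  have sub: "R2 \<subseteq> VM" by (rule set_plus_superset[OF Vm_fsubspace SM_fsubspace])
  have tr: "trunc n (a + b) = trunc n a + trunc n b" "trunc n (cst c * a) = cst c * trunc n a" "trunc n 0 = (0 :: real fvec)" 
    for a b :: "real fvec" and c by (auto simp: trunc_def fun_eq_iff)
  have "fsubspace (n + s) ?L" unfolding fsubspace_def using fsubspaceD[OF fL] fsubspaceD[OF fV] by (auto simp: tr)
  moreover have "act A x + act B (act K (act C x) + act Cc \<xi>) \<in> VM"
    if x: "x \<in> supp n" "\<xi> \<in> supp s" "stack n x \<xi> \<in> L" "x \<in> VM" for x \<xi>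
  proof -
    let ?u = "act K (act C x) + act Cc \<xi>"
    have 1: "act A x + act B ?u \<in> V0"
      by (rule projection_in_Vst[OF L _ _ decoupledD(2)[OF L x(1-3)]]) (use A B Ac Bc in auto)
    have "act A x + act B ?u + act H 0 \<in> VM"
      by (rule self_bounded[OF VM_out_nulling[OF L] sub x(4)]) (use 1 decoupledD(3)[OF L x(1-3)] in simp_all)
    then show ?thesis by simp
  qed
  moreover have "act H w + act B (act K (act Gy w)) \<in> VM" for w
    using disturbance_in_Vm[OF L] sub by blast
  ultimately show ?thesis
    unfolding closed_loop_decoupled_def using decoupledD(2-4)[OF L] A B H by auto
qed

text \<open>A vector of V1 lies in L and is solved there by the resolvent of the closed loop.  A vector of
  V_m is first solved in V_m with the inputs u and w, by Sst_resolvent and Vst_resolvent; then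
  H w, which is in L up to B K Gy w, is solved in L as well.\<close>

lemma VM_resolvent:
  assumes L0: "decoupled L0" and k: "k \<notin> Cg" and v: "v \<in> cx (VM)"
  shows "\<exists>x\<in>cx (VM). \<exists>u. v = cst k * x - act A x - act B u \<and> act E x + act Dz u = 0"
proof -
  define L1 where "L1 = L0 + (\<lambda>v. stack n v 0) ` V1"
  have L1: "decoupled L1" unfolding L1_def by (rule decoupled_extend[OF L0])
  define L where "L = {l \<in> L1. trunc n l \<in> VM}"
  have L: "decoupled L" unfolding L_def by (rule decoupled_restrict[OF L1])
  have fL: "fsubspace (n + s) L" by (rule decoupledD(1)[OF L])
  have fV: "fsubspace n VM" by (intro fsubspace_sum Vm_fsubspace SM_fsubspace)
  have V1L: "stack n b 0 \<in> L" if b: "b \<in> V1" for b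
  proof -
    have "0 + stack n b 0 \<in> L1" unfolding L1_def
      by (rule set_plus_intro) (use fsubspaceD(2)[OF decoupledD(1)[OF L0]] b in auto)
    moreover have "0 + b \<in> R2 + V1" by (rule set_plus_intro[OF fsubspaceD(2)[OF Vm_fsubspace] b])
    moreover have "b \<in> supp n" by (rule fsubspaceD(1)[OF Vst_fsubspace b])
    ultimately show ?thesis unfolding L_def VM_eq[OF L1] by simp
  qed
  \<comment> \<open>The resolvent of the closed loop solves on L, whose plant states lie in V_m + S_M and whose
    output is zero; this is applied to the part of v in V1 and to the disturbance of its part in V_m.\<close>
  have solve: "\<exists>x\<in>cx VM. \<exists>\<xi>. l = stack n (cst k * x - act A x - act B (act K (act C x) + act Cc \<xi>)) (cst k * \<xi> - act Bc (act C x) - act Ac \<xi>) \<and>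
      act E x + act Dz (act K (act C x) + act Cc \<xi>) = 0"
    if "l \<in> cx L" for l
  proof -
    obtain x \<xi> where x: "x \<in> supp n" "\<xi> \<in> supp s" "stack n x \<xi> \<in> cx L"
      "l = stack n (cst k * x - act A x - act B (act K (act C x) + act Cc \<xi>)) (cst k * \<xi> - act Bc (act C x) - act Ac \<xi>)"
      by (rule closed_loop_resolvent[OF A B H C Gy E Dz Gz Ac Bc Cc K L st k \<open>l \<in> cx L\<close>])
    have r: "stack n (fRe x) (fRe \<xi>) \<in> L" "stack n (fIm x) (fIm \<xi>) \<in> L" using x(3) by (auto simp: cx_def)
    have "x \<in> cx VM" using r x(1) by (auto simp: cx_def L_def)
    moreover have "act E x + act Dz (act K (act C x) + act Cc \<xi>) = 0"
      by (rule complex_fvec_eqI) (use r x(1,2) decoupledD(3)[OF L, of "fRe x" "fRe \<xi>"] 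
          decoupledD(3)[OF L, of "fIm x" "fIm \<xi>"] in simp_all)
    ultimately show ?thesis using x(4) by blast
  qed
  \<comment> \<open>V_m + S_M = V_m + V1, so that v is a state of V_m plus one that L already contains.\<close>
  obtain a b where ab: "v = a + b" "a \<in> cx R2" "b \<in> cx V1"
    using v unfolding VM_eq[OF L1] cx_sum by (auto elim!: set_plus_elim)
  have "stack n b 0 \<in> cx L" using ab(3) V1L by (simp add: cx_def)
  then obtain x1 \<xi>1 where x1: "x1 \<in> cx VM" 
    "stack n b 0 = stack n (cst k * x1 - act A x1 - act B (act K (act C x1) + act Cc \<xi>1)) (cst k * \<xi>1 - act Bc (act C x1) - act Ac \<xi>1)"
    "act E x1 + act Dz (act K (act C x1) + act Cc \<xi>1) = 0" using solve by blast
  define u1 where "u1 = act K (act C x1) + act Cc \<xi>1"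
  have x1n: "x1 \<in> supp n" by (rule cxD(1)[OF fV x1(1)])
  have bn: "b \<in> supp n" by (rule cxD(1)[OF Vst_fsubspace ab(3)])
  have b: "b = cst k * x1 - act A x1 - act B u1"
    using x1(2) x1n bn A B by (subst (asm) stack_eq_iff) (auto simp: u1_def)
  have a2: "a \<in> cx (S2)" "a \<in> cx (V2)" 
    using ab(2) by (auto simp: cx_def Vm_def)
  obtain x2 u' where x2: "x2 \<in> cx (S2)" "a = cst k * x2 - act A x2 - act (B @\<^sub>c H) u'" 
    "act E x2 + act (Dz @\<^sub>c Gz) u' = 0"
    using Sst_resolvent[OF A append_BH_carrier a2(1)] by blast
  have x2n: "x2 \<in> supp n" by (rule cxD(1)[OF Sst_fsubspace[OF append_BH_carrier] x2(1)])
  have "x2 \<in> cx (V2)"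
    by (rule Vst_resolvent[OF A x2n _ x2(3)]) (use a2(2) x2(2) in simp)
  then have x2m: "x2 \<in> cx R2" using x2(1) by (auto simp: cx_def Vm_def)
  have "R2 \<subseteq> VM" by (rule set_plus_superset[OF Vm_fsubspace SM_fsubspace])
  then have x2V: "x2 \<in> cx VM" using x2m by (auto simp: cx_def)
  define w where "w = shift m u'"
  have a: "a = cst k * x2 - act A x2 - act B u' - act H w"
    using x2(2) by (simp add: act_append_cols_shift[OF B H] w_def algebra_simps)
  have Ex2: "act E x2 + act Dz u' + act Gz w = 0"
    using x2(3) by (simp add: act_append_cols_shift[OF Dz Gz] w_def algebra_simps)
  have "stack n (act H w + act B (act K (act Gy w))) (act Bc (act Gy w)) \<in> cx L"
    using decoupledD(4)[OF L] by (simp add: cx_def)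
  then obtain x3 \<xi>3 where x3: "x3 \<in> cx VM" 
    "stack n (act H w + act B (act K (act Gy w))) (act Bc (act Gy w)) = 
      stack n (cst k * x3 - act A x3 - act B (act K (act C x3) + act Cc \<xi>3)) (cst k * \<xi>3 - act Bc (act C x3) - act Ac \<xi>3)"
    "act E x3 + act Dz (act K (act C x3) + act Cc \<xi>3) = 0" using solve by blast
  define u3 where "u3 = act K (act C x3) + act Cc \<xi>3"
  have x3n: "x3 \<in> supp n" by (rule cxD(1)[OF fV x3(1)])
  have h: "act H w + act B (act K (act Gy w)) = cst k * x3 - act A x3 - act B u3"
    using x3(2) x3n A B H by (subst (asm) stack_eq_iff) (auto simp: u3_def)
  have G0c: "act Gz w + act Dz (act K (act Gy w)) = 0"
    by (rule complex_fvec_eqI) (use G0[of "fRe w"] G0[of "fIm w"] in simp_all)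
  let ?x = "x1 + x2 - x3" and ?u = "u1 + u' - u3 - act K (act Gy w)"
  have "act H w = cst k * x3 - act A x3 - act B u3 - act B (act K (act Gy w))"
    using h by (simp add: eq_diff_eq)
  then have "v = cst k * ?x - act A ?x - act B ?u"
    unfolding ab(1) a b by (simp add: algebra_simps)
  moreover have "act E ?x + act Dz ?u = (act E x1 + act Dz u1) + (act E x2 + act Dz u' + act Gz w) 
      - (act E x3 + act Dz u3) - (act Gz w + act Dz (act K (act Gy w)))"
    by (simp add: algebra_simps)
  then have "act E ?x + act Dz ?u = 0"
    using x1(3)[folded u1_def] x3(3)[folded u3_def] Ex2 G0c by (simp only: diff_self add_0_left)
  moreover have "?x \<in> cx VM" using x1(1) x2V x3(1) cxD(3,5)[OF fV] by blast
  ultimately show ?thesis by blast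
qed

lemma SM_in_section:
  assumes L0: "decoupled L0" and x: "x \<in> N1"
  shows "stack n x 0 \<in> L0 + (\<lambda>v. stack n v 0) ` V1"
proof -
  obtain v s where vs: "x = v + s" "v \<in> V1" "s \<in> S1"
    using x unfolding SM_def by (rule set_plus_elim)
  have "stack n s 0 \<in> L0" using Sst_in_section[OF L0] S1_sub_S vs(3) by blast
  from set_plus_intro[OF this imageI[OF vs(2), of "\<lambda>v. stack n v 0"]]
  show ?thesis by (simp add: vs(1) stack_linear add.commute)
qed

text \<open>\<lambda> minus the closed loop maps (x, 0) to the sum of a vector of S_M x 0 and the effect of the
  disturbance w, both in L.  As L is invariant and \<lambda> is not an eigenvalue, (x, 0) is in L,
  and z = E x + Gz w is zero too.  Hence the hypothesis holds for the system with both outputs, where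
  Sst_resolvent and Vst_resolvent apply.\<close>

lemma SM_resolvent:
  assumes L0: "decoupled L0" and k: "k \<notin> Cg" and x: "x \<in> supp n"
    and v: "cst k * x - act A x - act H w \<in> cx (N1)" and z: "act C x + act Gy w = 0"
  shows "x \<in> cx (N1)"
proof -
  define L where "L = L0 + (\<lambda>v. stack n v 0) ` V1"
  have L: "decoupled L" unfolding L_def by (rule decoupled_extend[OF L0])
  have fL: "fsubspace (n + s) L" by (rule decoupledD(1)[OF L])
  define \<sigma> where "\<sigma> = cst k * x - act A x - act H w"
  have sn: "\<sigma> \<in> supp n" by (rule cxD(1)[OF SM_fsubspace]) (use v \<sigma>_def in simp)
  have "stack n \<sigma> 0 \<in> cx L" using v SM_in_section[OF L0] by (simp add: cx_def L_def \<sigma>_def)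
  moreover have "stack n (act H w + act B (act K (act Gy w))) (act Bc (act Gy w)) \<in> cx L"
    using decoupledD(4)[OF L] by (simp add: cx_def)
  ultimately have l: "stack n \<sigma> 0 + stack n (act H w + act B (act K (act Gy w))) (act Bc (act Gy w)) \<in> cx L"
    by (rule cxD(3)[OF fL])
  obtain x' \<xi>' where x': "x' \<in> supp n" "\<xi>' \<in> supp s" "stack n x' \<xi>' \<in> cx L"
    "stack n \<sigma> 0 + stack n (act H w + act B (act K (act Gy w))) (act Bc (act Gy w)) = 
      stack n (cst k * x' - act A x' - act B (act K (act C x') + act Cc \<xi>')) (cst k * \<xi>' - act Bc (act C x') - act Ac \<xi>')"
    by (rule closed_loop_resolvent[OF A B H C Gy E Dz Gz Ac Bc Cc K L st k l])
  have e: "\<sigma> + (act H w + act B (act K (act Gy w))) = cst k * x' - act A x' - act B (act K (act C x') + act Cc \<xi>')"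
    "act Bc (act Gy w) = cst k * \<xi>' - act Bc (act C x') - act Ac \<xi>'"
    using x'(4) x'(1) sn A B H unfolding stack_linear(1) by (subst (asm) stack_eq_iff; simp)+
  have Cx: "act Gy w = - act C x" using z by (simp add: eq_neg_iff_add_eq_0 add.commute)
  have "x - x' = 0 \<and> - \<xi>' = 0"
  proof (rule st[unfolded closed_loop_stable_def, rule_format, OF k])
    show "act A (x - x') + act B (act K (act C (x - x')) + act Cc (- \<xi>')) = cst k * (x - x')"
      using e(1) unfolding \<sigma>_def Cx by (simp add: algebra_simps)
    show "act Bc (act C (x - x')) + act Ac (- \<xi>') = cst k * - \<xi>'"
      using e(2) unfolding Cx by (simp add: algebra_simps)
  qed (use x x' in auto)
  then have "stack n x 0 \<in> cx L" using x'(3) by simp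
  then have r: "stack n (fRe x) 0 \<in> L" "stack n (fIm x) 0 \<in> L" by (auto simp: cx_def)
  have "act E x + act Dz (act K (act C x)) = 0"
    by (rule complex_fvec_eqI) (use r x decoupledD(3)[OF L, of "fRe x" 0] decoupledD(3)[OF L, of "fIm x" 0] in simp_all)
  moreover have "act Gz w + act Dz (act K (act Gy w)) = 0"
    by (rule complex_fvec_eqI) (use G0[of "fRe w"] G0[of "fIm w"] in simp_all)
  ultimately have Ez: "act E x + act Gz w = 0" unfolding Cx by (simp add: algebra_simps)
  have z1: "act (C @\<^sub>r E) x + act (Gy @\<^sub>r Gz) w = 0"
    using z Ez append_rows_zero_iff[OF C E Gy Gz] by blast
  obtain a b where ab: "\<sigma> = a + b" "a \<in> cx V1" "b \<in> cx S1"
    using v unfolding SM_def cx_sum \<sigma>_def[symmetric] by (auto elim!: set_plus_elim)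
  obtain y u where y: "y \<in> cx S1" "b = cst k * y - act A y - act H u" "act (C @\<^sub>r E) y + act (Gy @\<^sub>r Gz) u = 0"
    using Sst_resolvent[OF A H ab(3)] by blast
  have yn: "y \<in> supp n" by (rule cxD(1)[OF Sst_fsubspace[OF H] y(1)])
  have "x - y \<in> cx V1"
  proof (rule Vst_resolvent[OF A])
    have "a = \<sigma> - b" using ab(1) by simp
    then have "a = cst k * (x - y) - act A (x - y) - act H (w - u)"
      unfolding y(2) \<sigma>_def by (simp add: algebra_simps)
    with ab(2) show "cst k * (x - y) - act A (x - y) - act H (w - u) \<in> cx V1" by (simp only:)
    have "act (C @\<^sub>r E) (x - y) + act (Gy @\<^sub>r Gz) (w - u) = 
      (act (C @\<^sub>r E) x + act (Gy @\<^sub>r Gz) w) - (act (C @\<^sub>r E) y + act (Gy @\<^sub>r Gz) u)" by (simp add: algebra_simps)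
    then show "act (C @\<^sub>r E) (x - y) + act (Gy @\<^sub>r Gz) (w - u) = 0" by (simp only: z1 y(3) diff_self)
  qed (use x yn in simp)
  from set_plus_intro[OF this y(1)] show ?thesis unfolding SM_def cx_sum by simp
qed

lemma SM_in_containing:
  assumes L0: "decoupled L0"
  shows "in_containing A H C Gy (N1)"
proof -
  have "act A x + act H w \<in> N1" if x: "x \<in> N1" and z: "act C x + act Gy w = 0" for x w
  proof -
    have xn: "x \<in> supp n" by (rule fsubspaceD(1)[OF SM_fsubspace x])
    have "act E x + act Dz (act K (act C x)) = 0"
      using decoupledD(3)[OF decoupled_extend[OF L0] xn _ SM_in_section[OF L0 x]] by simp
    moreover have Cx: "act Gy w = - act C x" using z by (simp add: eq_neg_iff_add_eq_0 add.commute)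
    ultimately have Ez: "act E x + act Gz w = 0" using G0[of w] unfolding Cx by (simp add: algebra_simps)
    obtain a b where ab: "x = a + b" "a \<in> V1" "b \<in> S1"
      using x unfolding SM_def by (rule set_plus_elim)
    obtain w' where w': "act A a + act H w' \<in> V1" "act C a + act Gy w' = 0" "act E a + act Gz w' = 0"
      using V1_out_nulling[OF ab(2)] by blast
    have "act C b + act Gy (w - w') = (act C x + act Gy w) - (act C a + act Gy w')"
      "act E b + act Gz (w - w') = (act E x + act Gz w) - (act E a + act Gz w')"
      by (simp_all add: ab(1) algebra_simps)
    then have "act A b + act H (w - w') \<in> S1"
      by (intro S1_in_containing[OF ab(3)]) (simp_all only: z Ez w' diff_self)
    from set_plus_intro[OF w'(1) this] show ?thesis unfolding SM_def by (simp add: ab(1) algebra_simps)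
  qed
  then show ?thesis using SM_fsubspace A by (auto simp: in_containing_def)
qed

end

end

section \<open>A decoupling compensator\<close>

context
  fixes n m q p r :: nat and A B H C Gy E Dz Gz :: "real mat"
    and K F0 F2 G0 G2 PV PS :: "real mat" and c :: real
  assumes A: "A \<in> carrier_mat n n" and B: "B \<in> carrier_mat n m" and H: "H \<in> carrier_mat n q"
    and C: "C \<in> carrier_mat p n" and Gy: "Gy \<in> carrier_mat p q"
    and E: "E \<in> carrier_mat r n" and Dz: "Dz \<in> carrier_mat r m" and Gz: "Gz \<in> carrier_mat r q"
    and K: "K \<in> carrier_mat m p" and F0: "F0 \<in> carrier_mat m n" and F2: "F2 \<in> carrier_mat m n"
    and G0: "G0 \<in> carrier_mat n p" and G2: "G2 \<in> carrier_mat n p"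
    and PV: "PV \<in> carrier_mat n n" and PS: "PS \<in> carrier_mat n n"
begin

text \<open>PS and PV will be projections onto S and V, and comp_R is the projection along S.  With the residual
  \<epsilon> = y - C \<xi> and \<rho> = \<epsilon> - C R \<eta>, the compensator is
    u = F2 (\<xi> + R \<eta> - \<zeta>) + F0 \<zeta> + K \<rho>,
    \<xi>' = A \<xi> + B u - G2 \<epsilon>,
    \<eta>' = R (A + G0 C) R \<eta> + R (G2 - G0) \<epsilon> + c PS \<eta>,
    \<zeta>' = (A + B F0) PV \<zeta> + PV \<theta> + c (\<zeta> - PV \<zeta>),
  where \<theta> is what has to be added to (A + B F0) \<zeta> to keep \<zeta> = \<xi> + R \<eta>.  The terms with c give
  the redundant directions, the kernel of R for \<eta> and of PV for \<zeta>, the stable eigenvalue c.\<close>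

definition "comp_R = 1\<^sub>m n - PS"
definition "comp_T = F2 - K * C"
definition "comp_\<Theta> = B * K - G2 + comp_R * (G2 - G0)"
definition "comp_A = four_block_mat (A + B * comp_T + G2 * C) ((B * comp_T * comp_R) @\<^sub>c (B * (F0 - F2)))
   ((- (comp_R * (G2 - G0) * C)) @\<^sub>r (- (PV * comp_\<Theta> * C)))
   (four_block_mat (comp_R * (A + G0 * C) * comp_R + c \<cdot>\<^sub>m PS) (0\<^sub>m n n)
     (PV * (comp_R * (A + G0 * C) * comp_R - A * comp_R - B * K * C * comp_R)) ((A + B * F0) * PV + c \<cdot>\<^sub>m (1\<^sub>m n - PV)))"
definition "comp_B = (B * K - G2) @\<^sub>r ((comp_R * (G2 - G0)) @\<^sub>r (PV * comp_\<Theta>))"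
definition "comp_C = comp_T @\<^sub>c ((comp_T * comp_R) @\<^sub>c (F0 - F2))"

lemma dims: "dim_row A = n" "dim_col A = n" "dim_row B = n" "dim_col B = m" "dim_row C = p" "dim_col C = n"
  "dim_row H = n" "dim_col H = q" "dim_row E = r" "dim_col E = n"
  "dim_row K = m" "dim_col K = p" "dim_row F0 = m" "dim_col F0 = n" "dim_row F2 = m" "dim_col F2 = n"
  "dim_row G0 = n" "dim_col G0 = p" "dim_row G2 = n" "dim_col G2 = p"
  "dim_row PV = n" "dim_col PV = n" "dim_row PS = n" "dim_col PS = n"
  by (rule carrier_matD[OF A] carrier_matD[OF B] carrier_matD[OF C] carrier_matD[OF H] carrier_matD[OF E]
    carrier_matD[OF K] carrier_matD[OF F0] carrier_matD[OF F2] carrier_matD[OF G0] carrier_matD[OF G2]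
    carrier_matD[OF PV] carrier_matD[OF PS])+

lemma comp_dims: "dim_row comp_R = n" "dim_col comp_R = n" "dim_row comp_T = m" "dim_col comp_T = n"
   "dim_row comp_\<Theta> = n" "dim_col comp_\<Theta> = p"
  by (simp_all add: comp_R_def comp_T_def comp_\<Theta>_def dims)

lemma comp_parts: "comp_R \<in> carrier_mat n n" "comp_T \<in> carrier_mat m n" "comp_\<Theta> \<in> carrier_mat n p"
  by (rule carrier_matI; simp add: comp_dims)+

lemma comp_pieces: "B * K - G2 \<in> carrier_mat n p" "comp_R * (G2 - G0) \<in> carrier_mat n p"
  "PV * comp_\<Theta> \<in> carrier_mat n p" "comp_T * comp_R \<in> carrier_mat m n" "F0 - F2 \<in> carrier_mat m n"
  by (rule minus_carrier_mat[OF G2], rule mult_carrier_mat[OF comp_parts(1) minus_carrier_mat[OF G0]],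
    rule mult_carrier_mat[OF PV comp_parts(3)], rule mult_carrier_mat[OF comp_parts(2,1)], rule minus_carrier_mat[OF F2])

lemma comp_carrier: "comp_A \<in> carrier_mat (n + (n + n)) (n + (n + n))" "comp_B \<in> carrier_mat (n + (n + n)) p"
  "comp_C \<in> carrier_mat m (n + (n + n))"
proof -
  have c11: "A + B * comp_T + G2 * C \<in> carrier_mat n n"
    by (rule carrier_matI; simp add: dims comp_dims)
  have cN: "comp_R * (A + G0 * C) * comp_R + c \<cdot>\<^sub>m PS \<in> carrier_mat n n"
    by (rule carrier_matI; simp add: dims comp_dims)
  have cM: "(A + B * F0) * PV + c \<cdot>\<^sub>m (1\<^sub>m n - PV) \<in> carrier_mat n n"
    by (rule carrier_matI; simp add: dims comp_dims)
  show "comp_A \<in> carrier_mat (n + (n + n)) (n + (n + n))"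
    unfolding comp_A_def by (rule four_block_carrier_mat[OF c11 four_block_carrier_mat[OF cN cM]])
  show "comp_B \<in> carrier_mat (n + (n + n)) p"
    unfolding comp_B_def by (intro carrier_append_rows comp_pieces)
  show "comp_C \<in> carrier_mat m (n + (n + n))"
    unfolding comp_C_def by (intro carrier_append_cols comp_parts(2) comp_pieces)
qed

lemma act_comp_R: "x \<in> supp n \<Longrightarrow> act comp_R x = x - act PS x"
  by (simp add: comp_R_def act_minus dims)

lemma act_comp_T: "act comp_T x = act F2 x - act K (act C x)"
  by (simp add: comp_T_def act_minus act_mult dims)

lemma act_comp_\<Theta>: "act comp_\<Theta> y = act B (act K y) - act G2 y + act comp_R (act G2 y - act G0 y)"
  by (simp add: comp_\<Theta>_def act_add act_minus act_mult dims comp_dims)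

lemma act_comp_C:
  "act comp_C (stack n \<xi> (stack n \<eta> \<zeta>)) = act comp_T (\<xi> + act comp_R \<eta>) + act F0 \<zeta> - act F2 \<zeta>"
proof -
  have 1: "act comp_C (stack n \<xi> (stack n \<eta> \<zeta>)) = act comp_T \<xi> + act ((comp_T * comp_R) @\<^sub>c (F0 - F2)) (stack n \<eta> \<zeta>)"
    unfolding comp_C_def
    by (rule act_append_cols[of _ m n _ "n + n"]) (intro carrier_append_cols comp_parts(2) comp_pieces)+
  have 2: "act ((comp_T * comp_R) @\<^sub>c (F0 - F2)) (stack n \<eta> \<zeta>) = act (comp_T * comp_R) \<eta> + act (F0 - F2) \<zeta>"
    by (rule act_append_cols[OF comp_pieces(4,5)])
  show ?thesis unfolding 1 2 by (simp add: act_mult act_minus dims comp_dims)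
qed

lemma act_comp_B:
  "act comp_B y = stack n (act B (act K y) - act G2 y) (stack n (act comp_R (act G2 y - act G0 y)) (act PV (act comp_\<Theta> y)))"
proof -
  have 1: "act comp_B y = stack n (act (B * K - G2) y) (act ((comp_R * (G2 - G0)) @\<^sub>r (PV * comp_\<Theta>)) y)"
    unfolding comp_B_def by (rule act_append_rows[of _ n p _ "n + n"])
      (intro carrier_append_rows comp_pieces)+
  have 2: "act ((comp_R * (G2 - G0)) @\<^sub>r (PV * comp_\<Theta>)) y = stack n (act (comp_R * (G2 - G0)) y) (act (PV * comp_\<Theta>) y)"
    by (rule act_append_rows[OF comp_pieces(2,3)])
  show ?thesis unfolding 1 2 by (simp add: act_mult act_minus dims comp_dims)
qed

lemma act_comp_A:
  assumes "\<zeta> \<in> supp n"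
  shows "act comp_A (stack n \<xi> (stack n \<eta> \<zeta>)) = 
    stack n (act A \<xi> + act B (act comp_T \<xi>) + act G2 (act C \<xi>) + act B (act comp_T (act comp_R \<eta>)) + act B (act F0 \<zeta> - act F2 \<zeta>))
     (stack n (- act comp_R (act G2 (act C \<xi>) - act G0 (act C \<xi>)) 
        + act comp_R (act A (act comp_R \<eta>) + act G0 (act C (act comp_R \<eta>))) + cst (of_real c) * act PS \<eta>)
       (- act PV (act comp_\<Theta> (act C \<xi>)) + act PV (act comp_R (act A (act comp_R \<eta>) + act G0 (act C (act comp_R \<eta>))) 
         - act A (act comp_R \<eta>) - act B (act K (act C (act comp_R \<eta>))))
        + (act A (act PV \<zeta>) + act B (act F0 (act PV \<zeta>)) + cst (of_real c) * (\<zeta> - act PV \<zeta>))))"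
proof -
  let ?A11 = "A + B * comp_T + G2 * C" and ?A12 = "(B * comp_T * comp_R) @\<^sub>c (B * (F0 - F2))"
  let ?A21 = "(- (comp_R * (G2 - G0) * C)) @\<^sub>r (- (PV * comp_\<Theta> * C))"
  let ?N = "comp_R * (A + G0 * C) * comp_R + c \<cdot>\<^sub>m PS"
  let ?A32 = "PV * (comp_R * (A + G0 * C) * comp_R - A * comp_R - B * K * C * comp_R)"
  let ?M = "(A + B * F0) * PV + c \<cdot>\<^sub>m (1\<^sub>m n - PV)"
  let ?A22 = "four_block_mat ?N (0\<^sub>m n n) ?A32 ?M"
  have cN: "?N \<in> carrier_mat n n" "?A32 \<in> carrier_mat n n" "?M \<in> carrier_mat n n"
    by (rule carrier_matI; simp add: dims comp_dims)+
  have c22: "?A22 \<in> carrier_mat (n + n) (n + n)" by (rule four_block_carrier_mat[OF cN(1,3)])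
  have pieces: "B * comp_T * comp_R \<in> carrier_mat n n" "B * (F0 - F2) \<in> carrier_mat n n"
    "- (comp_R * (G2 - G0) * C) \<in> carrier_mat n n" "- (PV * comp_\<Theta> * C) \<in> carrier_mat n n" "?A11 \<in> carrier_mat n n"
    by (rule carrier_matI; simp add: dims comp_dims)+
  note c12 = carrier_append_cols[OF pieces(1,2)] and c21 = carrier_append_rows[OF pieces(3,4)] and c11 = pieces(5)
  have "act comp_A (stack n \<xi> (stack n \<eta> \<zeta>)) = stack n (act ?A11 \<xi> + act ?A12 (stack n \<eta> \<zeta>)) (act ?A21 \<xi> + act ?A22 (stack n \<eta> \<zeta>))"
    unfolding comp_A_def by (rule act_four_block[OF c11 c12 c21 c22])
  moreover have "act ?A12 (stack n \<eta> \<zeta>) = act (B * comp_T * comp_R) \<eta> + act (B * (F0 - F2)) \<zeta>"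
    by (rule act_append_cols[OF pieces(1,2)])
  moreover have "act ?A21 \<xi> = stack n (act (- (comp_R * (G2 - G0) * C)) \<xi>) (act (- (PV * comp_\<Theta> * C)) \<xi>)"
    by (rule act_append_rows[OF pieces(3,4)])
  moreover have "act ?A22 (stack n \<eta> \<zeta>) = stack n (act ?N \<eta> + act (0\<^sub>m n n) \<zeta>) (act ?A32 \<eta> + act ?M \<zeta>)"
    by (rule act_four_block[OF cN(1) _ cN(2,3)]) simp
  moreover have "act ?A11 \<xi> = act A \<xi> + act B (act comp_T \<xi>) + act G2 (act C \<xi>)"
    by (simp add: dims comp_dims act_add act_mult)
  moreover have "act (B * comp_T * comp_R) \<eta> + act (B * (F0 - F2)) \<zeta> = act B (act comp_T (act comp_R \<eta>)) + act B (act F0 \<zeta> - act F2 \<zeta>)"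
    by (simp add: dims comp_dims act_mult act_minus)
  moreover have "act (- (comp_R * (G2 - G0) * C)) \<xi> = - act comp_R (act G2 (act C \<xi>) - act G0 (act C \<xi>))"
    by (simp add: dims comp_dims act_uminus act_mult act_minus)
  moreover have "act (- (PV * comp_\<Theta> * C)) \<xi> = - act PV (act comp_\<Theta> (act C \<xi>))"
    by (simp add: dims comp_dims act_uminus act_mult)
  moreover have "act ?N \<eta> = act comp_R (act A (act comp_R \<eta>) + act G0 (act C (act comp_R \<eta>))) + cst (of_real c) * act PS \<eta>"
    by (simp add: dims comp_dims act_add act_mult act_smult)
  moreover have "act ?A32 \<eta> = act PV (act comp_R (act A (act comp_R \<eta>) + act G0 (act C (act comp_R \<eta>))) 
         - act A (act comp_R \<eta>) - act B (act K (act C (act comp_R \<eta>))))"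
    by (simp add: dims comp_dims act_add act_minus act_mult)
  moreover have "act ?M \<zeta> = act A (act PV \<zeta>) + act B (act F0 (act PV \<zeta>)) + cst (of_real c) * (\<zeta> - act PV \<zeta>)"
    using assms by (simp add: dims comp_dims act_add act_mult act_smult act_minus)
  ultimately show ?thesis by (simp only: stack_linear add.assoc act_zero add_0_right add_0_left)
qed

text \<open>The equations of the compensator.  Here X is the argument of R in the equation for \<eta>.\<close>

lemma comp_dynamics:
  fixes \<xi> \<eta> \<zeta> y :: "'a :: {real_algebra_1, comm_ring_1} fvec"
  assumes z: "\<zeta> \<in> supp n"
  defines "\<epsilon> \<equiv> y - act C \<xi>" and "u \<equiv> act K y + act comp_C (stack n \<xi> (stack n \<eta> \<zeta>))"
  defines "rr \<equiv> \<epsilon> - act C (act comp_R \<eta>)" 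
    and "X \<equiv> act A (act comp_R \<eta>) + act G0 (act C (act comp_R \<eta>)) + act G2 \<epsilon> - act G0 \<epsilon>"
  shows "u = act F2 (\<xi> + act comp_R \<eta> - \<zeta>) + act F0 \<zeta> + act K rr"
    "act comp_B y + act comp_A (stack n \<xi> (stack n \<eta> \<zeta>)) = 
      stack n (act A \<xi> + act B u - act G2 \<epsilon>) 
       (stack n (act comp_R X + cst (of_real c) * act PS \<eta>) 
        (act PV (act B (act K rr) - act A (act comp_R \<eta>) - act G2 \<epsilon> + act comp_R X)
          + (act A (act PV \<zeta>) + act B (act F0 (act PV \<zeta>)) + cst (of_real c) * (\<zeta> - act PV \<zeta>))))"
proof -
  show "u = act F2 (\<xi> + act comp_R \<eta> - \<zeta>) + act F0 \<zeta> + act K rr"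
    by (simp add: u_def act_comp_C act_comp_T rr_def \<epsilon>_def algebra_simps)
  show "act comp_B y + act comp_A (stack n \<xi> (stack n \<eta> \<zeta>)) = 
      stack n (act A \<xi> + act B u - act G2 \<epsilon>) 
       (stack n (act comp_R X + cst (of_real c) * act PS \<eta>) 
        (act PV (act B (act K rr) - act A (act comp_R \<eta>) - act G2 \<epsilon> + act comp_R X)
          + (act A (act PV \<zeta>) + act B (act F0 (act PV \<zeta>)) + cst (of_real c) * (\<zeta> - act PV \<zeta>))))"
    unfolding act_comp_B act_comp_A[OF z] stack_linear(1)
    by (intro arg_cong2[of _ _ _ _ "stack n"]) 
      (simp_all add: u_def act_comp_C act_comp_\<Theta> rr_def X_def \<epsilon>_def algebra_simps)
qed

context
  fixes V S :: "real fvec set" and Cg :: "complex set"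
  assumes V: "fsubspace n V" and S: "fsubspace n S" and SV: "S \<subseteq> V"
    and F0V: "\<And>x. x \<in> V \<Longrightarrow> act A x + act B (act F0 x) \<in> V" "\<And>x. x \<in> V \<Longrightarrow> act E x + act Dz (act F0 x) = 0"
    and G0S: "\<And>x w. x \<in> S \<Longrightarrow> act A x + act H w + act G0 (act C x + act Gy w) \<in> S"
    and KS: "\<And>x w. x \<in> S \<Longrightarrow> act A x + act H w + act B (act K (act C x + act Gy w)) \<in> V"
      "\<And>x w. x \<in> S \<Longrightarrow> act E x + act Gz w + act Dz (act K (act C x + act Gy w)) = 0"
    and PV_in: "\<And>x :: real fvec. act PV x \<in> V" and PV_id: "\<And>x. x \<in> V \<Longrightarrow> act PV x = x"
    and PV_cin: "\<And>x :: complex fvec. act PV x \<in> cx V" and PV_cid: "\<And>x. x \<in> cx V \<Longrightarrow> act PV x = x"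
    and PS_in: "\<And>x :: real fvec. act PS x \<in> S" and PS_id: "\<And>x. x \<in> S \<Longrightarrow> act PS x = x"
    and PS_cin: "\<And>x :: complex fvec. act PS x \<in> cx S" and PS_cid: "\<And>x. x \<in> cx S \<Longrightarrow> act PS x = x"
begin

text \<open>The invariant subspace consists of the states with x = o + s, \<xi> = o - R \<eta> and \<zeta> = o, for o in V,
  s in S and arbitrary \<eta>.  There u = F0 o + K (C s + Gy w), so x' is the sum of
  (A + B F0) o and of A s + H w + B K (C s + Gy w), which are in V by the hypotheses on F0 and K, and
  the new s is (A s + H w + G0 (C s + Gy w)) + PS X.\<close>

lemma compensator_decouples:
  obtains L where "closed_loop_decoupled n (n + (n + n)) A B H C Gy E Dz comp_A comp_B comp_C K L"
    "\<forall>w :: real fvec. act Gz w + act Dz (act K (act Gy w)) = 0"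
proof -
  define st where "st o' s \<eta> = stack n (o' + s) (stack n (o' - act comp_R \<eta>) (stack n \<eta> o'))" for o' s \<eta> :: "real fvec"
  define L where "L = {st o' s \<eta> |o' s \<eta>. o' \<in> V \<and> s \<in> S \<and> \<eta> \<in> supp n}"
  have LI: "st o' s \<eta> \<in> L" if "o' \<in> V" "s \<in> S" "\<eta> \<in> supp n" for o' s \<eta>
    using that by (auto simp: L_def)
  have Rn: "act comp_R x \<in> supp n" for x :: "real fvec" using comp_parts by simp
  have RS: "act comp_R x = 0" if "x \<in> S" for x 
    using act_comp_R[OF fsubspaceD(1)[OF S that]] PS_id[OF that] by simp
  have RR: "act comp_R (act comp_R x) = act comp_R x" if "x \<in> supp n" for x :: "real fvec"
    using RS[OF PS_in, of x] by (simp add: act_comp_R[OF that])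
  have fL: "fsubspace (n + (n + (n + n))) L" unfolding fsubspace_def
  proof (intro conjI ballI allI)
    show "L \<subseteq> supp (n + (n + (n + n)))"
      using fsubspaceD(1)[OF V] by (auto simp: L_def st_def intro!: stack_supp)
    have "st 0 0 0 = 0" by (simp add: st_def stack_linear)
    then show "0 \<in> L" using LI[OF fsubspaceD(2)[OF V] fsubspaceD(2)[OF S], of 0] by simp
    show "a + b \<in> L" if ab: "a \<in> L" "b \<in> L" for a b
    proof -
      obtain o1 s1 \<eta>1 o2 s2 \<eta>2 where e: "a = st o1 s1 \<eta>1" "o1 \<in> V" "s1 \<in> S" "\<eta>1 \<in> supp n"
        "b = st o2 s2 \<eta>2" "o2 \<in> V" "s2 \<in> S" "\<eta>2 \<in> supp n" using ab by (auto simp: L_def)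
      have "a + b = st (o1 + o2) (s1 + s2) (\<eta>1 + \<eta>2)"
        unfolding e(1,5) st_def stack_linear(1) by (simp add: algebra_simps)
      then show ?thesis using LI fsubspaceD(3)[OF V e(2,6)] fsubspaceD(3)[OF S e(3,7)] e(4,8) by simp
    qed
    show "cst a * b \<in> L" if "b \<in> L" for a b
    proof -
      obtain o1 s1 \<eta>1 where e: "b = st o1 s1 \<eta>1" "o1 \<in> V" "s1 \<in> S" "\<eta>1 \<in> supp n"
        using \<open>b \<in> L\<close> by (auto simp: L_def)
      have "cst a * b = st (cst a * o1) (cst a * s1) (cst a * \<eta>1)"
        unfolding e(1) st_def stack_linear(4) by (simp add: algebra_simps)
      then show ?thesis using LI fsubspaceD(4)[OF V e(2)] fsubspaceD(4)[OF S e(3)] e(4) by simp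
    qed
  qed
  have step: "stack n (act A x + act B u + act H w) (act comp_B (act C x + act Gy w) + act comp_A \<xi>c) \<in> L \<and> 
      act E x + act Dz u + act Gz w = 0"
    if x: "x = o' + s" and \<xi>c: "\<xi>c = stack n (o' - act comp_R \<eta>) (stack n \<eta> o')" and o': "o' \<in> V" and s: "s \<in> S" and \<eta>: "\<eta> \<in> supp n"
      and u: "u = act K (act C x + act Gy w) + act comp_C \<xi>c" for x \<xi>c o' s \<eta> w u
  proof -
    define y where "y = act C x + act Gy w"
    define \<epsilon> where "\<epsilon> = y - act C (o' - act comp_R \<eta>)"
    define rr where "rr = \<epsilon> - act C (act comp_R \<eta>)"
    define X where "X = act A (act comp_R \<eta>) + act G0 (act C (act comp_R \<eta>)) + act G2 \<epsilon> - act G0 \<epsilon>"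
    define \<theta> where "\<theta> = act B (act K rr) - act A (act comp_R \<eta>) - act G2 \<epsilon> + act comp_R X"
    have o'n: "o' \<in> supp n" by (rule fsubspaceD(1)[OF V o'])
    have rr: "rr = act C s + act Gy w" by (simp add: rr_def \<epsilon>_def y_def x algebra_simps)
    have u_eq: "u = act F0 o' + act K rr"
      using comp_dynamics(1)[OF o'n, of y "o' - act comp_R \<eta>" \<eta>]
      unfolding u \<xi>c y_def[symmetric] \<epsilon>_def[symmetric] rr_def[symmetric] by simp
    have dyn: "act comp_B y + act comp_A \<xi>c = stack n (act A (o' - act comp_R \<eta>) + act B u - act G2 \<epsilon>)
       (stack n (act comp_R X + cst c * act PS \<eta>) (act PV \<theta> + (act A o' + act B (act F0 o'))))"
      using comp_dynamics(2)[OF o'n, of y "o' - act comp_R \<eta>" \<eta>]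
      unfolding u \<xi>c y_def[symmetric] \<epsilon>_def[symmetric] rr_def[symmetric] X_def[symmetric] \<theta>_def[symmetric]
      by (simp add: PV_id[OF o'] del: act_linear)
    define g where "g = act A s + act H w + act B (act K rr)"
    have g: "g \<in> V" using KS(1)[OF s, of w] by (simp add: g_def rr)
    have Xn: "X \<in> supp n" using A G0 G2 by (simp add: X_def)
    define s' where "s' = (act A s + act H w + act G0 rr) + act PS X"
    have s': "s' \<in> S" unfolding s'_def rr by (rule fsubspaceD(3)[OF S G0S[OF s] PS_in])
    have \<epsilon>: "\<epsilon> = rr + act C (act comp_R \<eta>)" by (simp add: rr_def)
    have gs: "g - s' = \<theta>"
      by (simp add: g_def s'_def \<theta>_def act_comp_R[OF Xn]) (simp add: X_def \<epsilon> algebra_simps)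
    then have \<theta>: "\<theta> \<in> V" using fsubspaceD(5)[OF V g] s' SV by blast
    define o2 where "o2 = act A o' + act B (act F0 o') + \<theta>"
    have o2: "o2 \<in> V" unfolding o2_def by (rule fsubspaceD(3)[OF V F0V(1)[OF o'] \<theta>])
    define \<eta>2 where "\<eta>2 = act comp_R X + cst c * act PS \<eta>"
    have \<eta>2: "\<eta>2 \<in> supp n" using comp_parts PS by (simp add: \<eta>2_def)
    have R\<eta>2: "act comp_R \<eta>2 = act comp_R X"
      using RR[OF Xn] RS[OF PS_in, of \<eta>] by (simp add: \<eta>2_def)
    have "act A x + act B u + act H w = o2 + s'"
      unfolding x u_eq o2_def gs[symmetric] g_def by (simp add: algebra_simps)
    moreover have "act A (o' - act comp_R \<eta>) + act B u - act G2 \<epsilon> = o2 - act comp_R \<eta>2"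
      unfolding R\<eta>2 u_eq o2_def \<theta>_def by (simp add: algebra_simps)
    moreover have "act PV \<theta> + (act A o' + act B (act F0 o')) = o2"
      by (simp add: PV_id[OF \<theta>] o2_def algebra_simps)
    ultimately have "stack n (act A x + act B u + act H w) (act comp_B y + act comp_A \<xi>c) = st o2 s' \<eta>2"
      unfolding dyn st_def \<eta>2_def[symmetric] by (simp only:)
    moreover have "act E x + act Dz u + act Gz w = (act E o' + act Dz (act F0 o')) + (act E s + act Gz w + act Dz (act K (act C s + act Gy w)))"
      unfolding x u_eq rr by (simp add: algebra_simps)
    then have "act E x + act Dz u + act Gz w = 0" by (simp only: F0V(2)[OF o'] KS(2)[OF s] add_0_left)
    ultimately show ?thesis using LI[OF o2 s' \<eta>2] by (simp add: y_def)
  qed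
  have G0': "act Gz w + act Dz (act K (act Gy w)) = 0" for w :: "real fvec"
    using KS(2)[OF fsubspaceD(2)[OF S], of w] by simp
  have "closed_loop_decoupled n (n + (n + n)) A B H C Gy E Dz comp_A comp_B comp_C K L"
    unfolding closed_loop_decoupled_def
  proof (intro conjI allI impI)
    show "fsubspace (n + (n + (n + n))) L" by (rule fL)
  next
    fix x \<xi>c assume a: "x \<in> supp n" "stack n x \<xi>c \<in> L"
    then obtain o' s \<eta> where e: "stack n x \<xi>c = st o' s \<eta>" "o' \<in> V" "s \<in> S" "\<eta> \<in> supp n" by (auto simp: L_def)
    have e': "x = o' + s" "\<xi>c = stack n (o' - act comp_R \<eta>) (stack n \<eta> o')"
      using e a(1) fsubspaceD(1)[OF V e(2)] fsubspaceD(1)[OF S e(3)] by (simp_all add: st_def stack_eq_iff)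
    from step[OF e' e(2-4) refl, of 0]
    show "stack n (act A x + act B (act K (act C x) + act comp_C \<xi>c)) (act comp_B (act C x) + act comp_A \<xi>c) \<in> L"
      "act E x + act Dz (act K (act C x) + act comp_C \<xi>c) = 0" by simp_all
  next
    fix w
    have "(0 :: real fvec) = stack n (0 - act comp_R 0) (stack n 0 0)" by (simp add: stack_linear)
    from step[OF _ this fsubspaceD(2)[OF V] fsubspaceD(2)[OF S] _ refl, of 0 w]
    show "stack n (act H w + act B (act K (act Gy w))) (act comp_B (act Gy w)) \<in> L"
      by (simp add: add.commute)
  qed
  with G0' show thesis using that by blast
qed

text \<open>In the coordinates x - \<xi>, \<eta>, \<zeta>, x the closed loop is block triangular, with the diagonal blocks
  A + G2 C, the compression of A + G0 C by R, A + B F0 on V, and A + B F2.  An unstable eigenvector is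
  therefore excluded block by block.\<close>

lemma compensator_stable:
  assumes c: "of_real c \<in> Cg" 
    and F0s: "stable_on Cg (A + B * F0) V" and G0s: "stable_quot Cg (A + G0 * C) S"
    and F2s: "\<And>k x. k \<notin> Cg \<Longrightarrow> x \<in> supp n \<Longrightarrow> act A x + act B (act F2 x) = cst k * x \<Longrightarrow> x = (0 :: complex fvec)"
    and G2s: "\<And>k x. k \<notin> Cg \<Longrightarrow> x \<in> supp n \<Longrightarrow> act A x + act G2 (act C x) = cst k * x \<Longrightarrow> x = (0 :: complex fvec)"
  shows "closed_loop_stable Cg n (n + (n + n)) A B C comp_A comp_B comp_C K"
  unfolding closed_loop_stable_def
proof (intro allI impI)
  fix k and x \<xi>c :: "complex fvec"
  assume k: "k \<notin> Cg" and x: "x \<in> supp n" and \<xi>c: "\<xi>c \<in> supp (n + (n + n))"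
    and e1: "act A x + act B (act K (act C x) + act comp_C \<xi>c) = cst k * x"
    and e2: "act comp_B (act C x) + act comp_A \<xi>c = cst k * \<xi>c"
  have kc: "of_real c - k \<noteq> 0" using k c by auto
  have Rn: "act comp_R z \<in> supp n" for z :: "complex fvec" using comp_parts by simp
  have RS: "act comp_R z = 0" if "z \<in> cx S" for z
    using act_comp_R[OF cxD(1)[OF S that]] PS_cid[OF that] by simp
  have RR: "act comp_R (act comp_R z) = act comp_R z" if "z \<in> supp n" for z :: "complex fvec"
    using RS[OF PS_cin, of z] by (simp add: act_comp_R[OF that])
  define \<xi> where "\<xi> = trunc n \<xi>c"
  define \<eta> where "\<eta> = trunc n (shift n \<xi>c)"
  define \<zeta> where "\<zeta> = shift n (shift n \<xi>c)"
  have sup: "\<xi> \<in> supp n" "\<eta> \<in> supp n" "\<zeta> \<in> supp n" using \<xi>c by (simp_all add: \<xi>_def \<eta>_def \<zeta>_def)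
  have \<xi>c_eq: "\<xi>c = stack n \<xi> (stack n \<eta> \<zeta>)" by (simp add: \<xi>_def \<eta>_def \<zeta>_def stack_split)
  define \<epsilon> where "\<epsilon> = act C x - act C \<xi>"
  define u where "u = act K (act C x) + act comp_C \<xi>c"
  define rr where "rr = \<epsilon> - act C (act comp_R \<eta>)"
  define X where "X = act A (act comp_R \<eta>) + act G0 (act C (act comp_R \<eta>)) + act G2 \<epsilon> - act G0 \<epsilon>"
  define \<theta> where "\<theta> = act B (act K rr) - act A (act comp_R \<eta>) - act G2 \<epsilon> + act comp_R X"
  have u_eq: "u = act F2 (\<xi> + act comp_R \<eta> - \<zeta>) + act F0 \<zeta> + act K rr"
    using comp_dynamics(1)[OF sup(3), of "act C x" \<xi> \<eta>] 
    unfolding u_def \<xi>c_eq \<epsilon>_def[symmetric] rr_def[symmetric] .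
  have "stack n (act A \<xi> + act B u - act G2 \<epsilon>) (stack n (act comp_R X + cst (of_real c) * act PS \<eta>) 
        (act PV \<theta> + (act A (act PV \<zeta>) + act B (act F0 (act PV \<zeta>)) + cst (of_real c) * (\<zeta> - act PV \<zeta>))))
      = stack n (cst k * \<xi>) (stack n (cst k * \<eta>) (cst k * \<zeta>))"
    using comp_dynamics(2)[OF sup(3), of "act C x" \<xi> \<eta>] e2
    unfolding u_def[symmetric] \<xi>c_eq[symmetric] \<epsilon>_def[symmetric] rr_def[symmetric] X_def[symmetric] \<theta>_def[symmetric]
    by (simp only: \<xi>c_eq stack_linear)
  then have d: "act A \<xi> + act B u - act G2 \<epsilon> = cst k * \<xi>" 
    "act comp_R X + cst (of_real c) * act PS \<eta> = cst k * \<eta>"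
    "act PV \<theta> + (act A (act PV \<zeta>) + act B (act F0 (act PV \<zeta>)) + cst (of_real c) * (\<zeta> - act PV \<zeta>)) = cst k * \<zeta>"
    using A B G2 comp_parts PS PV sup by (auto simp: stack_eq_iff)
  \<comment> \<open>The diagonal blocks are treated in the order of the triangular form: x - \<xi>, then \<eta>, \<zeta>, x.\<close>
  have "act A (x - \<xi>) + act G2 (act C (x - \<xi>)) = (act A x + act B u) - (act A \<xi> + act B u - act G2 \<epsilon>)"
    by (simp add: \<epsilon>_def algebra_simps)
  also have "\<dots> = cst k * (x - \<xi>)" using e1 d(1) unfolding u_def by (simp add: right_diff_distrib)
  finally have "x - \<xi> = 0" by (rule G2s[OF k, rotated]) (simp add: x sup(1))
  then have x\<xi>: "x = \<xi>" by simp
  then have \<epsilon>0: "\<epsilon> = 0" by (simp add: \<epsilon>_def)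
  have \<eta>0: "\<eta> = 0"
  proof -
    define z where "z = act comp_R \<eta>"
    have X: "X = act A z + act G0 (act C z)" by (simp add: X_def \<epsilon>0 z_def)
    have Xn: "X \<in> supp n" unfolding X using A G0 by simp
    have "act comp_R (act comp_R X + cst (of_real c) * act PS \<eta>) = act comp_R X"
      using RR[OF Xn] RS[OF PS_cin, of \<eta>] by simp
    then have RX: "act comp_R X = cst k * z" using d(2) by (simp add: z_def)
    have "X - act comp_R X \<in> cx S" using PS_cin by (simp add: act_comp_R[OF Xn])
    moreover have "act (A + G0 * C) z = X" by (simp add: act_add act_mult dims X)
    ultimately have "act (A + G0 * C) z - cst k * z \<in> cx S" by (simp only: RX)
    moreover have "z \<in> supp (dim_row (A + G0 * C))" using Rn A G0 C by (simp add: z_def)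
    ultimately have "z \<in> cx S" using G0s k unfolding stable_quot_def by blast
    then have z0: "z = 0" using RS RR[OF sup(2)] by (simp add: z_def)
    then have "act PS \<eta> = \<eta>" using act_comp_R[OF sup(2)] by (simp add: z_def)
    with d(2) RX z0 have "cst (of_real c - k) * \<eta> = 0" by (simp add: cst_hom left_diff_distrib)
    with kc show ?thesis by simp
  qed
  have \<theta>0: "\<theta> = 0" by (simp add: \<theta>_def rr_def X_def \<epsilon>0 \<eta>0)
  have \<zeta>0: "\<zeta> = 0"
  proof -
    define z where "z = act PV \<zeta>"
    have zV: "z \<in> cx V" by (simp add: z_def PV_cin)
    have "act A z + act B (act F0 z) \<in> cx V" using zV F0V(1) by (auto simp: cx_def)
    moreover have d': "(act A z + act B (act F0 z)) + cst (of_real c) * (\<zeta> - z) = cst k * \<zeta>"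
      using d(3) by (simp add: \<theta>0 z_def)
    then have "act PV ((act A z + act B (act F0 z)) + cst (of_real c) * (\<zeta> - z)) = cst k * z"
      by (simp add: z_def)
    moreover have "act PV (\<zeta> - z) = 0" using PV_cid[OF zV] by (simp add: z_def)
    ultimately have ev: "act A z + act B (act F0 z) = cst k * z"
      using PV_cid[of "act A z + act B (act F0 z)"] by (simp only: act_linear(1,5) mult_zero_right add_0_right)
    then have "act (A + B * F0) z = cst k * z" using A B F0 by (simp add: act_feedback)
    then have z0: "z = 0" using F0s k zV unfolding stable_on_def by blast
    with d' have "cst (of_real c - k) * \<zeta> = 0" by (simp add: cst_hom left_diff_distrib)
    with kc show ?thesis by simp
  qed
  have "u = act F2 x" unfolding u_eq by (simp add: \<eta>0 \<zeta>0 rr_def \<epsilon>0 x\<xi>)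
  then have "x = 0" using F2s[OF k x] e1 unfolding u_def by simp
  then show "x = 0 \<and> \<xi>c = 0" using x\<xi> by (simp add: \<xi>c_eq \<eta>0 \<zeta>0 stack_linear)
qed

end

end

section \<open>Translation between vectors and functions\<close>

lemma real_subspace_iff:
  "real_subspace n V \<longleftrightarrow> V \<subseteq> carrier_vec n \<and> 0\<^sub>v n \<in> V \<and> (\<forall>x\<in>V. \<forall>y\<in>V. x + y \<in> V) \<and> (\<forall>c. \<forall>x\<in>V. c \<cdot>\<^sub>v x \<in> V)"
proof -
  have vs: "vectorspace class_ring (module_vec TYPE(real) n)" by (rule vec_vs)
  show ?thesis
    unfolding VectorSpace.subspace_def submodule_def using vs vs[unfolded VectorSpace.vectorspace_def]
    by (auto simp: module_vec_simps class_ring_simps)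
qed

lemma fn_image_subset: 
  assumes "X \<subseteq> carrier_vec n" "Y \<subseteq> carrier_vec n"
  shows "X \<subseteq> Y \<longleftrightarrow> fn ` X \<subseteq> fn ` Y"
  using assms fn_inj by (fastforce simp: subset_iff)

lemma fn_image_mem: "X \<subseteq> carrier_vec n \<Longrightarrow> v \<in> carrier_vec n \<Longrightarrow> fn v \<in> fn ` X \<longleftrightarrow> v \<in> X"
  using fn_inj by blast

lemma fn_carrier: "fn ` carrier_vec n = (supp n :: 'a :: zero fvec set)"
proof -
  have "f \<in> fn ` carrier_vec n" if "f \<in> supp n" for f :: "'a fvec"
    using that by (intro image_eqI[of _ _ "vec n f"]) auto
  then show ?thesis by auto
qed

lemma fn_subset_supp: "X \<subseteq> carrier_vec n \<Longrightarrow> fn ` X \<subseteq> supp n"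
  by auto

lemma fn_set_plus:
  assumes "X \<subseteq> carrier_vec n" "Y \<subseteq> carrier_vec n"
  shows "fn ` (X + Y) = fn ` X + (fn ` Y :: 'a :: comm_ring_1 fvec set)"
proof
  show "fn ` (X + Y) \<subseteq> fn ` X + fn ` Y"
    using assms by (auto elim!: set_plus_elim simp: fn_algebra(1)[of _ n] subset_iff intro!: set_plus_intro)
  show "fn ` X + fn ` Y \<subseteq> fn ` (X + Y)"
  proof
    fix z assume "z \<in> fn ` X + fn ` Y"
    then obtain x y where "z = fn x + fn y" "x \<in> X" "y \<in> Y" by (auto elim!: set_plus_elim)
    moreover from this have "fn (x + y) = fn x + fn y" using assms by (auto simp: fn_algebra(1)[of _ n] subset_iff)
    ultimately show "z \<in> fn ` (X + Y)" by (metis image_eqI set_plus_intro)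
  qed
qed

lemma set_plus_carrier: "X \<subseteq> carrier_vec n \<Longrightarrow> Y \<subseteq> carrier_vec n \<Longrightarrow> X + Y \<subseteq> carrier_vec n"
  by (auto elim!: set_plus_elim simp: subset_iff)

definition stack_set :: "nat \<Rightarrow> 'a fvec set \<Rightarrow> 'a fvec set \<Rightarrow> 'a fvec set" where
  "stack_set n V W = {stack n v w |v w. v \<in> V \<and> w \<in> W}"

lemma stack_setI: "v \<in> V \<Longrightarrow> w \<in> W \<Longrightarrow> stack n v w \<in> stack_set n V W"
  unfolding stack_set_def by blast

lemma fn_append: "v \<in> carrier_vec n \<Longrightarrow> fn (v @\<^sub>v w) = stack n (fn v) (fn w)"
  by (auto simp: fn_def stack_def fun_eq_iff)

lemma fn_ext_sum: "X \<subseteq> carrier_vec n \<Longrightarrow> fn ` (X \<oplus>\<^sub>v Y) = stack_set n (fn ` X) (fn ` Y)"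
proof -
  assume X: "X \<subseteq> carrier_vec n"
  have *: "fn (v @\<^sub>v w) = stack n (fn v) (fn w)" if "v \<in> X" for v w using X that by (auto simp: fn_append)
  show ?thesis
  proof
    show "fn ` (X \<oplus>\<^sub>v Y) \<subseteq> stack_set n (fn ` X) (fn ` Y)" unfolding ext_sum_def stack_set_def using * by blast
    show "stack_set n (fn ` X) (fn ` Y) \<subseteq> fn ` (X \<oplus>\<^sub>v Y)"
    proof
      fix z assume "z \<in> stack_set n (fn ` X) (fn ` Y)"
      then obtain x y where "z = stack n (fn x) (fn y)" "x \<in> X" "y \<in> Y" by (auto simp: stack_set_def)
      then have "z = fn (x @\<^sub>v y)" "x @\<^sub>v y \<in> X \<oplus>\<^sub>v Y" by (auto simp: * ext_sum_def)
      then show "z \<in> fn ` (X \<oplus>\<^sub>v Y)" by blast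
    qed
  qed
qed

lemma ext_sum_carrier: "X \<subseteq> carrier_vec n \<Longrightarrow> Y \<subseteq> carrier_vec m \<Longrightarrow> X \<oplus>\<^sub>v Y \<subseteq> carrier_vec (n + m)"
  by (auto simp: ext_sum_def subset_iff)

lemma fn_mat_image: "M \<in> carrier_mat r n \<Longrightarrow> X \<subseteq> carrier_vec n \<Longrightarrow> fn ` mat_image M X = act M ` fn ` X"
  unfolding image_image by (rule image_cong) (auto simp: fn_mat subset_iff)

lemma fn_mat_range: "M \<in> carrier_mat r n \<Longrightarrow> fn ` mat_range M = range (act M :: real fvec \<Rightarrow> real fvec)"
proof -
  assume M: "M \<in> carrier_mat r n"
  then have "fn ` mat_range M = act M ` (supp n :: real fvec set)"
    using fn_mat_image[OF M, of "carrier_vec n"] by (simp add: fn_carrier)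
  also have "\<dots> = range (act M)"
  proof
    show "range (act M :: real fvec \<Rightarrow> real fvec) \<subseteq> act M ` supp n"
    proof
      fix y :: "real fvec" assume "y \<in> range (act M)"
      then obtain x where "y = act M x" by auto
      then have "y = act M (trunc n x)" using M by simp
      then show "y \<in> act M ` supp n" by (intro image_eqI[of _ _ "trunc n x"] trunc_supp)
    qed
  qed auto
  finally show ?thesis .
qed

lemma mat_image_carrier: "M \<in> carrier_mat r n \<Longrightarrow> mat_image M X \<subseteq> carrier_vec r"
  by (auto intro!: carrier_vecI)

lemma fn_mat_kernel: "M \<in> carrier_mat r n \<Longrightarrow> fn ` mat_kernel M = {x \<in> supp n. act M x = (0 :: real fvec)}"
proof -
  assume M: "M \<in> carrier_mat r n"
  have *: "M *\<^sub>v v = 0\<^sub>v r \<longleftrightarrow> act M (fn v) = 0" if "v \<in> carrier_vec n" for v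
    using fn_eq_0_iff[of "M *\<^sub>v v" r] M that by (simp add: fn_mat)
  have "x \<in> fn ` {v \<in> carrier_vec n. act M (fn v) = 0}" if "x \<in> supp n" "act M x = 0" for x :: "real fvec"
    using that by (intro image_eqI[of _ _ "vec n x"]) auto
  then show ?thesis using M * unfolding mat_kernel_def by auto
qed

lemma fsubspace_image:
  assumes "V \<subseteq> carrier_vec n"
  shows "real_subspace n V \<longleftrightarrow> fsubspace n (fn ` V)"
proof -
  have z: "fn (0\<^sub>v n :: real vec) = 0" by (simp add: fn_algebra)
  have "0\<^sub>v n \<in> V \<longleftrightarrow> 0 \<in> fn ` V" using fn_image_mem[OF assms, of "0\<^sub>v n"] z by simp
  moreover have "x + y \<in> V \<longleftrightarrow> fn x + fn y \<in> fn ` V" if "x \<in> V" "y \<in> V" for x y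
    using fn_image_mem[OF assms, of "x + y"] that assms fn_algebra(1)[of x n y] by (auto simp: subset_iff)
  moreover have "c \<cdot>\<^sub>v x \<in> V \<longleftrightarrow> cst c * fn x \<in> fn ` V" if "x \<in> V" for c x
    using fn_image_mem[OF assms, of "c \<cdot>\<^sub>v x"] that assms fn_algebra(3)[of c x] by (auto simp: subset_iff)
  ultimately show ?thesis
    unfolding real_subspace_iff fsubspace_def using assms fn_subset_supp[OF assms] by (simp add: ball_simps)
qed

lemma output_nulling_iff:
  assumes A: "A \<in> carrier_mat n n" and B: "B \<in> carrier_mat n m" and C: "C \<in> carrier_mat p n" and D: "D \<in> carrier_mat p m"
  shows "output_nulling A B C D V \<longleftrightarrow> V \<subseteq> carrier_vec n \<and> out_nulling A B C D (fn ` V)"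
proof (cases "V \<subseteq> carrier_vec n")
  case True
  let ?V = "fn ` V"
  have z: "fn ` {0\<^sub>v p} = {0 :: real fvec}" by (simp add: fn_algebra)
  have dims: "dim_row A = n" "dim_row C = p" using A C by auto
  have AC: "A @\<^sub>r C \<in> carrier_mat (n + p) n" "B @\<^sub>r D \<in> carrier_mat (n + p) m" using A B C D by auto
  have e: "V \<oplus>\<^sub>v {0\<^sub>v p} \<subseteq> carrier_vec (n + p)" using True by (intro ext_sum_carrier) auto
  have "mat_image (A @\<^sub>r C) V \<subseteq> (V \<oplus>\<^sub>v {0\<^sub>v p}) + mat_range (B @\<^sub>r D) \<longleftrightarrow>
    act (A @\<^sub>r C) ` ?V \<subseteq> stack_set n ?V {0} + range (act (B @\<^sub>r D))"
    by (subst fn_image_subset[OF mat_image_carrier[OF AC(1)] set_plus_carrier[OF e mat_image_carrier[OF AC(2)]]])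
      (simp only: fn_mat_image[OF AC(1) True] fn_set_plus[OF e mat_image_carrier[OF AC(2)]] fn_mat_range[OF AC(2)] fn_ext_sum[OF True] z)
  also have "\<dots> \<longleftrightarrow> (\<forall>x\<in>?V. \<exists>u. act A x + act B u \<in> ?V \<and> act C x + act D u = 0)"
  proof -
    have "act (A @\<^sub>r C) x \<in> stack_set n ?V {0} + range (act (B @\<^sub>r D)) \<longleftrightarrow> 
      (\<exists>u. act A x + act B u \<in> ?V \<and> act C x + act D u = 0)" for x
    proof
      assume "act (A @\<^sub>r C) x \<in> stack_set n ?V {0} + range (act (B @\<^sub>r D))"
      then obtain v u where vu: "v \<in> ?V" "act (A @\<^sub>r C) x = stack n v 0 + act (B @\<^sub>r D) u"
        by (auto elim!: set_plus_elim simp: stack_set_def)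
      have "v \<in> supp n" using vu(1) fn_subset_supp[OF True] by auto
      then have "act A x = v + act B u" "act C x = act D u"
        using vu(2) A B by (simp_all add: act_append_rows[OF A C] act_append_rows[OF B D] stack_linear stack_eq_iff)
      then show "\<exists>u. act A x + act B u \<in> ?V \<and> act C x + act D u = 0"
        using vu(1) by (intro exI[of _ "- u"]) simp
    next
      assume "\<exists>u. act A x + act B u \<in> ?V \<and> act C x + act D u = 0"
      then obtain u where u: "act A x + act B u \<in> ?V" "act C x + act D u = 0" by blast
      have "act (A @\<^sub>r C) x = stack n (act A x + act B u) (act C x + act D u) + act (B @\<^sub>r D) (- u)"
        by (simp add: act_append_rows[OF A C] act_append_rows[OF B D] stack_linear)
      moreover have "stack n (act A x + act B u) (act C x + act D u) \<in> stack_set n ?V {0}"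
        using u by (auto simp: stack_set_def)
      ultimately show "act (A @\<^sub>r C) x \<in> stack_set n ?V {0} + range (act (B @\<^sub>r D))"
        by (metis rangeI set_plus_intro)
    qed
    then show ?thesis by (simp only: image_subset_iff)
  qed
  finally show ?thesis
    unfolding output_nulling_def out_nulling_def dims fsubspace_image[OF True, symmetric] using True by simp
next
  case False
  then show ?thesis using A unfolding output_nulling_def by (auto simp: real_subspace_iff)
qed

lemma complexification_iff:
  assumes "J \<subseteq> carrier_vec n"
  shows "v \<in> complexification J \<longleftrightarrow> v \<in> carrier_vec n \<and> fn v \<in> cx (fn ` J)"
proof -
  have e: "fn (map_vec Re v) = fRe (fn v)" "fn (map_vec Im v) = fIm (fn v)"
    by (auto simp: fn_def fRe_def fIm_def fun_eq_iff)
  show ?thesis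
  proof (cases "v \<in> carrier_vec n")
    case True
    then have "map_vec Re v \<in> carrier_vec n" "map_vec Im v \<in> carrier_vec n" by auto
    with True show ?thesis
      using fn_image_mem[OF assms] by (simp add: complexification_def cx_def flip: e)
  next
    case False
    then have "map_vec Re v \<notin> carrier_vec n" by simp
    with False assms show ?thesis by (auto simp: complexification_def)
  qed
qed

lemma fn_eq_cst_iff:
  assumes "M \<in> carrier_mat n n" "v \<in> carrier_vec n"
  shows "cmat M *\<^sub>v v = k \<cdot>\<^sub>v v \<longleftrightarrow> act M (fn v) = cst k * fn v"
  using fn_inj[of "cmat M *\<^sub>v v" n "k \<cdot>\<^sub>v v"] assms by (simp add: fn_cmat fn_algebra)

lemma spectrum_on_iff:
  assumes M: "M \<in> carrier_mat n n" and J: "J \<subseteq> carrier_vec n" and fJ: "fsubspace n (fn ` J)"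
  shows "spectrum_on M J \<subseteq> Cg \<longleftrightarrow> stable_on Cg M (fn ` J)"
proof -
  have d: "dim_row M = n" using M by simp
  have "(\<exists>v \<in> complexification J. v \<noteq> 0\<^sub>v n \<and> cmat M *\<^sub>v v = k \<cdot>\<^sub>v v) \<longleftrightarrow>
    (\<exists>x \<in> cx (fn ` J). x \<noteq> 0 \<and> act M x = cst k * x)" for k
  proof
    assume "\<exists>v \<in> complexification J. v \<noteq> 0\<^sub>v n \<and> cmat M *\<^sub>v v = k \<cdot>\<^sub>v v"
    then obtain v where v: "v \<in> carrier_vec n" "fn v \<in> cx (fn ` J)" "v \<noteq> 0\<^sub>v n" "cmat M *\<^sub>v v = k \<cdot>\<^sub>v v"
      unfolding complexification_iff[OF J] Bex_def by blast
    then show "\<exists>x \<in> cx (fn ` J). x \<noteq> 0 \<and> act M x = cst k * x"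
      using fn_eq_0_iff[OF v(1)] fn_eq_cst_iff[OF M v(1)] by blast
  next
    assume "\<exists>x \<in> cx (fn ` J). x \<noteq> 0 \<and> act M x = cst k * x"
    then obtain x where x: "x \<in> cx (fn ` J)" "x \<noteq> 0" "act M x = cst k * x" by blast
    have xn: "fn (vec n x) = x" using cxD(1)[OF fJ x(1)] by simp
    have v: "vec n x \<in> carrier_vec n" by simp
    have "vec n x \<in> complexification J" unfolding complexification_iff[OF J] using x(1) xn by simp
    moreover have "vec n x \<noteq> 0\<^sub>v n" using fn_eq_0_iff[OF v] x(2) xn by simp
    moreover have "cmat M *\<^sub>v vec n x = k \<cdot>\<^sub>v vec n x" using fn_eq_cst_iff[OF M v] x(3) xn by simp
    ultimately show "\<exists>v \<in> complexification J. v \<noteq> 0\<^sub>v n \<and> cmat M *\<^sub>v v = k \<cdot>\<^sub>v v" by blast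
  qed
  then show ?thesis unfolding spectrum_on_def stable_on_def d by blast
qed

lemma spectrum_quot_iff:
  assumes M: "M \<in> carrier_mat n n" and J: "J \<subseteq> carrier_vec n"
  shows "spectrum_quot M J \<subseteq> Cg \<longleftrightarrow> stable_quot Cg M (fn ` J)"
proof -
  have d: "dim_row M = n" using M by simp
  have e: "v \<notin> complexification J \<and> cmat M *\<^sub>v v - k \<cdot>\<^sub>v v \<in> complexification J \<longleftrightarrow>
    fn v \<notin> cx (fn ` J) \<and> act M (fn v) - cst k * fn v \<in> cx (fn ` J)" if "v \<in> carrier_vec n" for k v
  proof -
    have c: "cmat M *\<^sub>v v \<in> carrier_vec n" "k \<cdot>\<^sub>v v \<in> carrier_vec n" using that M by auto
    then have "fn (cmat M *\<^sub>v v - k \<cdot>\<^sub>v v) = act M (fn v) - cst k * fn v"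
      using that M by (simp add: fn_algebra(2)[of _ n] fn_algebra(3) fn_cmat)
    moreover have "cmat M *\<^sub>v v - k \<cdot>\<^sub>v v \<in> carrier_vec n" using c by simp
    ultimately show ?thesis unfolding complexification_iff[OF J] using that by simp
  qed
  have "(\<exists>v \<in> carrier_vec n. v \<notin> complexification J \<and> cmat M *\<^sub>v v - k \<cdot>\<^sub>v v \<in> complexification J) \<longleftrightarrow>
    (\<exists>x \<in> supp n. x \<notin> cx (fn ` J) \<and> act M x - cst k * x \<in> cx (fn ` J))" for k
    unfolding fn_carrier[symmetric] using e by blast
  then show ?thesis unfolding spectrum_quot_def stable_quot_def d by blast
qed

lemma internally_stabilizable_iff:
  assumes A: "A \<in> carrier_mat n n" and B: "B \<in> carrier_mat n m" and C: "C \<in> carrier_mat p n" and D: "D \<in> carrier_mat p m"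
    and V: "V \<subseteq> carrier_vec n" and fV: "fsubspace n (fn ` V)"
  shows "internally_stabilizable Cg A B C D V \<longleftrightarrow> (\<exists>F \<in> carrier_mat m n. 
     (\<forall>x \<in> fn ` V. act A x + act B (act F x) \<in> fn ` V \<and> act C x + act D (act F x) = 0) \<and> stable_on Cg (A + B * F) (fn ` V))"
proof -
  let ?V = "fn ` V"
  have dims: "dim_row A = n" "dim_row C = p" "dim_col B = m" using A B C by auto
  have e: "V \<oplus>\<^sub>v {0\<^sub>v p} \<subseteq> carrier_vec (n + p)" using V by (intro ext_sum_carrier) auto
  have z: "fn ` {0\<^sub>v p} = {0 :: real fvec}" by (simp add: fn_algebra)
  have "mat_image ((A + B * F) @\<^sub>r (C + D * F)) V \<subseteq> V \<oplus>\<^sub>v {0\<^sub>v p} \<longleftrightarrow> 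
    (\<forall>x \<in> ?V. act A x + act B (act F x) \<in> ?V \<and> act C x + act D (act F x) = 0)"
    if F: "F \<in> carrier_mat m n" for F
  proof -
    have c: "A + B * F \<in> carrier_mat n n" "C + D * F \<in> carrier_mat p n" using A B C D F by auto
    have cc: "(A + B * F) @\<^sub>r (C + D * F) \<in> carrier_mat (n + p) n" using c by auto
    have "mat_image ((A + B * F) @\<^sub>r (C + D * F)) V \<subseteq> V \<oplus>\<^sub>v {0\<^sub>v p} \<longleftrightarrow> 
      act ((A + B * F) @\<^sub>r (C + D * F)) ` ?V \<subseteq> stack_set n ?V {0}"
      by (subst fn_image_subset[OF mat_image_carrier[OF cc] e])
        (simp only: fn_mat_image[OF cc V] fn_ext_sum[OF V] z)
    also have "\<dots> \<longleftrightarrow> (\<forall>x \<in> ?V. act A x + act B (act F x) \<in> ?V \<and> act C x + act D (act F x) = 0)"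
    proof -
      have "act ((A + B * F) @\<^sub>r (C + D * F)) x \<in> stack_set n ?V {0} \<longleftrightarrow> 
        act A x + act B (act F x) \<in> ?V \<and> act C x + act D (act F x) = 0" for x
      proof -
        have "stack n (act A x + act B (act F x)) (act C x + act D (act F x)) = stack n v 0 \<longleftrightarrow>
          act A x + act B (act F x) = v \<and> act C x + act D (act F x) = 0" if "v \<in> ?V" for v
          using that fn_subset_supp[OF V] A B by (intro stack_eq_iff) auto
        then show ?thesis
          unfolding act_append_rows[OF c] act_feedback[OF A B F] act_feedback[OF C D F] stack_set_def by blast
      qed
      then show ?thesis by (simp only: image_subset_iff)
    qed
    finally show ?thesis .
  qed
  moreover have "spectrum_on (A + B * F) V \<subseteq> Cg \<longleftrightarrow> stable_on Cg (A + B * F) ?V" if F: "F \<in> carrier_mat m n" for F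
  proof -
    have M: "A + B * F \<in> carrier_mat n n" using A B F by auto
    show ?thesis by (rule spectrum_on_iff[OF M V fV])
  qed
  ultimately have "output_nulling_friend A B C D V F \<and> spectrum_on (A + B * F) V \<subseteq> Cg \<longleftrightarrow> F \<in> carrier_mat m n \<and>
     (\<forall>x \<in> ?V. act A x + act B (act F x) \<in> ?V \<and> act C x + act D (act F x) = 0) \<and> stable_on Cg (A + B * F) ?V" for F
    unfolding output_nulling_friend_def dims by (cases "F \<in> carrier_mat m n") (simp_all only: simp_thms)
  then show ?thesis unfolding internally_stabilizable_def Bex_def by (simp only: conj_assoc)
qed

lemma input_containing_iff:
  assumes A: "A \<in> carrier_mat n n" and B: "B \<in> carrier_mat n m" and C: "C \<in> carrier_mat p n" and D: "D \<in> carrier_mat p m"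
  shows "input_containing A B C D S \<longleftrightarrow> S \<subseteq> carrier_vec n \<and> in_containing A B C D (fn ` S)"
proof (cases "S \<subseteq> carrier_vec n")
  case True
  let ?S = "fn ` S"
  have dims: "dim_row A = n" "dim_col B = m" using A B by auto
  have AB: "A @\<^sub>c B \<in> carrier_mat n (n + m)" "C @\<^sub>c D \<in> carrier_mat p (n + m)" using A B C D by auto
  have e: "S \<oplus>\<^sub>v carrier_vec m \<subseteq> carrier_vec (n + m)" using True by (intro ext_sum_carrier) auto
  have ek: "(S \<oplus>\<^sub>v carrier_vec m) \<inter> mat_kernel (C @\<^sub>c D) \<subseteq> carrier_vec (n + m)" using e by blast
  have k: "mat_kernel (C @\<^sub>c D) \<subseteq> carrier_vec (n + m)" using AB(2) by (auto simp: mat_kernel_def)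
  have "fn ` ((S \<oplus>\<^sub>v carrier_vec m) \<inter> mat_kernel (C @\<^sub>c D)) = fn ` (S \<oplus>\<^sub>v carrier_vec m) \<inter> fn ` mat_kernel (C @\<^sub>c D)"
    by (rule inj_on_image_Int[OF _ e k]) (auto simp: inj_on_def fn_inj)
  then have i: "fn ` ((S \<oplus>\<^sub>v carrier_vec m) \<inter> mat_kernel (C @\<^sub>c D)) = stack_set n ?S (supp m) \<inter> {x \<in> supp (n + m). act (C @\<^sub>c D) x = 0}"
    by (simp only: fn_ext_sum[OF True] fn_carrier fn_mat_kernel[OF AB(2)])
  have "mat_image (A @\<^sub>c B) ((S \<oplus>\<^sub>v carrier_vec m) \<inter> mat_kernel (C @\<^sub>c D)) \<subseteq> S \<longleftrightarrow>
    act (A @\<^sub>c B) ` (stack_set n ?S (supp m) \<inter> {x \<in> supp (n + m). act (C @\<^sub>c D) x = 0}) \<subseteq> ?S"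
    by (subst fn_image_subset[OF mat_image_carrier[OF AB(1)] True]) (simp only: fn_mat_image[OF AB(1) ek] i)
  also have "\<dots> \<longleftrightarrow> (\<forall>x\<in>?S. \<forall>u. act C x + act D u = 0 \<longrightarrow> act A x + act B u \<in> ?S)"
  proof
    assume h: "act (A @\<^sub>c B) ` (stack_set n ?S (supp m) \<inter> {x \<in> supp (n + m). act (C @\<^sub>c D) x = 0}) \<subseteq> ?S"
    show "\<forall>x\<in>?S. \<forall>u. act C x + act D u = 0 \<longrightarrow> act A x + act B u \<in> ?S"
    proof (intro ballI allI impI)
      fix x u assume x: "x \<in> ?S" and z: "act C x + act D u = 0"
      have "stack n x (trunc m u) \<in> stack_set n ?S (supp m)"
        by (intro stack_setI x trunc_supp)
      moreover have "stack n x (trunc m u) \<in> supp (n + m)" by simp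
      moreover have "act (C @\<^sub>c D) (stack n x (trunc m u)) = 0" using z D by (simp add: act_append_cols[OF C D])
      ultimately have "act (A @\<^sub>c B) (stack n x (trunc m u)) \<in> ?S"
        by (intro subsetD[OF h] imageI IntI CollectI conjI)
      then show "act A x + act B u \<in> ?S" using B by (simp add: act_append_cols[OF A B])
    qed
  next
    assume h: "\<forall>x\<in>?S. \<forall>u. act C x + act D u = 0 \<longrightarrow> act A x + act B u \<in> ?S"
    show "act (A @\<^sub>c B) ` (stack_set n ?S (supp m) \<inter> {x \<in> supp (n + m). act (C @\<^sub>c D) x = 0}) \<subseteq> ?S"
    proof
      fix y assume "y \<in> act (A @\<^sub>c B) ` (stack_set n ?S (supp m) \<inter> {x \<in> supp (n + m). act (C @\<^sub>c D) x = 0})"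
      then obtain x u where "y = act (A @\<^sub>c B) (stack n x u)" "x \<in> ?S" "act (C @\<^sub>c D) (stack n x u) = 0"
        unfolding stack_set_def by blast
      then show "y \<in> ?S" using h unfolding act_append_cols[OF A B] act_append_cols[OF C D] by blast
    qed
  qed
  finally show ?thesis
    unfolding input_containing_def in_containing_def dims fsubspace_image[OF True, symmetric] using True by simp
next
  case False
  then show ?thesis using A unfolding input_containing_def by (auto simp: real_subspace_iff)
qed

lemma stack_set_image_iff: 
  assumes "\<And>x u. P (stack n x u) \<longleftrightarrow> Q x u" "\<And>x u. Q x (trunc m u) \<longleftrightarrow> Q x u"
  shows "(\<forall>z \<in> stack_set n X (supp m). P z) \<longleftrightarrow> (\<forall>x \<in> X. \<forall>u. Q x u)"
proof
  assume h: "\<forall>z \<in> stack_set n X (supp m). P z"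
  show "\<forall>x \<in> X. \<forall>u. Q x u"
  proof (intro ballI allI)
    fix x u assume "x \<in> X"
    then have "stack n x (trunc m u) \<in> stack_set n X (supp m)" by (intro stack_setI trunc_supp)
    with h have "P (stack n x (trunc m u))" by blast
    then show "Q x u" using assms by blast
  qed
next
  assume "\<forall>x \<in> X. \<forall>u. Q x u"
  then show "\<forall>z \<in> stack_set n X (supp m). P z" unfolding stack_set_def using assms(1) by blast
qed

lemma externally_detectable_iff:
  assumes A: "A \<in> carrier_mat n n" and B: "B \<in> carrier_mat n m" and C: "C \<in> carrier_mat p n" and D: "D \<in> carrier_mat p m"
    and S: "S \<subseteq> carrier_vec n"
  shows "externally_detectable Cg A B C D S \<longleftrightarrow> (\<exists>G \<in> carrier_mat n p. 
     (\<forall>x \<in> fn ` S. \<forall>u. act A x + act B u + act G (act C x + act D u) \<in> fn ` S) \<and> stable_quot Cg (A + G * C) (fn ` S))"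
proof -
  let ?S = "fn ` S"
  have dims: "dim_row A = n" "dim_row C = p" "dim_col B = m" using A B C by auto
  have e: "S \<oplus>\<^sub>v carrier_vec m \<subseteq> carrier_vec (n + m)" using S by (intro ext_sum_carrier) auto
  have "mat_image ((A + G * C) @\<^sub>c (B + G * D)) (S \<oplus>\<^sub>v carrier_vec m) \<subseteq> S \<longleftrightarrow>
     (\<forall>x \<in> ?S. \<forall>u. act A x + act B u + act G (act C x + act D u) \<in> ?S)" if G: "G \<in> carrier_mat n p" for G
  proof -
    have c: "A + G * C \<in> carrier_mat n n" "B + G * D \<in> carrier_mat n m" using A B C D G by auto
    have cc: "(A + G * C) @\<^sub>c (B + G * D) \<in> carrier_mat n (n + m)" using c by auto
    have "mat_image ((A + G * C) @\<^sub>c (B + G * D)) (S \<oplus>\<^sub>v carrier_vec m) \<subseteq> S \<longleftrightarrow> 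
      act ((A + G * C) @\<^sub>c (B + G * D)) ` stack_set n ?S (supp m) \<subseteq> ?S"
      by (subst fn_image_subset[OF mat_image_carrier[OF cc] S]) (simp only: fn_mat_image[OF cc e] fn_ext_sum[OF S] fn_carrier)
    also have "\<dots> \<longleftrightarrow> (\<forall>x \<in> ?S. \<forall>u. act A x + act B u + act G (act C x + act D u) \<in> ?S)"
      unfolding image_subset_iff
    proof (rule stack_set_image_iff)
      show "act ((A + G * C) @\<^sub>c (B + G * D)) (stack n x u) \<in> ?S \<longleftrightarrow> act A x + act B u + act G (act C x + act D u) \<in> ?S" for x u
        unfolding act_append_cols[OF c] act_feedback[OF A G C] act_feedback[OF B G D] by (simp add: add_ac)
    qed (use B D in simp)
    finally show ?thesis .
  qed
  moreover have "spectrum_quot (A + G * C) S \<subseteq> Cg \<longleftrightarrow> stable_quot Cg (A + G * C) ?S" if G: "G \<in> carrier_mat n p" for G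
    by (rule spectrum_quot_iff[OF _ S]) (use A C G in auto)
  ultimately have "input_containing_friend A B C D S G \<and> spectrum_quot (A + G * C) S \<subseteq> Cg \<longleftrightarrow> G \<in> carrier_mat n p \<and>
     (\<forall>x \<in> ?S. \<forall>u. act A x + act B u + act G (act C x + act D u) \<in> ?S) \<and> stable_quot Cg (A + G * C) ?S" for G
    unfolding input_containing_friend_def dims by (cases "G \<in> carrier_mat n p") (simp_all only: simp_thms)
  then show ?thesis unfolding externally_detectable_def Bex_def by (simp only: conj_assoc)
qed

lemma fn_vset: "V \<subseteq> supp n \<Longrightarrow> fn ` (vec n ` V) = V"
  unfolding image_image by (auto simp: subset_iff image_iff)

lemma V_star_eq:
  assumes A: "A \<in> carrier_mat n n" and B: "B \<in> carrier_mat n m" and C: "C \<in> carrier_mat p n" and D: "D \<in> carrier_mat p m"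
  shows "V_star A B C D \<subseteq> carrier_vec n" "fn ` V_star A B C D = Vst A B C D"
proof -
  have out_nulling: "out_nulling A B C D (Vst A B C D)" by (rule out_nulling_Vst)
  have s: "Vst A B C D \<subseteq> supp n" using out_nulling A unfolding out_nulling_def fsubspace_def by simp
  have c: "vec n ` Vst A B C D \<subseteq> carrier_vec n" by auto
  have "V_star A B C D = vec n ` Vst A B C D"
    unfolding V_star_def
  proof (rule Greatest_equality)
    show "output_nulling A B C D (vec n ` Vst A B C D)"
      unfolding output_nulling_iff[OF assms] fn_vset[OF s] using out_nulling c by simp
    fix V assume "output_nulling A B C D V"
    then have V: "V \<subseteq> carrier_vec n" "out_nulling A B C D (fn ` V)" unfolding output_nulling_iff[OF assms] by auto
    show "V \<le> vec n ` Vst A B C D"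
      unfolding fn_image_subset[OF V(1) c] fn_vset[OF s] by (rule Vst_greatest[OF V(2)])
  qed
  then show "V_star A B C D \<subseteq> carrier_vec n" "fn ` V_star A B C D = Vst A B C D" using c fn_vset[OF s] by auto
qed

lemma S_star_eq:
  assumes A: "A \<in> carrier_mat n n" and B: "B \<in> carrier_mat n m" and C: "C \<in> carrier_mat p n" and D: "D \<in> carrier_mat p m"
  shows "S_star A B C D \<subseteq> carrier_vec n" "fn ` S_star A B C D = Sst A B C D"
proof -
  have in_containing: "in_containing A B C D (Sst A B C D)" by (rule in_containing_Sst[OF A B])
  have s: "Sst A B C D \<subseteq> supp n" using in_containing A unfolding in_containing_def fsubspace_def by simp
  have c: "vec n ` Sst A B C D \<subseteq> carrier_vec n" by auto
  have "S_star A B C D = vec n ` Sst A B C D"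
    unfolding S_star_def
  proof (rule Least_equality)
    show "input_containing A B C D (vec n ` Sst A B C D)"
      unfolding input_containing_iff[OF assms] fn_vset[OF s] using in_containing c by simp
    fix S assume "input_containing A B C D S"
    then have S: "S \<subseteq> carrier_vec n" "in_containing A B C D (fn ` S)" unfolding input_containing_iff[OF assms] by auto
    show "vec n ` Sst A B C D \<le> S"
      unfolding fn_image_subset[OF c S(1)] fn_vset[OF s] by (rule Sst_least[OF S(2)])
  qed
  then show "S_star A B C D \<subseteq> carrier_vec n" "fn ` S_star A B C D = Sst A B C D" using c fn_vset[OF s] by auto
qed

section \<open>Solvability of the decoupling problem\<close>

lemma condition_A_intro:
  assumes B: "B \<in> carrier_mat n m" and H: "H \<in> carrier_mat n q" and Dz: "Dz \<in> carrier_mat r m" and Gz: "Gz \<in> carrier_mat r q"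
    and V: "V \<subseteq> carrier_vec n"
    and h: "\<And>w. \<exists>u. act H w + act B u \<in> fn ` V \<and> act Gz w + act Dz u = 0"
  shows "mat_range (H @\<^sub>r Gz) \<subseteq> (V \<oplus>\<^sub>v {0\<^sub>v r}) + mat_range (B @\<^sub>r Dz)"
proof -
  have z: "fn ` {0\<^sub>v r} = {0 :: real fvec}" by (simp add: fn_algebra)
  have c: "H @\<^sub>r Gz \<in> carrier_mat (n + r) q" "B @\<^sub>r Dz \<in> carrier_mat (n + r) m" using B H Dz Gz by auto
  have e: "V \<oplus>\<^sub>v {0\<^sub>v r} \<subseteq> carrier_vec (n + r)" using V by (intro ext_sum_carrier) auto
  have "range (act (H @\<^sub>r Gz)) \<subseteq> stack_set n (fn ` V) {0} + range (act (B @\<^sub>r Dz) :: real fvec \<Rightarrow> real fvec)"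
  proof
    fix y :: "real fvec" assume "y \<in> range (act (H @\<^sub>r Gz))"
    then obtain w where y: "y = act (H @\<^sub>r Gz) w" by auto
    obtain u where u: "act H w + act B u \<in> fn ` V" "act Gz w + act Dz u = 0" using h by blast
    have "y = stack n (act H w + act B u) (act Gz w + act Dz u) + act (B @\<^sub>r Dz) (- u)"
      by (simp add: y act_append_rows[OF H Gz] act_append_rows[OF B Dz] stack_linear)
    moreover have "stack n (act H w + act B u) (act Gz w + act Dz u) \<in> stack_set n (fn ` V) {0}"
      using u by (intro stack_setI) auto
    ultimately show "y \<in> stack_set n (fn ` V) {0} + range (act (B @\<^sub>r Dz))"
      by (metis rangeI set_plus_intro)
  qed
  then show ?thesis
    by (subst fn_image_subset[OF mat_image_carrier[OF c(1)] set_plus_carrier[OF e mat_image_carrier[OF c(2)]]])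
      (simp only: fn_mat_range[OF c(1)] fn_set_plus[OF e mat_image_carrier[OF c(2)]] fn_mat_range[OF c(2)] fn_ext_sum[OF V] z)
qed

lemma condition_B_intro:
  assumes C: "C \<in> carrier_mat p n" and Gy: "Gy \<in> carrier_mat p q" and E: "E \<in> carrier_mat r n" and Gz: "Gz \<in> carrier_mat r q"
    and S: "S \<subseteq> carrier_vec n"
    and h: "\<And>x w. x \<in> fn ` S \<Longrightarrow> act C x + act Gy w = 0 \<Longrightarrow> act E x + act Gz w = 0"
  shows "(S \<oplus>\<^sub>v carrier_vec q) \<inter> mat_kernel (C @\<^sub>c Gy) \<subseteq> mat_kernel (E @\<^sub>c Gz)"
proof -
  have c: "C @\<^sub>c Gy \<in> carrier_mat p (n + q)" "E @\<^sub>c Gz \<in> carrier_mat r (n + q)" using C Gy E Gz by auto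
  have e: "S \<oplus>\<^sub>v carrier_vec q \<subseteq> carrier_vec (n + q)" using S by (intro ext_sum_carrier) auto
  have k: "mat_kernel M \<subseteq> carrier_vec (n + q)" if "M \<in> carrier_mat i (n + q)" for i and M :: "real mat"
    using that by (auto simp: mat_kernel_def)
  have i: "fn ` ((S \<oplus>\<^sub>v carrier_vec q) \<inter> mat_kernel (C @\<^sub>c Gy)) = 
      stack_set n (fn ` S) (supp q) \<inter> {x \<in> supp (n + q). act (C @\<^sub>c Gy) x = 0}"
    by (subst inj_on_image_Int[OF _ e k[OF c(1)]]) 
      (auto simp: inj_on_def fn_inj fn_ext_sum[OF S] fn_carrier fn_mat_kernel[OF c(1)])
  have "stack_set n (fn ` S) (supp q) \<inter> {x \<in> supp (n + q). act (C @\<^sub>c Gy) x = 0} \<subseteq> {x \<in> supp (n + q). act (E @\<^sub>c Gz) x = 0}"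
  proof
    fix y assume "y \<in> stack_set n (fn ` S) (supp q) \<inter> {x \<in> supp (n + q). act (C @\<^sub>c Gy) x = 0}"
    then obtain x w where y: "y = stack n x w" "x \<in> fn ` S" "y \<in> supp (n + q)" "act (C @\<^sub>c Gy) (stack n x w) = 0"
      unfolding stack_set_def by blast
    have "act C x + act Gy w = 0" using y(4) unfolding act_append_cols[OF C Gy] .
    then have "act (E @\<^sub>c Gz) y = 0" unfolding y(1) act_append_cols[OF E Gz] by (rule h[OF y(2)])
    then show "y \<in> {x \<in> supp (n + q). act (E @\<^sub>c Gz) x = 0}" using y(3) by simp
  qed
  moreover have ek: "(S \<oplus>\<^sub>v carrier_vec q) \<inter> mat_kernel (C @\<^sub>c Gy) \<subseteq> carrier_vec (n + q)" using e by blast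
  ultimately show ?thesis
    by (subst fn_image_subset[OF ek k[OF c(2)]]) (simp only: i fn_mat_kernel[OF c(2)])
qed

lemma condition_F_iff:
  assumes A: "A \<in> carrier_mat n n" and B: "B \<in> carrier_mat n m" and H: "H \<in> carrier_mat n q"
    and C: "C \<in> carrier_mat p n" and Gy: "Gy \<in> carrier_mat p q"
    and E: "E \<in> carrier_mat r n" and Dz: "Dz \<in> carrier_mat r m" and Gz: "Gz \<in> carrier_mat r q"
    and K: "K \<in> carrier_mat m p" and S: "S \<subseteq> carrier_vec n" and V: "V \<subseteq> carrier_vec n"
  shows "mat_image (four_block_mat (A + B * K * C) (H + B * K * Gy) (E + Dz * K * C) (Gz + Dz * K * Gy))
     (S \<oplus>\<^sub>v carrier_vec q) \<subseteq> V \<oplus>\<^sub>v {0\<^sub>v r} \<longleftrightarrow>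
   (\<forall>x \<in> fn ` S. \<forall>w. act A x + act B (act K (act C x)) + (act H w + act B (act K (act Gy w))) \<in> fn ` V \<and>
     act E x + act Dz (act K (act C x)) + (act Gz w + act Dz (act K (act Gy w))) = 0)" (is "?lhs \<longleftrightarrow> ?rhs")
proof -
  let ?M = "four_block_mat (A + B * K * C) (H + B * K * Gy) (E + Dz * K * C) (Gz + Dz * K * Gy)"
  have c: "A + B * K * C \<in> carrier_mat n n" "H + B * K * Gy \<in> carrier_mat n q" "E + Dz * K * C \<in> carrier_mat r n" 
    "Gz + Dz * K * Gy \<in> carrier_mat r q"
    by (rule carrier_matI; simp add: carrier_matD[OF A] carrier_matD[OF B] carrier_matD[OF C] carrier_matD[OF H] 
        carrier_matD[OF Gy] carrier_matD[OF E] carrier_matD[OF Dz] carrier_matD[OF Gz])+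
  have M: "?M \<in> carrier_mat (n + r) (n + q)" by (rule four_block_carrier_mat[OF c(1,4)])
  have z: "fn ` {0\<^sub>v r} = {0 :: real fvec}" by (simp add: fn_algebra)
  have e: "S \<oplus>\<^sub>v carrier_vec q \<subseteq> carrier_vec (n + q)" "V \<oplus>\<^sub>v {0\<^sub>v r} \<subseteq> carrier_vec (n + r)" 
    by (rule ext_sum_carrier[OF S]; simp) (rule ext_sum_carrier[OF V]; simp)
  have act: "act ?M (stack n x w) = stack n (act A x + act B (act K (act C x)) + (act H w + act B (act K (act Gy w))))
     (act E x + act Dz (act K (act C x)) + (act Gz w + act Dz (act K (act Gy w))))" for x w :: "real fvec"
    unfolding act_four_block[OF c] using A B C E H K Gy Gz Dz by (simp add: act_add act_mult)
  have "?lhs \<longleftrightarrow> act ?M ` stack_set n (fn ` S) (supp q) \<subseteq> stack_set n (fn ` V) {0}"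
    by (subst fn_image_subset[OF mat_image_carrier[OF M] e(2)])
      (simp only: fn_mat_image[OF M e(1)] fn_ext_sum[OF S] fn_ext_sum[OF V] fn_carrier z)
  also have "\<dots> \<longleftrightarrow> ?rhs"
    unfolding image_subset_iff
  proof (rule stack_set_image_iff)
    fix x w :: "real fvec"
    have jj: "stack n a b \<in> stack_set n (fn ` V) {0} \<longleftrightarrow> a \<in> fn ` V \<and> b = 0" if a: "a \<in> supp n" for a b
    proof
      assume "stack n a b \<in> stack_set n (fn ` V) {0}"
      then obtain v where v: "v \<in> fn ` V" "stack n a b = stack n v 0" unfolding stack_set_def by blast
      have "v \<in> supp n" using v(1) fn_subset_supp[OF V] by blast
      then have "a = v \<and> b = 0" using v(2) a by (simp add: stack_eq_iff)
      with v(1) show "a \<in> fn ` V \<and> b = 0" by blast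
    qed (auto intro: stack_setI)
    show "act ?M (stack n x w) \<in> stack_set n (fn ` V) {0} \<longleftrightarrow>
      act A x + act B (act K (act C x)) + (act H w + act B (act K (act Gy w))) \<in> fn ` V \<and>
     act E x + act Dz (act K (act C x)) + (act Gz w + act Dz (act K (act Gy w))) = 0"
      unfolding act by (rule jj) (use A B H in simp)
  qed (use H Gy Gz in simp)
  finally show ?thesis .
qed

text \<open>Split x = v + s with v in V1 and s in S1, and take w1 that keeps v in V1 with zero outputs.  The rest
  of the motion starts in s with disturbance w - w1 and has the same measurement.  As S1 \<subseteq> S*, it
  leads into V*, and self_bounded replaces V* by V_m + S_M.\<close>

lemma feedthrough_maps_SM_to_VM:
  assumes A: "A \<in> carrier_mat n n" and B: "B \<in> carrier_mat n m" and H: "H \<in> carrier_mat n q"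
    and C: "C \<in> carrier_mat p n" and Gy: "Gy \<in> carrier_mat p q"
    and E: "E \<in> carrier_mat r n" and Dz: "Dz \<in> carrier_mat r m" and Gz: "Gz \<in> carrier_mat r q"
    and VM: "out_nulling A B E Dz (Vm A B H E Dz Gz + SM A H C Gy E Gz)"
    and KS: "\<And>x w. x \<in> Sst A H C Gy \<Longrightarrow> act A x + act B (act K (act C x)) + (act H w + act B (act K (act Gy w))) \<in> Vst A B E Dz \<and>
     act E x + act Dz (act K (act C x)) + (act Gz w + act Dz (act K (act Gy w))) = 0"
    and x: "x \<in> SM A H C Gy E Gz"
  shows "act A x + act H w + act B (act K (act C x + act Gy w)) \<in> Vm A B H E Dz Gz + SM A H C Gy E Gz"
    "act E x + act Gz w + act Dz (act K (act C x + act Gy w)) = 0"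
proof -
  note car = A B H C Gy E Dz Gz
  let ?VM = "Vm A B H E Dz Gz + SM A H C Gy E Gz" and ?V1 = "Vst A H (C @\<^sub>r E) (Gy @\<^sub>r Gz)" and ?S1 = "Sst A H (C @\<^sub>r E) (Gy @\<^sub>r Gz)"
  have fVM: "fsubspace n ?VM" by (intro fsubspace_sum Vm_fsubspace[OF car] SM_fsubspace[OF car])
  have sub: "Vm A B H E Dz Gz \<subseteq> ?VM" "SM A H C Gy E Gz \<subseteq> ?VM"
    by (rule set_plus_superset[OF Vm_fsubspace[OF car] SM_fsubspace[OF car]])+
  have sub1: "?V1 \<subseteq> SM A H C Gy E Gz" "?S1 \<subseteq> SM A H C Gy E Gz"
    unfolding SM_def by (rule set_plus_superset[OF Vst_fsubspace[OF car] Sst_fsubspace[OF car H]])+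
  obtain v s where vs: "x = v + s" "v \<in> ?V1" "s \<in> ?S1" using x unfolding SM_def by (rule set_plus_elim)
  obtain w1 where w1: "act A v + act H w1 \<in> ?V1" "act C v + act Gy w1 = 0" "act E v + act Gz w1 = 0"
    using V1_out_nulling[OF car vs(2)] by blast
  have s: "s \<in> Sst A H C Gy" using vs(3) S1_sub_S[OF car] by blast
  let ?w = "w - w1" and ?u = "act K (act C s + act Gy (w - w1))"
  have 1: "act A s + act B ?u + act H ?w \<in> Vst A B E Dz" "act E s + act Dz ?u + act Gz ?w = 0"
    using KS[OF s, of ?w] by (simp_all add: algebra_simps)
  have "act A s + act B ?u + act H ?w \<in> ?VM"
    by (rule self_bounded[OF car VM sub(1) _ 1]) (use vs(3) sub1 sub in blast)
  moreover have "act A v + act H w1 \<in> ?VM" using w1(1) sub1 sub by blast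
  ultimately have 2: "(act A v + act H w1) + (act A s + act B ?u + act H ?w) \<in> ?VM" by (rule fsubspaceD(3)[OF fVM, rotated])
  have "act C x + act Gy w = (act C v + act Gy w1) + (act C s + act Gy ?w)" by (simp add: vs(1) algebra_simps)
  then have y: "act C x + act Gy w = act C s + act Gy ?w" by (simp only: w1 add_0_left)
  have "(act A v + act H w1) + (act A s + act B ?u + act H ?w) = act A x + act H w + act B ?u" 
    by (simp add: vs(1) algebra_simps)
  with 2 show "act A x + act H w + act B (act K (act C x + act Gy w)) \<in> ?VM" unfolding y by (simp only:)
  have "act E x + act Gz w + act Dz ?u = (act E v + act Gz w1) + (act E s + act Dz ?u + act Gz ?w)" 
    by (simp add: vs(1) algebra_simps)
  then show "act E x + act Gz w + act Dz (act K (act C x + act Gy w)) = 0" unfolding y by (simp only: w1 1 add_0_left)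
qed

lemma spectrum_feedback_stable:
  assumes A: "A \<in> carrier_mat n n" and B: "B \<in> carrier_mat n m" and F: "F \<in> carrier_mat m n"
    and sp: "spectrum (cmat (A + B * F)) \<subseteq> Cg" and k: "k \<notin> Cg"
    and x: "x \<in> supp n" "act A x + act B (act F x) = cst k * x"
  shows "x = (0 :: complex fvec)"
proof -
  have M: "A + B * F \<in> carrier_mat n n" using A B F by auto
  have "no_eigenvector (A + B * F) k" using spectrum_iff[OF M] sp k by blast
  then show ?thesis using x B by (simp add: no_eigenvector_def act_feedback[OF A B F])
qed

theorem theorem5:
  fixes A B H C Dy Gy E Dz Gz :: "real mat"
    and n m q p r :: nat
    and Cg :: "complex set"
  assumes A: "A \<in> carrier_mat n n" and B: "B \<in> carrier_mat n m" and H: "H \<in> carrier_mat n q"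
    and C: "C \<in> carrier_mat p n" and Dy: "Dy \<in> carrier_mat p m" and Gy: "Gy \<in> carrier_mat p q"
    and E: "E \<in> carrier_mat r n" and Dz: "Dz \<in> carrier_mat r m" and Gz: "Gz \<in> carrier_mat r q"
    and Cg: "Cg = {k. Re k < 0} \<or> Cg = {k. cmod k < 1}"
    and stab: "stabilizable Cg A B"
    and det: "detectable Cg C A"
  shows "ddp_output_feedback_solvable Cg A B H C Dy Gy E Dz Gz \<longleftrightarrow>
    (\<exists>K \<in> carrier_mat m p.
       mat_range (H @\<^sub>r Gz) \<subseteq> (V_star A B E Dz \<oplus>\<^sub>v {0\<^sub>v r}) + mat_range (B @\<^sub>r Dz) \<and>
       (S_star A H C Gy \<oplus>\<^sub>v carrier_vec q) \<inter> mat_kernel (C @\<^sub>c Gy) \<subseteq> mat_kernel (E @\<^sub>c Gz) \<and>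
       S_star A H C Gy \<subseteq> V_star A B E Dz \<and>
       (output_nulling A B E Dz (V_m A B H E Dz Gz + S_M A H C Gy E Gz) \<and>
        internally_stabilizable Cg A B E Dz (V_m A B H E Dz Gz + S_M A H C Gy E Gz)) \<and>
       (input_containing A H C Gy (S_M A H C Gy E Gz) \<and>
        externally_detectable Cg A H C Gy (S_M A H C Gy E Gz)) \<and>
       invertible_mat (1\<^sub>m m + K * Dy) \<and>
       mat_image (four_block_mat (A + B * K * C) (H + B * K * Gy)
                                 (E + Dz * K * C) (Gz + Dz * K * Gy))
                 (S_star A H C Gy \<oplus>\<^sub>v carrier_vec q)
         \<subseteq> V_star A B E Dz \<oplus>\<^sub>v {0\<^sub>v r})" (is "_ \<longleftrightarrow> ?rhs")
proof -
  note car = A B H C Gy E Dz Gz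
  have append_BH_carrier: "B @\<^sub>c H \<in> carrier_mat n (m + q)" and DG: "Dz @\<^sub>c Gz \<in> carrier_mat r (m + q)"
    and CE: "C @\<^sub>r E \<in> carrier_mat (p + r) n" and GG: "Gy @\<^sub>r Gz \<in> carrier_mat (p + r) q"
    using A B H C Gy E Dz Gz by auto
  note V = V_star_eq[OF A B E Dz] and S = S_star_eq[OF A H C Gy]
  note V2 = V_star_eq[OF A append_BH_carrier E DG] and S2 = S_star_eq[OF A append_BH_carrier E DG]
  note V1 = V_star_eq[OF A H CE GG] and S1 = S_star_eq[OF A H CE GG]
  have Vm: "V_m A B H E Dz Gz \<subseteq> carrier_vec n" "fn ` V_m A B H E Dz Gz = Vm A B H E Dz Gz"
  proof -
    show "V_m A B H E Dz Gz \<subseteq> carrier_vec n" using V2(1) by (auto simp: V_m_def)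
    show "fn ` V_m A B H E Dz Gz = Vm A B H E Dz Gz"
      unfolding V_m_def Vm_def V2(2)[symmetric] S2(2)[symmetric]
      by (rule inj_on_image_Int[OF _ V2(1) S2(1)]) (auto simp: inj_on_def fn_inj)
  qed
  have SM: "S_M A H C Gy E Gz \<subseteq> carrier_vec n" "fn ` S_M A H C Gy E Gz = SM A H C Gy E Gz"
    unfolding S_M_def SM_def fn_set_plus[OF V1(1) S1(1)] V1(2) S1(2)
    by (rule set_plus_carrier[OF V1(1) S1(1)]) (rule refl)
  let ?VM = "Vm A B H E Dz Gz + SM A H C Gy E Gz"
  have VM: "V_m A B H E Dz Gz + S_M A H C Gy E Gz \<subseteq> carrier_vec n" "fn ` (V_m A B H E Dz Gz + S_M A H C Gy E Gz) = ?VM"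
    using set_plus_carrier[OF Vm(1) SM(1)] fn_set_plus[OF Vm(1) SM(1)] by (simp_all add: Vm(2) SM(2))
  have fVM: "fsubspace n ?VM" by (intro fsubspace_sum Vm_fsubspace[OF car] SM_fsubspace[OF car])
  \<comment> \<open>A real point of the stability region, to serve as eigenvalue of all redundant modes.\<close>
  define c :: real where "c = (if Cg = {k. Re k < 0} then - 1 else 0)"
  have c: "complex_of_real c \<in> Cg" using Cg by (auto simp: c_def)
  note F_iff = condition_F_iff[OF car _ S(1) V(1), unfolded S(2) V(2)]
  note D_iff = output_nulling_iff[OF A B E Dz, of "V_m A B H E Dz Gz + S_M A H C Gy E Gz", unfolded VM(2)]
    internally_stabilizable_iff[OF A B E Dz VM(1), unfolded VM(2), OF fVM]
  note E_iff = input_containing_iff[OF A H C Gy, of "S_M A H C Gy E Gz", unfolded SM(2)]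
    externally_detectable_iff[OF A H C Gy SM(1), unfolded SM(2)]
  show ?thesis
  proof
    assume "ddp_output_feedback_solvable Cg A B H C Dy Gy E Dz Gz"
    then obtain s Ac Bc Cc K L where c': "Ac \<in> carrier_mat s s" "Bc \<in> carrier_mat s p" "Cc \<in> carrier_mat m s"
      and K: "K \<in> carrier_mat m p" and inv: "invertible_mat (1\<^sub>m m + K * Dy)"
      and G0: "\<And>w :: real fvec. act Gz w + act Dz (act K (act Gy w)) = 0"
      and L: "closed_loop_decoupled n s A B H C Gy E Dz Ac Bc Cc K L"
      and st: "closed_loop_stable Cg n s A B C Ac Bc Cc K"
      unfolding ddp_iff[OF A B H C Dy Gy E Dz Gz] by blast
    note hyp = car c' K G0 st
    note F = feedthrough_maps_Sst_to_Vst[OF hyp L]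
    have F': "mat_image (four_block_mat (A + B * K * C) (H + B * K * Gy) (E + Dz * K * C) (Gz + Dz * K * Gy))
                 (S_star A H C Gy \<oplus>\<^sub>v carrier_vec q) \<subseteq> V_star A B E Dz \<oplus>\<^sub>v {0\<^sub>v r}"
      unfolding F_iff[OF K] using F by blast
    have A': "mat_range (H @\<^sub>r Gz) \<subseteq> (V_star A B E Dz \<oplus>\<^sub>v {0\<^sub>v r}) + mat_range (B @\<^sub>r Dz)"
    proof (rule condition_A_intro[OF B H Dz Gz V(1)], unfold V(2))
      fix w
      have "0 \<in> Sst A H C Gy" by (rule fsubspaceD(2)[OF Sst_fsubspace[OF car H]])
      from F[OF this, of w] show "\<exists>u. act H w + act B u \<in> Vst A B E Dz \<and> act Gz w + act Dz u = 0" by auto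
    qed
    have B': "(S_star A H C Gy \<oplus>\<^sub>v carrier_vec q) \<inter> mat_kernel (C @\<^sub>c Gy) \<subseteq> mat_kernel (E @\<^sub>c Gz)"
    proof (rule condition_B_intro[OF C Gy E Gz S(1)], unfold S(2))
      fix x w assume x: "x \<in> Sst A H C Gy" and z: "act C x + act Gy w = 0"
      have "act C x = - act Gy w" using z by (simp add: eq_neg_iff_add_eq_0)
      with F(2)[OF x, of w] show "act E x + act Gz w = 0" by (simp add: algebra_simps)
    qed
    have C': "S_star A H C Gy \<subseteq> V_star A B E Dz"
      unfolding fn_image_subset[OF S(1) V(1)] S(2) V(2) by (rule Sst_sub_Vst[OF hyp L])
    obtain F0 where "F0 \<in> carrier_mat m n" 
      "\<And>x. x \<in> ?VM \<Longrightarrow> act A x + act B (act F0 x) \<in> ?VM" "\<And>x. x \<in> ?VM \<Longrightarrow> act E x + act Dz (act F0 x) = 0"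
      "stable_on Cg (A + B * F0) ?VM"
      by (rule out_nulling_stabilization[OF A B E Dz c VM_out_nulling[OF hyp L] VM_resolvent[OF hyp L]]) (assumption+, rule that, assumption+)
    then have D': "output_nulling A B E Dz (V_m A B H E Dz Gz + S_M A H C Gy E Gz) \<and>
        internally_stabilizable Cg A B E Dz (V_m A B H E Dz Gz + S_M A H C Gy E Gz)"
      unfolding D_iff using VM(1) VM_out_nulling[OF hyp L] by blast
    obtain G1 where "G1 \<in> carrier_mat n p" 
      "\<And>x u. x \<in> SM A H C Gy E Gz \<Longrightarrow> act A x + act H u + act G1 (act C x + act Gy u) \<in> SM A H C Gy E Gz"
      "stable_quot Cg (A + G1 * C) (SM A H C Gy E Gz)"
      by (rule in_containing_stabilization[OF A H C Gy c SM_in_containing[OF hyp L] SM_resolvent[OF hyp L]]) (assumption+, rule that, assumption+)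
    then have E': "input_containing A H C Gy (S_M A H C Gy E Gz) \<and> externally_detectable Cg A H C Gy (S_M A H C Gy E Gz)"
      unfolding E_iff using SM(1) SM_in_containing[OF hyp L] by blast
    show ?rhs
      by (intro bexI[OF _ K] conjI A' B' C' D'[THEN conjunct1] D'[THEN conjunct2] E'[THEN conjunct1] E'[THEN conjunct2] inv F')
  next
    assume ?rhs
    then obtain K where K: "K \<in> carrier_mat m p"
      and D1: "output_nulling A B E Dz (V_m A B H E Dz Gz + S_M A H C Gy E Gz)"
      and D2: "internally_stabilizable Cg A B E Dz (V_m A B H E Dz Gz + S_M A H C Gy E Gz)"
      and E2: "externally_detectable Cg A H C Gy (S_M A H C Gy E Gz)"
      and inv: "invertible_mat (1\<^sub>m m + K * Dy)"
      and F: "mat_image (four_block_mat (A + B * K * C) (H + B * K * Gy) (E + Dz * K * C) (Gz + Dz * K * Gy))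
                 (S_star A H C Gy \<oplus>\<^sub>v carrier_vec q) \<subseteq> V_star A B E Dz \<oplus>\<^sub>v {0\<^sub>v r}"
      by (elim bexE conjE) (rule that)
    have out_nulling: "out_nulling A B E Dz ?VM" using D1 unfolding D_iff(1) by blast
    obtain F0 where F0: "F0 \<in> carrier_mat m n" 
      "\<forall>x\<in>?VM. act A x + act B (act F0 x) \<in> ?VM \<and> act E x + act Dz (act F0 x) = 0" "stable_on Cg (A + B * F0) ?VM"
      using D2 unfolding D_iff(2) by blast
    obtain G1 where G1: "G1 \<in> carrier_mat n p" 
      "\<forall>x\<in>SM A H C Gy E Gz. \<forall>u. act A x + act H u + act G1 (act C x + act Gy u) \<in> SM A H C Gy E Gz"
      "stable_quot Cg (A + G1 * C) (SM A H C Gy E Gz)"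
      using E2 unfolding E_iff(2) by blast
    have KS: "act A x + act B (act K (act C x)) + (act H w + act B (act K (act Gy w))) \<in> Vst A B E Dz \<and>
     act E x + act Dz (act K (act C x)) + (act Gz w + act Dz (act K (act Gy w))) = 0" if "x \<in> Sst A H C Gy" for x w
      using F that unfolding F_iff[OF K] by blast
    note KSM = feedthrough_maps_SM_to_VM[OF car out_nulling KS]
    obtain F2 where F2: "F2 \<in> carrier_mat m n" "spectrum (cmat (A + B * F2)) \<subseteq> Cg"
      using stab A B unfolding stabilizable_def by auto
    obtain G2 where G2: "G2 \<in> carrier_mat n p" "spectrum (cmat (A + G2 * C)) \<subseteq> Cg"
      using det A C unfolding detectable_def by auto
    obtain PV where PV: "PV \<in> carrier_mat n n" "\<forall>x :: real fvec. act PV x \<in> ?VM" "\<forall>v \<in> ?VM. act PV v = v"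
      "\<forall>x :: complex fvec. act PV x \<in> cx ?VM" "\<forall>v\<in>cx ?VM. act PV v = v"
      using projection_matrix[OF fVM] by (elim bexE conjE) (rule that)
    obtain PS where PS: "PS \<in> carrier_mat n n" "\<forall>x :: real fvec. act PS x \<in> SM A H C Gy E Gz" "\<forall>v \<in> SM A H C Gy E Gz. act PS v = v"
      "\<forall>x :: complex fvec. act PS x \<in> cx (SM A H C Gy E Gz)" "\<forall>v\<in>cx (SM A H C Gy E Gz). act PS v = v"
      using projection_matrix[OF SM_fsubspace[OF car]] by (elim bexE conjE) (rule that)
    have sub: "SM A H C Gy E Gz \<subseteq> ?VM" by (rule set_plus_superset[OF Vm_fsubspace[OF car] SM_fsubspace[OF car]])
    note mats = car K F0(1) F2(1) G1(1) G2(1) PV(1) PS(1)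
    have geo: "fsubspace n ?VM" "fsubspace n (SM A H C Gy E Gz)" "SM A H C Gy E Gz \<subseteq> ?VM"
      "\<And>x. x \<in> ?VM \<Longrightarrow> act A x + act B (act F0 x) \<in> ?VM" "\<And>x. x \<in> ?VM \<Longrightarrow> act E x + act Dz (act F0 x) = 0"
      "\<And>x w. x \<in> SM A H C Gy E Gz \<Longrightarrow> act A x + act H w + act G1 (act C x + act Gy w) \<in> SM A H C Gy E Gz"
      using fVM SM_fsubspace[OF car] sub F0(2) G1(2) by blast+
    note proj = PV(2)[rule_format] PV(3)[rule_format] PV(4)[rule_format] PV(5)[rule_format]
      PS(2)[rule_format] PS(3)[rule_format] PS(4)[rule_format] PS(5)[rule_format]
    note comp = mats geo KSM proj
    let ?Ac = "comp_A n A B C K F0 F2 G1 G2 PV PS c" and ?Bc = "comp_B n B K G1 G2 PV PS" and ?Cc = "comp_C n C K F0 F2 PS"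
    obtain L where L: "closed_loop_decoupled n (n + (n + n)) A B H C Gy E Dz ?Ac ?Bc ?Cc K L"
      "\<forall>w :: real fvec. act Gz w + act Dz (act K (act Gy w)) = 0"
      by (rule compensator_decouples[OF comp]) (assumption | rule that)+
    have st: "closed_loop_stable Cg n (n + (n + n)) A B C ?Ac ?Bc ?Cc K"
    proof (rule compensator_stable[OF comp])
      show "x = 0" if "k \<notin> Cg" "x \<in> supp n" "act A x + act B (act F2 x) = cst k * x" for k and x :: "complex fvec"
        by (rule spectrum_feedback_stable[OF A B F2 that])
      show "x = 0" if "k \<notin> Cg" "x \<in> supp n" "act A x + act G2 (act C x) = cst k * x" for k and x :: "complex fvec"
        by (rule spectrum_feedback_stable[OF A G2(1) C G2(2) that])
    qed (assumption | rule c F0(3) G1(3))+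
    have cc: "?Ac \<in> carrier_mat (n + (n + n)) (n + (n + n))" "?Bc \<in> carrier_mat (n + (n + n)) p" "?Cc \<in> carrier_mat m (n + (n + n))"
      by (rule comp_carrier[OF mats])+
    show "ddp_output_feedback_solvable Cg A B H C Dy Gy E Dz Gz"
      unfolding ddp_iff[OF A B H C Dy Gy E Dz Gz] using cc K inv L st by blast
  qed
qed

end
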